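(* Let $\pi$ be a probability measure on $\mathbb{R}^d$ with a smooth, strictly positive density, also denoted $\pi$, and let $\gamma:\mathbb{R}^d\to\mathbb{R}^d$ be a smooth vector field with $\nabla\cdot(\gamma\pi)=0$. Suppose that: (i) the density $\pi$ is bounded and, for some $0<\beta<1$, $\liminf_{|x|\to\infty}\left((1-\beta)|\nabla\log\pi(x)|^2+\Delta\log\pi(x)\right)>0$; (ii) $\lim_{|x|\to\infty}|\nabla\log\pi(x)|=\infty$; (iii) $\gamma$ is bounded, i.e. $\gamma\in L^\infty(\mathbb{R}^d;\mathbb{R}^d)$. Let $\mathcal{L}=\mathcal{S}+\alpha\mathcal{A}$ with $\alpha\in\mathbb{R}$. Then $$\left[(-\mathcal{L})^{-1}\right]^{S}=\left[-\mathcal{S}+\alpha^2\mathcal{A}^*(-\mathcal{S})^{-1}\mathcal{A}\right]^{-1},$$ where $\mathcal{A}^*=-\mathcal{A}$ denotes the adjoint of $\mathcal{A}$ in $L^2_0(\pi)$. In particular, for all $f\in L^2_0(\pi)$, $$\sigma_f^2(\alpha)=2\langle f,(-\mathcal{L})^{-1}f\rangle_\pi\le2\langle f,(-\mathcal{S})^{-1}f\rangle_\pi=\sigma_f^2(0).$$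
   Context: $L^2_0(\pi)$ is the space of functions in $L^2(\pi)$ with $\int f\,d\pi=0$, with inner product $\langle\cdot,\cdot\rangle_\pi$. $\mathcal{S}=\nabla\log\pi\cdot\nabla+\Delta$ denotes the nonpositive selfadjoint operator on $L^2_0(\pi)$ associated with the Dirichlet form $\int\nabla f\cdot\nabla g\,d\pi$. $\mathcal{H}^1$ is the Hilbert space of $f\in L^2_0(\pi)$ with $\langle f,(-\mathcal{S})f\rangle_\pi<\infty$ (the form domain), with inner product $\langle f,g\rangle_1=\int\nabla f\cdot\nabla g\,d\pi$; $\mathcal{H}^2$ is the domain of $\mathcal{S}$. Under the stated hypotheses $-\mathcal{S}$ has a spectral gap and is invertible on $L^2_0(\pi)$. $\mathcal{A}=\gamma\cdot\nabla:\mathcal{H}^1\to L^2_0(\pi)$ is a bounded operator, antisymmetric with respect to $\langle\cdot,\cdot\rangle_\pi$. $\mathcal{L}=\mathcal{S}+\alpha\mathcal{A}$ has domain $\mathcal{H}^2$, and $-\mathcal{L}$ is invertible on $L^2_0(\pi)$ for every $\alpha$. The operator $-\mathcal{S}+\alpha^2\mathcal{A}^*(-\mathcal{S})^{-1}\mathcal{A}$ is taken on the domain $\mathcal{H}^2$. For a bounded operator $T$ on $L^2_0(\pi)$, $[T]^S=\frac12(T+T^* )$ is its symmetric part. Asymptotic variance: for $f\in L^2_0(\pi)$ let $\phi\in\mathcal{H}^1$ be the unique solution of $-\mathcal{L}\phi=f$; then $\sigma_f^2(\alpha)=2\int|\nabla\phi|^2\,d\pi=2\langle\phi,(-\mathcal{L})\phi\rangle_\pi$.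 It is the asymptotic variance of the time average of $f$ along the diffusion $dX_t^\gamma=(\nabla\log\pi(X_t^\gamma)+\alpha\gamma(X_t^\gamma))\,dt+\sqrt2\,dW_t$. *)

theory Defs
  imports "HOL-Probability.Probability"
begin

primrec C_k :: "nat \<Rightarrow> ('a::euclidean_space \<Rightarrow> 'b::real_normed_vector) \<Rightarrow> bool" where
  "C_k 0 f \<longleftrightarrow> continuous_on UNIV f"
| "C_k (Suc k) f \<longleftrightarrow> (\<forall>x. f differentiable (at x)) \<and>
     (\<forall>b\<in>Basis. C_k k (\<lambda>x. frechet_derivative f (at x) b))"

definition smooth :: "('a::euclidean_space \<Rightarrow> 'b::real_normed_vector) \<Rightarrow> bool" where
  "smooth f \<longleftrightarrow> (\<forall>k. C_k k f)"

definition grad :: "('a::euclidean_space \<Rightarrow> real) \<Rightarrow> 'a \<Rightarrow> 'a" where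
  "grad f x = (\<Sum>b\<in>Basis. frechet_derivative f (at x) b *\<^sub>R b)"

definition divergence :: "('a::euclidean_space \<Rightarrow> 'a) \<Rightarrow> 'a \<Rightarrow> real" where
  "divergence F x = (\<Sum>b\<in>Basis. frechet_derivative F (at x) b \<bullet> b)"

definition laplacian :: "('a::euclidean_space \<Rightarrow> real) \<Rightarrow> 'a \<Rightarrow> real" where
  "laplacian f x = divergence (grad f) x"

definition test_functions :: "('a::euclidean_space \<Rightarrow> real) set" where
  "test_functions = {\<phi>. smooth \<phi> \<and> compact (closure {x. \<phi> x \<noteq> 0})}"

definition dens_measure :: "('a::euclidean_space \<Rightarrow> real) \<Rightarrow> 'a measure" where
  "dens_measure \<pi> = density lborel (\<lambda>x. ennreal (\<pi> x))"

text \<open>Elements of the Hilbert spaces are represented by Borel functions; two functions that agree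
  almost everywhere represent the same element.\<close>

definition L2 :: "('a::euclidean_space \<Rightarrow> real) \<Rightarrow> ('a \<Rightarrow> 'b::euclidean_space) set" where
  "L2 \<pi> = {f. f \<in> borel_measurable borel \<and> integrable (dens_measure \<pi>) (\<lambda>x. (norm (f x))\<^sup>2)}"

definition L2_inner ::
  "('a::euclidean_space \<Rightarrow> real) \<Rightarrow> ('a \<Rightarrow> 'b::euclidean_space) \<Rightarrow> ('a \<Rightarrow> 'b) \<Rightarrow> real" where
  "L2_inner \<pi> f g = (LINT x|dens_measure \<pi>. f x \<bullet> g x)"

definition L2_norm :: "('a::euclidean_space \<Rightarrow> real) \<Rightarrow> ('a \<Rightarrow> 'b::euclidean_space) \<Rightarrow> real" where
  "L2_norm \<pi> f = sqrt (L2_inner \<pi> f f)"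

definition L20 :: "('a::euclidean_space \<Rightarrow> real) \<Rightarrow> ('a \<Rightarrow> real) set" where
  "L20 \<pi> = {f \<in> L2 \<pi>. (LINT x|dens_measure \<pi>. f x) = 0}"

text \<open>The gradient on \<^term>\<open>L2 \<pi>\<close> is the closure of the classical gradient on smooth compactly
  supported functions. When \<^term>\<open>\<pi>\<close> is a smooth, strictly positive probability density, the closure
  is single-valued up to null sets and agrees with the distributional gradient.\<close>

definition has_L2_gradient ::
  "('a::euclidean_space \<Rightarrow> real) \<Rightarrow> ('a \<Rightarrow> real) \<Rightarrow> ('a \<Rightarrow> 'a) \<Rightarrow> bool" where
  "has_L2_gradient \<pi> f G \<longleftrightarrow> f \<in> L2 \<pi> \<and> G \<in> L2 \<pi> \<and>
     (\<exists>\<phi> :: nat \<Rightarrow> 'a \<Rightarrow> real. (\<forall>n. \<phi> n \<in> test_functions) \<and>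
        (\<lambda>n. L2_norm \<pi> (\<lambda>x. \<phi> n x - f x)) \<longlonglongrightarrow> 0 \<and>
        (\<lambda>n. L2_norm \<pi> (\<lambda>x. grad (\<phi> n) x - G x)) \<longlonglongrightarrow> 0)"

definition L2_grad :: "('a::euclidean_space \<Rightarrow> real) \<Rightarrow> ('a \<Rightarrow> real) \<Rightarrow> 'a \<Rightarrow> 'a" where
  "L2_grad \<pi> f = (SOME G. has_L2_gradient \<pi> f G)"

definition H1 :: "('a::euclidean_space \<Rightarrow> real) \<Rightarrow> ('a \<Rightarrow> real) set" where
  "H1 \<pi> = {f \<in> L20 \<pi>. \<exists>G. has_L2_gradient \<pi> f G}"

definition dirichlet ::
  "('a::euclidean_space \<Rightarrow> real) \<Rightarrow> ('a \<Rightarrow> real) \<Rightarrow> ('a \<Rightarrow> real) \<Rightarrow> real" where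
  "dirichlet \<pi> f g = L2_inner \<pi> (L2_grad \<pi> f) (L2_grad \<pi> g)"

text \<open>An operator on \<^term>\<open>L20 \<pi>\<close> is given by its graph, which contains a pair together with
  all its almost-everywhere modifications. Its domain is \<^const>\<open>Domain\<close>, its inverse is the
  converse relation, and the composition ``first \<open>U\<close>, then \<open>T\<close>'' is \<open>U O T\<close>. Sums have the
  intersection of the domains as domain.\<close>

type_synonym 'a operator = "(('a \<Rightarrow> real) \<times> ('a \<Rightarrow> real)) set"

definition op_scale :: "real \<Rightarrow> 'a operator \<Rightarrow> 'a operator" where
  "op_scale c T = {(f, \<lambda>x. c * u x) | f u. (f, u) \<in> T}"

definition op_plus :: "'a operator \<Rightarrow> 'a operator \<Rightarrow> 'a operator" where
  "op_plus T U = {(f, \<lambda>x. u x + v x) | f u v. (f, u) \<in> T \<and> (f, v) \<in> U}"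

text \<open>A graph scaled by \<open>0\<close> has only the exact zero function as value; adding it to a graph closed
  under almost-everywhere modification restores that closure.\<close>

definition op_restrict :: "'a operator \<Rightarrow> ('a \<Rightarrow> real) set \<Rightarrow> 'a operator" where
  "op_restrict T D = {(f, u) \<in> T. f \<in> D}"

definition op_adjoint :: "('a::euclidean_space \<Rightarrow> real) \<Rightarrow> 'a operator \<Rightarrow> 'a operator" where
  "op_adjoint \<pi> T = {(g, h). g \<in> L20 \<pi> \<and> h \<in> L20 \<pi> \<and>
     (\<forall>(f, u) \<in> T. L2_inner \<pi> u g = L2_inner \<pi> f h)}"

definition op_apply :: "'a operator \<Rightarrow> ('a \<Rightarrow> real) \<Rightarrow> ('a \<Rightarrow> real)" where
  "op_apply T f = (SOME u. (f, u) \<in> T)"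

definition is_operator :: "('a::euclidean_space \<Rightarrow> real) \<Rightarrow> 'a operator \<Rightarrow> bool" where
  "is_operator \<pi> T \<longleftrightarrow> T \<subseteq> L20 \<pi> \<times> L20 \<pi> \<and>
     (\<forall>f u g v a b. (f, u) \<in> T \<longrightarrow> (g, v) \<in> T \<longrightarrow>
        (\<lambda>x. a * f x + b * g x, \<lambda>x. a * u x + b * v x) \<in> T) \<and>
     (\<forall>f u g v. (f, u) \<in> T \<longrightarrow> g \<in> L20 \<pi> \<longrightarrow> v \<in> L20 \<pi> \<longrightarrow>
        (AE x in dens_measure \<pi>. f x = g x) \<longrightarrow>
        ((g, v) \<in> T \<longleftrightarrow> (AE x in dens_measure \<pi>. u x = v x)))"

definition bounded_operator :: "('a::euclidean_space \<Rightarrow> real) \<Rightarrow> 'a operator \<Rightarrow> bool" where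
  "bounded_operator \<pi> T \<longleftrightarrow> is_operator \<pi> T \<and> Domain T = L20 \<pi> \<and>
     (\<exists>C. \<forall>(f, u) \<in> T. L2_norm \<pi> u \<le> C * L2_norm \<pi> f)"

definition invertible_operator :: "('a::euclidean_space \<Rightarrow> real) \<Rightarrow> 'a operator \<Rightarrow> bool" where
  "invertible_operator \<pi> T \<longleftrightarrow> is_operator \<pi> T \<and> bounded_operator \<pi> (T\<inverse>)"

definition sym_part :: "('a::euclidean_space \<Rightarrow> real) \<Rightarrow> 'a operator \<Rightarrow> 'a operator" where
  "sym_part \<pi> T = op_scale (1/2) (op_plus T (op_adjoint \<pi> T))"

text \<open>The selfadjoint operator associated with the Dirichlet form; integration by parts shows that
  it acts as \<open>\<nabla> log \<pi> \<cdot> \<nabla> + \<Delta>\<close> on smooth functions.\<close>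

definition S_op :: "('a::euclidean_space \<Rightarrow> real) \<Rightarrow> 'a operator" where
  "S_op \<pi> = {(f, h). f \<in> H1 \<pi> \<and> h \<in> L20 \<pi> \<and>
     (\<forall>g\<in>H1 \<pi>. dirichlet \<pi> f g = - L2_inner \<pi> h g)}"

definition H2 :: "('a::euclidean_space \<Rightarrow> real) \<Rightarrow> ('a \<Rightarrow> real) set" where
  "H2 \<pi> = Domain (S_op \<pi>)"

definition A_op :: "('a::euclidean_space \<Rightarrow> real) \<Rightarrow> ('a \<Rightarrow> 'a) \<Rightarrow> 'a operator" where
  "A_op \<pi> \<gamma> = {(f, h). f \<in> H1 \<pi> \<and> h \<in> L20 \<pi> \<and>
     (AE x in dens_measure \<pi>. h x = \<gamma> x \<bullet> L2_grad \<pi> f x)}"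

definition L_op :: "('a::euclidean_space \<Rightarrow> real) \<Rightarrow> ('a \<Rightarrow> 'a) \<Rightarrow> real \<Rightarrow> 'a operator" where
  "L_op \<pi> \<gamma> \<alpha> = op_plus (S_op \<pi>) (op_scale \<alpha> (A_op \<pi> \<gamma>))"

abbreviation neg_S :: "('a::euclidean_space \<Rightarrow> real) \<Rightarrow> 'a operator" where
  "neg_S \<pi> \<equiv> op_scale (-1) (S_op \<pi>)"

abbreviation neg_L :: "('a::euclidean_space \<Rightarrow> real) \<Rightarrow> ('a \<Rightarrow> 'a) \<Rightarrow> real \<Rightarrow> 'a operator" where
  "neg_L \<pi> \<gamma> \<alpha> \<equiv> op_scale (-1) (L_op \<pi> \<gamma> \<alpha>)"

text \<open>\<open>-S + \<alpha>\<^sup>2 A\<^sup>* (-S)\<^sup>-\<^sup>1 A\<close>\<close>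

definition effective_op ::
  "('a::euclidean_space \<Rightarrow> real) \<Rightarrow> ('a \<Rightarrow> 'a) \<Rightarrow> real \<Rightarrow> 'a operator" where
  "effective_op \<pi> \<gamma> \<alpha> = op_plus (neg_S \<pi>)
     (op_scale (\<alpha>\<^sup>2) (A_op \<pi> \<gamma> O (neg_S \<pi>)\<inverse> O op_adjoint \<pi> (A_op \<pi> \<gamma>)))"

definition asymp_var ::
  "('a::euclidean_space \<Rightarrow> real) \<Rightarrow> ('a \<Rightarrow> 'a) \<Rightarrow> real \<Rightarrow> ('a \<Rightarrow> real) \<Rightarrow> real" where
  "asymp_var \<pi> \<gamma> \<alpha> f =
     (let \<phi> = (SOME \<phi>. \<phi> \<in> H1 \<pi> \<and> (\<phi>, f) \<in> neg_L \<pi> \<gamma> \<alpha>) in 2 * dirichlet \<pi> \<phi> \<phi>)"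

end

theory Submission
  imports Defs
begin

text \<open>A test function satisfies \<open>0 \<le> \<integral> \<bar>\<nabla>\<phi> + \<beta> \<phi> \<nabla> log \<pi>\<bar>\<^sup>2 d\<pi>\<close>; integrating the cross term by parts and using (i)
  bounds \<open>\<integral> \<phi>\<^sup>2 d\<pi>\<close> by \<open>\<integral> \<bar>\<nabla>\<phi>\<bar>\<^sup>2 d\<pi>\<close> plus a multiple of \<open>\<integral> \<phi>\<^sup>2 d\<pi>\<close> over a ball, and the Poincare inequality on that ball
  turns this into a global one. Hence \<open>-S\<close> is the isomorphism given by the Riesz theorem in the complete form domain
  \<open>H\<^sup>1\<close>, and \<open>K = (-S)\<^sup>-\<^sup>1 A\<close> is bounded and antisymmetric there, because \<open>div (\<gamma> \<pi>) = 0\<close>. The form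
  \<open>\<langle>f, g\<rangle>\<^sub>1 + \<alpha>\<^sup>2 \<langle>K f, K g\<rangle>\<^sub>1\<close> is that of the effective operator and equivalent to \<open>\<langle>f, g\<rangle>\<^sub>1\<close>, so Riesz applies once more, and the
  factorisation \<open>1 - \<alpha>\<^sup>2 K\<^sup>2 = (1 - \<alpha> K) (1 + \<alpha> K)\<close> then inverts \<open>-L\<close>. The adjoint of \<open>(-L)\<^sup>-\<^sup>1\<close> is the same inverse with \<open>-\<alpha>\<close>
  in place of \<open>\<alpha>\<close>, and averaging the two solutions solves the effective equation.\<close>

section \<open>Semi-inner product spaces\<close>

text \<open>The variational problem for -L is not symmetric, so the Riesz theorem does not reach it
  directly. That is why the symmetric effective problem is solved first and its solution is then
  converted. Boundedness of \<gamma> keeps the effective norm comparable with the Dirichlet norm, so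
  that completeness carries over. A second obstacle is representation: elements are functions, not
  classes, and the graph of an operator has to absorb almost-everywhere changes. Hence the inner
  products are only semidefinite, gradients and drifts depend linearly on the function only up to
  null sets, and linearity is stated after pairing with another function. A gradient is by
  definition a limit of gradients of test functions. Integral identities are therefore proved for
  test functions and extended by continuity of the inner product. Constants are not test functions;
  cut-offs put them into the domain with gradient zero, which allows means to be subtracted and
  makes the mean of the drift vanish.\<close>

locale semi_inner =
  fixes V :: "('x \<Rightarrow> 'b::real_vector) set" and q :: "('x \<Rightarrow> 'b) \<Rightarrow> ('x \<Rightarrow> 'b) \<Rightarrow> real"
  assumes V_lincomb: "f \<in> V \<Longrightarrow> g \<in> V \<Longrightarrow> (\<lambda>x. a *\<^sub>R f x + b *\<^sub>R g x) \<in> V"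
    and V_zero: "(\<lambda>x. 0) \<in> V"
    and q_lincomb: "f \<in> V \<Longrightarrow> g \<in> V \<Longrightarrow> h \<in> V \<Longrightarrow>
           q (\<lambda>x. a *\<^sub>R f x + b *\<^sub>R g x) h = a * q f h + b * q g h"
    and q_sym: "f \<in> V \<Longrightarrow> g \<in> V \<Longrightarrow> q f g = q g f"
    and q_nonneg: "f \<in> V \<Longrightarrow> 0 \<le> q f f"
begin

definition nrm :: "('x \<Rightarrow> 'b) \<Rightarrow> real" where
  "nrm f = sqrt (q f f)"

lemma V_scale: "f \<in> V \<Longrightarrow> (\<lambda>x. a *\<^sub>R f x) \<in> V"
  using V_lincomb[of f f a 0] by simp

lemma V_add: "f \<in> V \<Longrightarrow> g \<in> V \<Longrightarrow> (\<lambda>x. f x + g x) \<in> V"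
  using V_lincomb[of f g 1 1] by simp

lemma V_diff: "f \<in> V \<Longrightarrow> g \<in> V \<Longrightarrow> (\<lambda>x. f x - g x) \<in> V"
  using V_lincomb[of f g 1 "-1"] by simp

lemma V_uminus: "f \<in> V \<Longrightarrow> (\<lambda>x. - f x) \<in> V"
  using V_lincomb[of f f "-1" 0] by simp

lemmas V_closed = V_lincomb V_scale V_add V_diff V_uminus V_zero

lemma q_lincomb_right:
  "f \<in> V \<Longrightarrow> g \<in> V \<Longrightarrow> h \<in> V \<Longrightarrow> q h (\<lambda>x. a *\<^sub>R f x + b *\<^sub>R g x) = a * q h f + b * q h g"
  using q_lincomb[of f g h a b] q_sym V_lincomb by metis

lemma q_add: "f \<in> V \<Longrightarrow> g \<in> V \<Longrightarrow> h \<in> V \<Longrightarrow> q (\<lambda>x. f x + g x) h = q f h + q g h"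
  using q_lincomb[of f g h 1 1] by simp

lemma q_diff: "f \<in> V \<Longrightarrow> g \<in> V \<Longrightarrow> h \<in> V \<Longrightarrow> q (\<lambda>x. f x - g x) h = q f h - q g h"
  using q_lincomb[of f g h 1 "-1"] by simp

lemma q_scale: "f \<in> V \<Longrightarrow> h \<in> V \<Longrightarrow> q (\<lambda>x. a *\<^sub>R f x) h = a * q f h"
  using q_lincomb[of f f h a 0] by simp

lemma q_uminus: "f \<in> V \<Longrightarrow> h \<in> V \<Longrightarrow> q (\<lambda>x. - f x) h = - q f h"
  using q_lincomb[of f f h "-1" 0] by simp

lemma q_add_right: "f \<in> V \<Longrightarrow> g \<in> V \<Longrightarrow> h \<in> V \<Longrightarrow> q h (\<lambda>x. f x + g x) = q h f + q h g"
  using q_lincomb_right[of f g h 1 1] by simp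

lemma q_diff_right: "f \<in> V \<Longrightarrow> g \<in> V \<Longrightarrow> h \<in> V \<Longrightarrow> q h (\<lambda>x. f x - g x) = q h f - q h g"
  using q_lincomb_right[of f g h 1 "-1"] by simp

lemma q_scale_right: "f \<in> V \<Longrightarrow> h \<in> V \<Longrightarrow> q h (\<lambda>x. a *\<^sub>R f x) = a * q h f"
  using q_lincomb_right[of f f h a 0] by simp

lemma q_uminus_right: "f \<in> V \<Longrightarrow> h \<in> V \<Longrightarrow> q h (\<lambda>x. - f x) = - q h f"
  using q_lincomb_right[of f f h "-1" 0] by simp

lemmas q_simps = q_lincomb q_lincomb_right q_add q_add_right q_diff q_diff_right
  q_scale q_scale_right q_uminus q_uminus_right

lemma nrm_nonneg: "f \<in> V \<Longrightarrow> 0 \<le> nrm f"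
  by (simp add: nrm_def q_nonneg)

lemma nrm_sq: "f \<in> V \<Longrightarrow> (nrm f)\<^sup>2 = q f f"
  by (simp add: nrm_def q_nonneg)

lemma quadratic_expand:
  assumes "f \<in> V" "g \<in> V"
  shows "q (\<lambda>x. a *\<^sub>R f x + b *\<^sub>R g x) (\<lambda>x. a *\<^sub>R f x + b *\<^sub>R g x)
    = a\<^sup>2 * q f f + 2 * a * b * q f g + b\<^sup>2 * q g g"
  using assms by (simp add: q_simps V_closed q_sym[of g f] power2_eq_square algebra_simps)

lemma cauchy_schwarz:
  assumes "f \<in> V" "g \<in> V"
  shows "\<bar>q f g\<bar> \<le> nrm f * nrm g"
proof -
  have quad: "0 \<le> q f f + 2 * t * q f g + t\<^sup>2 * q g g" for t
    using quadratic_expand[OF assms, of 1 t] q_nonneg[OF V_lincomb[OF assms, of 1 t]] by simp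
  have "(q f g)\<^sup>2 \<le> q f f * q g g"
  proof (cases "q g g = 0")
    case True
    have "q f g = 0"
    proof (rule ccontr)
      assume "q f g \<noteq> 0"
      \<comment> \<open>This multiplier turns \<open>quad\<close> into \<open>0 <= -1\<close>. The
        degenerate case is real: \<open>q g g\<close> vanishes for every null function
        \<open>g\<close>.\<close>
      then show False
        using quad[of "- (q f f + 1) / (2 * q f g)"] True by (simp add: field_simps)
    qed
    then show ?thesis using True by simp
  next
    case False
    then have pos: "q g g > 0" using q_nonneg[OF assms(2)] by simp
    have "0 \<le> q f f - (q f g)\<^sup>2 / q g g"
      using quad[of "- q f g / q g g"] pos by (simp add: field_simps power2_eq_square)
    then show ?thesis using pos by (simp add: field_simps)
  qed
  then have "sqrt ((q f g)\<^sup>2) \<le> sqrt (q f f * q g g)" by (rule real_sqrt_le_mono)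
  then show ?thesis by (simp add: nrm_def real_sqrt_mult)
qed

lemma nrm_triangle:
  assumes "f \<in> V" "g \<in> V"
  shows "nrm (\<lambda>x. f x + g x) \<le> nrm f + nrm g"
proof -
  have "(nrm (\<lambda>x. f x + g x))\<^sup>2 = q f f + 2 * q f g + q g g"
    using quadratic_expand[OF assms, of 1 1] V_add[OF assms] by (simp add: nrm_sq)
  also have "\<dots> \<le> (nrm f)\<^sup>2 + 2 * (nrm f * nrm g) + (nrm g)\<^sup>2"
    using cauchy_schwarz[OF assms] assms by (simp add: nrm_sq)
  also have "\<dots> = (nrm f + nrm g)\<^sup>2" by (simp add: power2_sum)
  finally show ?thesis
    using assms by (meson add_nonneg_nonneg nrm_nonneg power2_le_imp_le)
qed

lemma nrm_scale: "f \<in> V \<Longrightarrow> nrm (\<lambda>x. a *\<^sub>R f x) = \<bar>a\<bar> * nrm f"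
  by (simp add: nrm_def q_simps V_closed real_sqrt_mult flip: power2_eq_square mult.assoc)

lemma nrm_diff_commute: "f \<in> V \<Longrightarrow> g \<in> V \<Longrightarrow> nrm (\<lambda>x. f x - g x) = nrm (\<lambda>x. g x - f x)"
  using nrm_scale[of "\<lambda>x. f x - g x" "-1"] V_diff by (simp add: scaleR_diff_right)

lemma nrm_triangle_diff:
  assumes "f \<in> V" "g \<in> V" "h \<in> V"
  shows "nrm (\<lambda>x. f x - h x) \<le> nrm (\<lambda>x. f x - g x) + nrm (\<lambda>x. g x - h x)"
  using nrm_triangle[of "\<lambda>x. f x - g x" "\<lambda>x. g x - h x"] assms by (simp add: V_closed)

lemma nrm_diff_le:
  assumes "f \<in> V" "g \<in> V"
  shows "\<bar>nrm f - nrm g\<bar> \<le> nrm (\<lambda>x. f x - g x)"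
  using nrm_triangle[of g "\<lambda>x. f x - g x"] nrm_triangle[of f "\<lambda>x. g x - f x"] assms
    nrm_diff_commute[of f g] by (simp add: V_closed)

lemma tendsto_q:
  assumes "\<And>n. F n \<in> V" "\<And>n. G n \<in> V" "f \<in> V" "g \<in> V"
    and F: "(\<lambda>n. nrm (\<lambda>x. F n x - f x)) \<longlonglongrightarrow> 0" and G: "(\<lambda>n. nrm (\<lambda>x. G n x - g x)) \<longlonglongrightarrow> 0"
  shows "(\<lambda>n. q (F n) (G n)) \<longlonglongrightarrow> q f g"
proof -
  have nG: "(\<lambda>n. nrm (G n)) \<longlonglongrightarrow> nrm g"
    by (rule Lim_transform_bound[where g = "\<lambda>n. nrm (\<lambda>x. G n x - g x)", THEN LIM_zero_cancel])
      (use nrm_diff_le assms in \<open>auto intro!: always_eventually simp: nrm_nonneg V_closed\<close>)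
  have "(\<lambda>n. q (F n) (G n) - q f g) \<longlonglongrightarrow> 0"
  proof (rule Lim_null_comparison)
    show "\<forall>\<^sub>F n in sequentially. norm (q (F n) (G n) - q f g)
       \<le> nrm (\<lambda>x. F n x - f x) * nrm (G n) + nrm f * nrm (\<lambda>x. G n x - g x)"
    proof (intro always_eventually allI)
      fix n
      have "q (F n) (G n) - q f g = q (\<lambda>x. F n x - f x) (G n) + q f (\<lambda>x. G n x - g x)"
        using assms by (simp add: q_simps V_closed)
      then show "norm (q (F n) (G n) - q f g)
       \<le> nrm (\<lambda>x. F n x - f x) * nrm (G n) + nrm f * nrm (\<lambda>x. G n x - g x)"
        using cauchy_schwarz[of "\<lambda>x. F n x - f x" "G n"] cauchy_schwarz[of f "\<lambda>x. G n x - g x"] assms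
        by (simp add: V_closed)
    qed
    show "(\<lambda>n. nrm (\<lambda>x. F n x - f x) * nrm (G n) + nrm f * nrm (\<lambda>x. G n x - g x)) \<longlonglongrightarrow> 0"
      using tendsto_add[OF tendsto_mult[OF F nG] tendsto_mult[OF tendsto_const G], of "nrm f"] by simp
  qed
  then show ?thesis by (rule LIM_zero_cancel)
qed

lemma lim_trans:
  assumes "\<And>n. F n \<in> V" "\<And>n. H n \<in> V" "f \<in> V"
    and FH: "(\<lambda>n. nrm (\<lambda>x. H n x - F n x)) \<longlonglongrightarrow> 0" and F: "(\<lambda>n. nrm (\<lambda>x. F n x - f x)) \<longlonglongrightarrow> 0"
  shows "(\<lambda>n. nrm (\<lambda>x. H n x - f x)) \<longlonglongrightarrow> 0"
  by (rule Lim_null_comparison[OF _ tendsto_add_zero[OF FH F]])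
    (use nrm_triangle_diff assms in \<open>auto intro!: always_eventually simp: nrm_nonneg V_closed\<close>)

lemma lim_lincomb:
  assumes V: "\<And>n. F n \<in> V" "\<And>n. G n \<in> V" "f \<in> V" "g \<in> V"
    and F: "(\<lambda>n. nrm (\<lambda>x. F n x - f x)) \<longlonglongrightarrow> 0" and G: "(\<lambda>n. nrm (\<lambda>x. G n x - g x)) \<longlonglongrightarrow> 0"
  shows "(\<lambda>n. nrm (\<lambda>x. (a *\<^sub>R F n x + b *\<^sub>R G n x) - (a *\<^sub>R f x + b *\<^sub>R g x))) \<longlonglongrightarrow> 0"
proof (rule Lim_null_comparison)
  show "\<forall>\<^sub>F n in sequentially. norm (nrm (\<lambda>x. (a *\<^sub>R F n x + b *\<^sub>R G n x) - (a *\<^sub>R f x + b *\<^sub>R g x)))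
    \<le> \<bar>a\<bar> * nrm (\<lambda>x. F n x - f x) + \<bar>b\<bar> * nrm (\<lambda>x. G n x - g x)"
  proof (intro always_eventually allI)
    fix n
    have d: "(\<lambda>x. F n x - f x) \<in> V" "(\<lambda>x. G n x - g x) \<in> V" by (intro V_diff V)+
    have "(\<lambda>x. (a *\<^sub>R F n x + b *\<^sub>R G n x) - (a *\<^sub>R f x + b *\<^sub>R g x))
        = (\<lambda>x. a *\<^sub>R (F n x - f x) + b *\<^sub>R (G n x - g x))"
      by (auto simp: algebra_simps)
    then show "norm (nrm (\<lambda>x. (a *\<^sub>R F n x + b *\<^sub>R G n x) - (a *\<^sub>R f x + b *\<^sub>R g x)))
        \<le> \<bar>a\<bar> * nrm (\<lambda>x. F n x - f x) + \<bar>b\<bar> * nrm (\<lambda>x. G n x - g x)"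
      using nrm_triangle[OF V_scale[OF d(1), of a] V_scale[OF d(2), of b]]
        nrm_nonneg[OF V_lincomb[OF d, of a b]] nrm_scale[OF d(1), of a] nrm_scale[OF d(2), of b] by simp
  qed
qed (intro tendsto_add_zero tendsto_mult_right_zero F G)

text \<open>The representing element minimises \<open>q v v - 2 * \<phi> v\<close>; by the parallelogram identity every
  minimising sequence is Cauchy.\<close>

lemma riesz_representation:
  fixes \<phi> :: "('x \<Rightarrow> 'b) \<Rightarrow> real"
  assumes complete: "\<And>F. (\<And>n. F n \<in> V) \<Longrightarrow>
      (\<And>e. e > 0 \<Longrightarrow> \<exists>N. \<forall>m\<ge>N. \<forall>n\<ge>N. nrm (\<lambda>x. F m x - F n x) < e) \<Longrightarrow>
      \<exists>f\<in>V. (\<lambda>n. nrm (\<lambda>x. F n x - f x)) \<longlonglongrightarrow> 0"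
    and lin: "\<And>f g a b. f \<in> V \<Longrightarrow> g \<in> V \<Longrightarrow> \<phi> (\<lambda>x. a *\<^sub>R f x + b *\<^sub>R g x) = a * \<phi> f + b * \<phi> g"
    and bounded: "\<And>f. f \<in> V \<Longrightarrow> \<bar>\<phi> f\<bar> \<le> C * nrm f"
  shows "\<exists>u\<in>V. \<forall>v\<in>V. q u v = \<phi> v"
proof -
  define J where "J v = q v v - 2 * \<phi> v" for v
  have J_lincomb: "J (\<lambda>x. a *\<^sub>R f x + b *\<^sub>R g x)
      = a\<^sup>2 * q f f + 2 * a * b * q f g + b\<^sup>2 * q g g - 2 * (a * \<phi> f + b * \<phi> g)"
    if "f \<in> V" "g \<in> V" for f g a b
    using that by (simp add: J_def quadratic_expand lin)
  have J_lower: "- C\<^sup>2 \<le> J v" if "v \<in> V" for v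
  proof -
    have "0 \<le> (nrm v - C)\<^sup>2" by simp
    then have "2 * (C * nrm v) \<le> (nrm v)\<^sup>2 + C\<^sup>2" by (simp add: power2_diff mult_ac)
    then show ?thesis
      using bounded[OF that] that unfolding J_def by (simp add: nrm_sq[symmetric])
  qed
  define d where "d = Inf (J ` V)"
  have ne: "J ` V \<noteq> {}" using V_zero by auto
  have bdd: "bdd_below (J ` V)" using J_lower by (intro bdd_belowI2)
  have d_le: "d \<le> J v" if "v \<in> V" for v
    unfolding d_def using bdd that by (simp add: cINF_lower)
  have "\<exists>v\<in>V. J v < d + inverse (real (Suc n))" for n
    using cInf_less_iff[OF ne bdd, of "d + inverse (real (Suc n))"] by (auto simp: d_def)
  then obtain U where U: "\<And>n. U n \<in> V" "\<And>n. J (U n) < d + inverse (real (Suc n))"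
    by metis
  \<comment> \<open>By the parallelogram identity the left side is
    \<open>2 * J (U m) + 2 * J (U n) - 4 * J w\<close> with \<open>w\<close> the midpoint. As
    \<open>J w\<close> is at least \<open>d\<close>, only the two excesses over the infimum
    remain.\<close>
  have par: "(nrm (\<lambda>x. U m x - U n x))\<^sup>2 \<le> 2 * inverse (real (Suc m)) + 2 * inverse (real (Suc n))" for m n
  proof -
    have "(nrm (\<lambda>x. U m x - U n x))\<^sup>2 = q (U m) (U m) - 2 * q (U m) (U n) + q (U n) (U n)"
      using quadratic_expand[OF U(1) U(1), of 1 m "-1" n] U(1) by (simp add: nrm_sq V_closed)
    moreover have "J (\<lambda>x. (1/2) *\<^sub>R U m x + (1/2) *\<^sub>R U n x)
       = (1/4) * q (U m) (U m) + (1/2) * q (U m) (U n) + (1/4) * q (U n) (U n) - (\<phi> (U m) + \<phi> (U n))"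
      using J_lincomb[OF U(1) U(1), of "1/2" m "1/2" n] by (simp add: power2_eq_square)
    moreover have "d \<le> J (\<lambda>x. (1/2) *\<^sub>R U m x + (1/2) *\<^sub>R U n x)"
      using d_le U(1) V_lincomb by blast
    ultimately show ?thesis
      using U(2)[of m] U(2)[of n] by (simp add: J_def)
  qed
  have "\<exists>N. \<forall>m\<ge>N. \<forall>n\<ge>N. nrm (\<lambda>x. U m x - U n x) < e" if "e > 0" for e
  proof -
    have "0 < e\<^sup>2 / 4" using that by simp
    then obtain N where N: "inverse (real (Suc N)) < e\<^sup>2 / 4"
      using reals_Archimedean by blast
    have "nrm (\<lambda>x. U m x - U n x) < e" if "m \<ge> N" "n \<ge> N" for m n
    proof -
      have "inverse (real (Suc m)) \<le> inverse (real (Suc N))" "inverse (real (Suc n)) \<le> inverse (real (Suc N))"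
        using that by (auto intro: le_imp_inverse_le)
      then have "(nrm (\<lambda>x. U m x - U n x))\<^sup>2 < e\<^sup>2" using par[of m n] N by linarith
      then show ?thesis using \<open>e > 0\<close> by (simp add: power2_less_imp_less)
    qed
    then show ?thesis by blast
  qed
  then obtain u where u: "u \<in> V" "(\<lambda>n. nrm (\<lambda>x. U n x - u x)) \<longlonglongrightarrow> 0"
    using complete[of U] U(1) by blast
  have "(\<lambda>n. \<phi> (U n) - \<phi> u) \<longlonglongrightarrow> 0"
  proof (rule Lim_null_comparison)
    show "\<forall>\<^sub>F n in sequentially. norm (\<phi> (U n) - \<phi> u) \<le> C * nrm (\<lambda>x. U n x - u x)"
      using lin[of "U _" u 1 "-1"] bounded[of "\<lambda>x. U _ x - u x"] U(1) u(1)
      by (intro always_eventually) (simp add: V_closed)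
    show "(\<lambda>n. C * nrm (\<lambda>x. U n x - u x)) \<longlonglongrightarrow> 0"
      using tendsto_mult[OF tendsto_const u(2), of C] by simp
  qed
  then have "(\<lambda>n. J (U n)) \<longlonglongrightarrow> J u"
    unfolding J_def using U(1) u
    by (intro tendsto_intros tendsto_q) (auto dest: LIM_zero_cancel)
  moreover have "(\<lambda>n. d + inverse (real (Suc n))) \<longlonglongrightarrow> d + 0"
    by (intro tendsto_intros LIMSEQ_inverse_real_of_nat)
  ultimately have "J u \<le> d + 0"
    using U(2) by (intro LIMSEQ_le[of "\<lambda>n. J (U n)" _ "\<lambda>n. d + inverse (real (Suc n))"]) (auto intro: less_imp_le)
  then have min: "J u \<le> J v" if "v \<in> V" for v using d_le[OF that] by simp
  have "q u v = \<phi> v" if v: "v \<in> V" for v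
  proof (rule ccontr)
    assume ne: "q u v \<noteq> \<phi> v"
    define k where "k = q u v - \<phi> v"
    have k: "k \<noteq> 0" using ne by (simp add: k_def)
    have ineq: "0 \<le> 2 * t * k + t\<^sup>2 * q v v" for t
      using min[OF V_lincomb[OF u(1) v, of 1 t]] J_lincomb[OF u(1) v, of 1 t]
      by (simp add: J_def k_def algebra_simps)
    \<comment> \<open>A step against the sign of the first variation \<open>2 * k\<close>; the added
      1 keeps the denominator positive when \<open>q v v = 0\<close>.\<close>
    define t where "t = - k / (q v v + 1)"
    have pos: "q v v + 1 > 0" using q_nonneg[OF v] by simp
    have k_eq: "k = - t * (q v v + 1)" using pos by (simp add: t_def)
    have "2 * t * k + t\<^sup>2 * q v v = - (t\<^sup>2 * (q v v + 2))"
      unfolding k_eq by (simp add: power2_eq_square algebra_simps)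
    also have "\<dots> < 0"
      using k pos by (simp add: t_def)
    finally show False using ineq[of t] by simp
  qed
  then show ?thesis using u(1) by blast
qed

end

section \<open>Test functions\<close>

lemma C_k_SucI:
  assumes "\<And>x. (f has_derivative f' x) (at x)" "\<And>b. b \<in> Basis \<Longrightarrow> C_k k (\<lambda>x. f' x b)"
  shows "C_k (Suc k) f"
proof -
  have "frechet_derivative f (at x) = f' x" for x
    using frechet_derivative_at[OF assms(1)] by simp
  then show ?thesis using assms by (auto simp: differentiable_def)
qed

lemma C_k_SucD:
  assumes "C_k (Suc k) f"
  shows "(f has_derivative frechet_derivative f (at x)) (at x)"
    "b \<in> Basis \<Longrightarrow> C_k k (\<lambda>x. frechet_derivative f (at x) b)"
  using assms by (auto simp: frechet_derivative_works[symmetric])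

lemma C_k_Suc_imp: "C_k (Suc k) f \<Longrightarrow> C_k k f"
proof (induction k arbitrary: f)
  case 0
  then show ?case
    by (auto intro!: continuous_at_imp_continuous_on differentiable_imp_continuous_within)
next
  case (Suc k)
  have "C_k k (\<lambda>x. frechet_derivative f (at x) b)" if "b \<in> Basis" for b
    by (rule Suc.IH) (rule C_k_SucD(2)[OF Suc.prems that])
  then show ?case using Suc.prems by simp
qed

lemma C_k_const: "C_k k (\<lambda>x. c)"
proof (induction k arbitrary: c)
  case (Suc k)
  show ?case by (rule C_k_SucI[where f' = "\<lambda>_ _. 0"]) (auto intro: Suc)
qed auto

lemma C_k_bounded_linear: "bounded_linear T \<Longrightarrow> C_k k T"
proof (cases k)
  case 0
  then show "bounded_linear T \<Longrightarrow> ?thesis"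
    by (simp add: bounded_linear.linear linear_continuous_on)
next
  case (Suc m)
  then show "bounded_linear T \<Longrightarrow> ?thesis"
    using C_k_SucI[where f' = "\<lambda>_. T" and f = T] by (simp add: bounded_linear_imp_has_derivative C_k_const)
qed

lemma C_k_add: "C_k k f \<Longrightarrow> C_k k g \<Longrightarrow> C_k k (\<lambda>x. f x + g x)"
proof (induction k arbitrary: f g)
  case 0
  then show ?case by (simp add: continuous_on_add)
next
  case (Suc k)
  show ?case
    by (rule C_k_SucI[OF has_derivative_add[OF C_k_SucD(1)[OF Suc.prems(1)] C_k_SucD(1)[OF Suc.prems(2)]]])
      (intro Suc.IH C_k_SucD(2)[OF Suc.prems(1)] C_k_SucD(2)[OF Suc.prems(2)])
qed

lemma C_k_bilinear:
  assumes "bounded_bilinear pr"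
  shows "C_k k f \<Longrightarrow> C_k k g \<Longrightarrow> C_k k (\<lambda>x. pr (f x) (g x))"
proof (induction k arbitrary: f g)
  case 0
  then show ?case by (simp add: bounded_bilinear.continuous_on[OF assms])
next
  case (Suc k)
  show ?case
    by (rule C_k_SucI[OF bounded_bilinear.FDERIV[OF assms C_k_SucD(1)[OF Suc.prems(1)] C_k_SucD(1)[OF Suc.prems(2)]]])
      (intro C_k_add Suc.IH C_k_SucD(2)[OF Suc.prems(1)] C_k_SucD(2)[OF Suc.prems(2)]
        C_k_Suc_imp[OF Suc.prems(1)] C_k_Suc_imp[OF Suc.prems(2)])
qed

lemmas C_k_mult = C_k_bilinear[OF bounded_bilinear_mult]
  and C_k_scaleR = C_k_bilinear[OF bounded_bilinear_scaleR]
  and C_k_inner = C_k_bilinear[OF bounded_bilinear_inner]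

lemma C_k_cmult: "C_k k f \<Longrightarrow> C_k k (\<lambda>x. c * f x)" for c :: real
  by (intro C_k_mult C_k_const)

lemma C_k_diff: "C_k k f \<Longrightarrow> C_k k g \<Longrightarrow> C_k k (\<lambda>x. f x - g x)"
  using C_k_add[OF _ C_k_scaleR[OF C_k_const, of k g "-1"], of f] by simp

lemma C_k_prod:
  fixes f :: "'i \<Rightarrow> 'a::euclidean_space \<Rightarrow> real"
  shows "(\<And>i. i \<in> A \<Longrightarrow> C_k k (f i)) \<Longrightarrow> C_k k (\<lambda>x. \<Prod>i\<in>A. f i x)"
  by (induction A rule: infinite_finite_induct) (auto intro!: C_k_const C_k_mult)

lemma C_k_sum:
  "(\<And>i. i \<in> A \<Longrightarrow> C_k k (f i)) \<Longrightarrow> C_k k (\<lambda>x. \<Sum>i\<in>A. f i x)"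
  by (induction A rule: infinite_finite_induct) (auto intro!: C_k_const C_k_add)

text \<open>The chain rule replaces \<open>s n\<close> by \<open>s (Suc n)\<close>, so the induction
  on \<open>k\<close> needs the whole sequence of derivatives and a statement for every
  \<open>n\<close>.\<close>

lemma C_k_compose_real:
  assumes s: "\<And>n t. (s n has_real_derivative s (Suc n) t) (at t)"
  shows "C_k k f \<Longrightarrow> C_k k (\<lambda>x. s n (f x))"
proof (induction k arbitrary: f n)
  case 0
  have "continuous_on UNIV (s n)"
    using s by (intro continuous_at_imp_continuous_on ballI DERIV_isCont)
  then show ?case using 0 continuous_on_compose2 by fastforce
next
  case (Suc k)
  have "((\<lambda>x. s n (f x)) has_derivative (\<lambda>h. s (Suc n) (f x) * frechet_derivative f (at x) h)) (at x)" for x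
    using has_derivative_compose[OF C_k_SucD(1)[OF Suc.prems] s[THEN has_field_derivative_imp_has_derivative]] .
  then show ?case
    by (rule C_k_SucI) (intro C_k_mult Suc.IH C_k_SucD(2)[OF Suc.prems] C_k_Suc_imp[OF Suc.prems])
qed

lemma smoothD: "smooth f \<Longrightarrow> C_k k f"
  by (simp add: smooth_def)

text \<open>The recursion is the differentiation rule for \<open>p (1 / t) * exp (- 1 / t)\<close>:
  its derivative has the same shape, with \<open>p\<close> replaced by
  \<open>X^2 * (p - p')\<close>.\<close>

fun flat_poly :: "nat \<Rightarrow> real poly" where
  "flat_poly 0 = 1"
| "flat_poly (Suc n) = [:0, 0, 1:] * (flat_poly n - pderiv (flat_poly n))"

text \<open>\<open>flat n\<close> is the \<open>n\<close>-th derivative of \<open>flat 0\<close>, the smooth extension of \<open>exp (- 1 / t)\<close> by zero.\<close>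

definition flat :: "nat \<Rightarrow> real \<Rightarrow> real" where
  "flat n t = (if t \<le> 0 then 0 else poly (flat_poly n) (1 / t) * exp (- 1 / t))"

lemma tendsto_poly_exp: "((\<lambda>t::real. poly p (1 / t) * exp (- 1 / t)) \<longlongrightarrow> 0) (at_right 0)"
proof -
  have "((\<lambda>u. poly p u * exp (- u)) \<longlongrightarrow> 0) at_top"
  proof -
    have "((\<lambda>u. \<Sum>i\<le>degree p. coeff p i * (u ^ i / exp u)) \<longlongrightarrow> (\<Sum>i\<le>degree p. coeff p i * 0)) at_top"
      by (intro tendsto_intros tendsto_power_div_exp_0)
    then show ?thesis
      by (simp add: poly_altdef exp_minus sum_distrib_right sum_divide_distrib field_simps)
  qed
  from filterlim_compose[OF this filterlim_inverse_at_top_right] show ?thesis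
    by (simp add: inverse_eq_divide)
qed

lemma flat_has_derivative: "(flat n has_real_derivative flat (Suc n) t) (at t)"
proof -
  consider "t < 0" | "t = 0" | "t > 0" by linarith
  then show ?thesis
  proof cases
    case 1
    have "((\<lambda>_. 0) has_real_derivative flat (Suc n) t) (at t)" using 1 by (simp add: flat_def)
    then show ?thesis
      by (rule has_field_derivative_transform_within_open[of _ _ _ "{..<0}"]) (use 1 in \<open>auto simp: flat_def\<close>)
  next
    case 2
    \<comment> \<open>Only the origin needs an estimate. Dividing by \<open>h\<close> multiplies the
      polynomial by one more power of \<open>1 / h\<close>, so the right-hand quotient is again
      covered by \<open>tendsto_poly_exp\<close>.\<close>
    have "((\<lambda>h. flat n h / h) \<longlongrightarrow> 0) (at_right 0)"
      using tendsto_poly_exp[of "pCons 0 (flat_poly n)"]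
      by (rule Lim_transform_eventually)
        (auto simp: flat_def eventually_at_filter)
    moreover have "((\<lambda>h. flat n h / h) \<longlongrightarrow> 0) (at_left 0)"
      using tendsto_const[of 0 "at_left (0::real)"]
      by (rule Lim_transform_eventually) (auto simp: flat_def eventually_at_filter)
    ultimately have "((\<lambda>h. flat n h / h) \<longlongrightarrow> 0) (at 0)"
      by (simp add: filterlim_split_at)
    then show ?thesis using 2 by (simp add: has_field_derivative_iff flat_def)
  next
    case 3
    have "((\<lambda>t. poly (flat_poly n) (1 / t) * exp (- 1 / t)) has_real_derivative flat (Suc n) t) (at t)"
      using 3 by (auto intro!: derivative_eq_intros
        simp: flat_def field_simps power2_eq_square)
    then show ?thesis
      by (rule has_field_derivative_transform_within_open[of _ _ _ "{0<..}"]) (use 3 in \<open>auto simp: flat_def\<close>)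
  qed
qed

lemma flat_0_pos_iff: "0 < flat 0 t \<longleftrightarrow> 0 < t" and flat_0_eq_0_iff: "flat 0 t = 0 \<longleftrightarrow> t \<le> 0"
  and flat_0_nonneg: "0 \<le> flat 0 t" and flat_0_le_1: "flat 0 t \<le> 1"
  by (auto simp: flat_def)

lemma flat_1_bound: "\<bar>flat 1 t\<bar> \<le> 2"
proof (cases "t > 0")
  case True
  define u where "u = 1 / t"
  have u: "u > 0" using True by (simp add: u_def)
  have "u\<^sup>2 \<le> 2 * exp u" using exp_lower_Taylor_quadratic[of u] u by simp
  then have "u\<^sup>2 * exp (- u) \<le> 2" by (simp add: exp_minus field_simps)
  then show ?thesis using True u by (simp add: flat_def u_def power2_eq_square pderiv_1)
qed (simp add: flat_def)

lemma flat_at_top: "(flat 0 \<longlongrightarrow> 1) at_top"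
proof -
  have "((\<lambda>t::real. exp (- 1 / t)) \<longlongrightarrow> exp 0) at_top"
    by (intro tendsto_intros tendsto_divide_0[OF tendsto_const]) (auto intro: filterlim_at_top_imp_at_infinity filterlim_ident)
  then have "((\<lambda>t::real. exp (- 1 / t)) \<longlongrightarrow> 1) at_top" by simp
  then show ?thesis
    by (rule Lim_transform_eventually) (auto simp: flat_def intro: eventually_at_top_linorderI[of 1])
qed

lemma flat_1_at_top: "(flat 1 \<longlongrightarrow> 0) at_top"
proof -
  have "((\<lambda>t::real. (1 / t) * (1 / t)* exp (- 1 / t)) \<longlongrightarrow> 0 * 0 * exp 0) at_top"
    by (intro tendsto_intros tendsto_divide_0[OF tendsto_const]) (auto intro: filterlim_at_top_imp_at_infinity filterlim_ident)
  then have "((\<lambda>t::real. (1 / t) * (1 / t)* exp (- 1 / t)) \<longlongrightarrow> 0) at_top" by simp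
  then show ?thesis
    by (rule Lim_transform_eventually) (auto simp: flat_def pderiv_1 intro: eventually_at_top_linorderI[of 1])
qed

section \<open>Cut-offs and bumps built from the flat function\<close>

lemma smooth_flat: "smooth f \<Longrightarrow> smooth (\<lambda>x. flat 0 (f x))"
  unfolding smooth_def using C_k_compose_real[where s = flat, OF flat_has_derivative] by blast

lemma test_flat:
  assumes "smooth f" "bounded {x. f x > 0}"
  shows "(\<lambda>x. flat 0 (f x)) \<in> test_functions"
proof -
  have "{x. flat 0 (f x) \<noteq> 0} = {x. f x > 0}"
    using flat_0_eq_0_iff by (auto simp: not_le)
  then show ?thesis
    using assms unfolding test_functions_def by (simp add: smooth_flat compact_closure)
qed

text \<open>With \<open>N = n + 1\<close> the argument \<open>N - |x|^2 / N\<close> is positive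
  exactly inside the ball of radius \<open>N\<close>, tends to infinity for fixed \<open>x\<close>,
  and has slope at most 2 on that ball. As \<open>flat 0\<close> tends to 1 at infinity, no plateau
  has to be built in.\<close>

definition cutoff :: "nat \<Rightarrow> 'a::euclidean_space \<Rightarrow> real" where
  "cutoff n x = flat 0 (real (Suc n) - (x \<bullet> x) / real (Suc n))"

lemma cutoff_test: "cutoff n \<in> test_functions"
  unfolding cutoff_def
proof (rule test_flat)
  show "smooth (\<lambda>x::'a. real (Suc n) - x \<bullet> x / real (Suc n))"
    unfolding smooth_def divide_inverse
    by (intro allI C_k_diff C_k_const C_k_mult C_k_inner C_k_bounded_linear bounded_linear_ident)
  have "norm x \<le> real (Suc n)" if "0 < real (Suc n) - x \<bullet> x / real (Suc n)" for x :: 'a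
  proof -
    have "(norm x)\<^sup>2 \<le> (real (Suc n))\<^sup>2"
      using that by (simp only: power2_norm_eq_inner) (simp add: field_simps power2_eq_square)
    then show ?thesis by (rule power2_le_imp_le) simp
  qed
  then show "bounded {x::'a. 0 < real (Suc n) - x \<bullet> x / real (Suc n)}"
    unfolding bounded_iff by blast
qed

lemma cutoff_nonneg: "0 \<le> cutoff n x" and cutoff_le_1: "cutoff n x \<le> 1"
  by (simp_all add: cutoff_def flat_0_nonneg flat_0_le_1)

lemma cutoff_arg_at_top: "filterlim (\<lambda>n. real (Suc n) - c / real (Suc n)) at_top sequentially"
proof -
  have "(\<lambda>n. - c / real (Suc n)) \<longlonglongrightarrow> 0"
    using LIMSEQ_Suc[OF lim_const_over_n[of "- c"]] by simp
  then have "filterlim (\<lambda>n. - c / real (Suc n) + real (Suc n)) at_top sequentially"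
    by (rule filterlim_tendsto_add_at_top)
      (rule filterlim_compose[OF filterlim_real_sequentially filterlim_Suc])
  then show ?thesis by (simp add: algebra_simps)
qed

lemma cutoff_tendsto: "(\<lambda>n. cutoff n x) \<longlonglongrightarrow> 1"
  unfolding cutoff_def by (rule filterlim_compose[OF flat_at_top cutoff_arg_at_top])

lemma cutoff_has_derivative:
  "(cutoff n has_derivative
     (\<lambda>h. flat 1 (real (Suc n) - (x \<bullet> x) / real (Suc n)) * (- (2 / real (Suc n)) * (x \<bullet> h)))) (at x)"
proof -
  let ?r = "inverse (real (Suc n))"
  have "((\<lambda>x. real (Suc n) - (x \<bullet> x) * ?r) has_derivative (\<lambda>h. 0 - (x \<bullet> h + h \<bullet> x) * ?r)) (at x)"
    by (intro has_derivative_diff has_derivative_const has_derivative_mult_left has_derivative_inner has_derivative_ident)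
  also have "(\<lambda>h. 0 - (x \<bullet> h + h \<bullet> x) * ?r) = (\<lambda>h. - (2 / real (Suc n)) * (x \<bullet> h))"
    by (simp add: fun_eq_iff inner_commute[of _ x] divide_inverse mult_ac del: of_nat_Suc)
  finally have "((\<lambda>x. real (Suc n) - (x \<bullet> x) / real (Suc n)) has_derivative (\<lambda>h. - (2 / real (Suc n)) * (x \<bullet> h))) (at x)"
    by (simp only: divide_inverse)
  from has_derivative_compose[OF this flat_has_derivative[of 0, THEN has_field_derivative_imp_has_derivative]]
  show ?thesis unfolding cutoff_def by simp
qed

lemma grad_has_derivative:
  assumes "(f has_derivative (\<lambda>h. v \<bullet> h)) (at x)"
  shows "grad f x = v"
proof -
  have "frechet_derivative f (at x) = (\<lambda>h. v \<bullet> h)"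
    using frechet_derivative_at[OF assms] by simp
  then show ?thesis by (simp add: grad_def euclidean_representation)
qed

lemma has_derivative_grad:
  assumes "f differentiable (at x)"
  shows "(f has_derivative (\<lambda>h. grad f x \<bullet> h)) (at x)"
proof -
  have D: "(f has_derivative frechet_derivative f (at x)) (at x)"
    using assms frechet_derivative_works by blast
  then interpret linear "frechet_derivative f (at x)" by (rule has_derivative_linear)
  have "frechet_derivative f (at x) h = grad f x \<bullet> h" for h
  proof -
    have "frechet_derivative f (at x) h = frechet_derivative f (at x) (\<Sum>b\<in>Basis. (h \<bullet> b) *\<^sub>R b)"
      by (simp add: euclidean_representation)
    also have "\<dots> = grad f x \<bullet> h"
      unfolding grad_def by (simp add: sum scale inner_sum_left inner_sum_right inner_commute mult.commute)
    finally show ?thesis .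
  qed
  then show ?thesis using D by presburger
qed

lemma grad_cutoff: "grad (cutoff n) x = (flat 1 (real (Suc n) - (x \<bullet> x) / real (Suc n)) * - (2 / real (Suc n))) *\<^sub>R x"
  by (rule grad_has_derivative) (use cutoff_has_derivative in \<open>simp add: mult.assoc\<close>)

text \<open>Where \<open>flat 1\<close> does not vanish, \<open>norm x\<close> is at most
  \<open>n + 1\<close>; the factor 2 from the square and the 2 from \<open>flat_1_bound\<close> give
  4. Uniformity in \<open>n\<close> is what dominated convergence needs in
  \<open>gradient_const\<close>.\<close>

lemma grad_cutoff_bound: "norm (grad (cutoff n) x) \<le> 4"
proof (cases "0 < real (Suc n) - (x \<bullet> x) / real (Suc n)")
  case True
  have "(norm x)\<^sup>2 \<le> (real (Suc n))\<^sup>2"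
    using True by (simp only: power2_norm_eq_inner) (simp add: field_simps power2_eq_square)
  then have x: "norm x \<le> real (Suc n)" by (rule power2_le_imp_le) simp
  have "norm (grad (cutoff n) x) = \<bar>flat 1 (real (Suc n) - (x \<bullet> x) / real (Suc n))\<bar> * (2 * (norm x / real (Suc n)))"
    by (simp add: grad_cutoff abs_mult del: of_nat_Suc)
  also have "\<dots> \<le> 2 * (2 * 1)"
    by (intro mult_mono flat_1_bound) (use x in \<open>auto simp: divide_simps\<close>)
  finally show ?thesis by simp
qed (simp add: grad_cutoff flat_def del: of_nat_Suc)

lemma grad_cutoff_tendsto: "(\<lambda>n. grad (cutoff n) x) \<longlonglongrightarrow> 0"
proof -
  have "(\<lambda>n. (flat 1 (real (Suc n) - (x \<bullet> x) / real (Suc n)) * - (2 / real (Suc n))) *\<^sub>R x) \<longlonglongrightarrow> (0 * - 0) *\<^sub>R x"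
    by (intro tendsto_intros filterlim_compose[OF flat_1_at_top cutoff_arg_at_top] LIMSEQ_Suc[OF lim_const_over_n])
  then show ?thesis by (simp add: grad_cutoff del: of_nat_Suc)
qed

text \<open>The product is positive exactly on the open box. Scaling it by \<open>n\<close> before
  applying \<open>flat 0\<close> drives the values on the box to 1 and leaves them 0 elsewhere, so
  the limit is the indicator.\<close>

definition box_bump :: "'a::euclidean_space \<Rightarrow> 'a \<Rightarrow> nat \<Rightarrow> 'a \<Rightarrow> real" where
  "box_bump a b n x = flat 0 (real n * (\<Prod>i\<in>Basis. flat 0 (x \<bullet> i - a \<bullet> i) * flat 0 (b \<bullet> i - x \<bullet> i)))"

lemma box_bump_arg_pos_iff:
  "(\<Prod>i\<in>Basis. flat 0 (x \<bullet> i - a \<bullet> i) * flat 0 (b \<bullet> i - x \<bullet> i)) > 0 \<longleftrightarrow> x \<in> box a b"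
proof
  let ?p = "\<lambda>i. flat 0 (x \<bullet> i - a \<bullet> i) * flat 0 (b \<bullet> i - x \<bullet> i)"
  assume "x \<in> box a b"
  then show "prod ?p Basis > 0"
    by (intro prod_pos ballI mult_pos_pos) (auto simp: box_def flat_0_pos_iff)
next
  let ?p = "\<lambda>i. flat 0 (x \<bullet> i - a \<bullet> i) * flat 0 (b \<bullet> i - x \<bullet> i)"
  assume "prod ?p Basis > 0"
  then have "prod ?p Basis \<noteq> 0" by linarith
  then have "?p i \<noteq> 0" if "i \<in> Basis" for i using that by (auto simp only: prod_zero_iff[OF finite_Basis])
  then have "a \<bullet> i < x \<bullet> i \<and> x \<bullet> i < b \<bullet> i" if "i \<in> Basis" for i
    using that by (force simp: flat_0_eq_0_iff not_le)
  then show "x \<in> box a b" by (simp add: box_def)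
qed

lemma box_bump_test: "box_bump a b n \<in> test_functions"
  unfolding box_bump_def
proof (rule test_flat)
  have lin: "C_k k (\<lambda>x. x \<bullet> i)" for k and i :: 'a
    by (intro C_k_bounded_linear bounded_linear_inner_left)
  show "smooth (\<lambda>x. real n * (\<Prod>i\<in>Basis. flat 0 (x \<bullet> i - a \<bullet> i) * flat 0 (b \<bullet> i - x \<bullet> i)))"
    unfolding smooth_def
    by (intro allI C_k_mult C_k_const C_k_prod C_k_compose_real[where s = flat, OF flat_has_derivative] C_k_diff lin)
  have "{x. 0 < real n * (\<Prod>i\<in>Basis. flat 0 (x \<bullet> i - a \<bullet> i) * flat 0 (b \<bullet> i - x \<bullet> i))} \<subseteq> box a b"
    using box_bump_arg_pos_iff by (auto simp: zero_less_mult_iff)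
  then show "bounded {x. 0 < real n * (\<Prod>i\<in>Basis. flat 0 (x \<bullet> i - a \<bullet> i) * flat 0 (b \<bullet> i - x \<bullet> i))}"
    using bounded_box bounded_subset by blast
qed

lemma box_bump_tendsto: "(\<lambda>n. box_bump a b n x) \<longlonglongrightarrow> indicator (box a b) x"
proof -
  define p where "p = (\<Prod>i\<in>Basis. flat 0 (x \<bullet> i - a \<bullet> i) * flat 0 (b \<bullet> i - x \<bullet> i))"
  have pos: "p > 0 \<longleftrightarrow> x \<in> box a b" unfolding p_def by (rule box_bump_arg_pos_iff)
  have p0: "p \<ge> 0" unfolding p_def by (intro prod_nonneg ballI mult_nonneg_nonneg flat_0_nonneg)
  show ?thesis
  proof (cases "x \<in> box a b")
    case True
    then have "filterlim (\<lambda>n. real n * p) at_top sequentially"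
      using pos filterlim_real_sequentially
      by (subst mult.commute, intro filterlim_tendsto_pos_mult_at_top[OF tendsto_const]) auto
    then show ?thesis
      using filterlim_compose[OF flat_at_top] True by (simp add: box_bump_def p_def)
  next
    case False
    then have "p = 0" using pos p0 by simp
    then show ?thesis using False by (simp add: box_bump_def p_def[symmetric] flat_0_eq_0_iff[THEN iffD2])
  qed
qed

section \<open>Test functions separate integrable functions\<close>

lemma test_borel: "\<phi> \<in> test_functions \<Longrightarrow> \<phi> \<in> borel_measurable borel"
  using smoothD[of \<phi> 0] by (auto simp: test_functions_def intro: borel_measurable_continuous_onI)

text \<open>Dominated convergence along \<open>box_bump\<close> and \<open>cutoff\<close> gives zero
  integrals over open boxes and over the whole space. Open boxes are stable under intersection and
  generate the Borel sets, so the integral of \<open>h\<close> over every Borel set vanishes; the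
  whole space is what the complement step of the induction uses.\<close>

lemma test_separate:
  fixes h :: "'a::euclidean_space \<Rightarrow> real"
  assumes M: "sets M = sets borel" and h: "integrable M h"
    and zero: "\<And>\<phi>. \<phi> \<in> test_functions \<Longrightarrow> (LINT x|M. \<phi> x * h x) = 0"
  shows "AE x in M. h x = 0"
proof -
  have [measurable_cong]: "sets M = sets borel" by (rule M)
  note [measurable] = borel_measurable_integrable[OF h] test_borel
  have bnd: "(LINT x|M. f x * h x) = 0"
    if "\<And>n. \<phi> n \<in> test_functions" "\<And>n x. \<bar>\<phi> n x\<bar> \<le> 1" "\<And>x. (\<lambda>n. \<phi> n x) \<longlonglongrightarrow> f x" for \<phi> f
  proof -
    have [measurable]: "\<phi> n \<in> borel_measurable borel" for n using that test_borel by blast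
    have [measurable]: "f \<in> borel_measurable borel" by (rule borel_measurable_LIMSEQ_metric[OF _ that(3)]) simp
    have "(\<lambda>n. LINT x|M. \<phi> n x * h x) \<longlonglongrightarrow> (LINT x|M. f x * h x)"
    proof (rule integral_dominated_convergence[where w = "\<lambda>x. \<bar>h x\<bar>"])
      show "AE x in M. (\<lambda>i. \<phi> i x * h x) \<longlonglongrightarrow> f x * h x"
        using that(3) by (intro always_eventually allI tendsto_intros)
      show "AE x in M. norm (\<phi> n x * h x) \<le> \<bar>h x\<bar>" for n
        using that(2) by (intro always_eventually allI) (simp add: abs_mult mult_left_le_one_le)
    qed (use h in auto)
    then show ?thesis using zero[OF that(1)] by (simp add: LIMSEQ_const_iff)
  qed
  have UNIV: "(LINT x|M. h x) = 0"
  proof -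
    have "\<bar>cutoff n x\<bar> \<le> 1" for n and x :: 'a using cutoff_nonneg[of n x] cutoff_le_1[of n x] by simp
    from bnd[where \<phi> = cutoff and f = "\<lambda>_. 1", OF cutoff_test this cutoff_tendsto] show ?thesis by simp
  qed
  let ?G = "range (\<lambda>(a, b). box a b :: 'a set)"
  have borel: "sets borel = sigma_sets UNIV ?G"
    unfolding borel_eq_box by (simp add: image_def)
  have all: "(LINT x|M. indicator A x * h x) = 0" if "A \<in> sets borel" for A
  proof -
    have "Int_stable ?G"
    proof -
      have "box a b \<in> ?G" for a b :: 'a by (rule image_eqI[of _ _ "(a, b)"]) auto
      then show ?thesis by (intro Int_stableI) (clarsimp simp only: box_Int_box image_iff split_beta)
    qed
    moreover have "?G \<subseteq> Pow UNIV" by simp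
    moreover have "A \<in> sigma_sets UNIV ?G" using that borel by simp
    ultimately show ?thesis
    proof (induction rule: sigma_sets_induct_disjoint)
      case (basic A)
      then obtain a b where A: "A = box a b" by auto
      show ?case unfolding A
        by (rule bnd[where \<phi> = "box_bump a b", OF box_bump_test _ box_bump_tendsto]) (simp add: box_bump_def flat_0_nonneg flat_0_le_1)
    next
      case (compl A)
      have [measurable]: "A \<in> sets borel" using compl borel by simp
      have "(\<lambda>x. indicator (UNIV - A) x * h x) = (\<lambda>x. h x - indicator A x * h x)"
        by (auto simp: indicator_def)
      then show ?case
        using compl h UNIV integrable_mult_indicator[OF _ h, of A] by (simp add: real_scaleR_def)
    next
      case (union A)
      have [measurable]: "A i \<in> sets borel" for i using union(2) borel by auto
      have "set_integrable M (\<Union>i. A i) h"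
        using integrable_mult_indicator[OF _ h, of "\<Union>i. A i"] by (simp add: set_integrable_def)
      then have "set_lebesgue_integral M (\<Union>i. A i) h = (\<Sum>i. set_lebesgue_integral M (A i) h)"
        using union(1) by (intro lebesgue_integral_countable_add) (auto simp: disjoint_family_on_def)
      then show ?case using union(3) by (simp add: set_lebesgue_integral_def)
    qed auto
  qed
  \<comment> \<open>The Borel set on which \<open>s * h\<close> is positive carries zero integral of
    a nonnegative function; the two signs together force \<open>h = 0\<close>.\<close>
  have half: "AE x in M. s * h x \<le> 0" if "s \<in> {1, -1}" for s
  proof -
    let ?A = "{x. s * h x > 0}"
    have [measurable]: "?A \<in> sets borel" by measurable
    have int: "integrable M (\<lambda>x. indicator ?A x * (s * h x))"
      using integrable_mult_indicator[OF _ integrable_mult_right[OF h], of ?A s] by simp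
    have "(LINT x|M. indicator ?A x * (s * h x)) = s * (LINT x|M. indicator ?A x * h x)"
      by (subst integral_mult_right_zero[symmetric]) (auto intro!: Bochner_Integration.integral_cong simp: mult_ac)
    then have "(LINT x|M. indicator ?A x * (s * h x)) = 0" using all by simp
    then have "AE x in M. indicator ?A x * (s * h x) = 0"
      using int by (subst (asm) integral_nonneg_eq_0_iff_AE) (auto simp: indicator_def)
    then show ?thesis by eventually_elim (auto simp: indicator_def split: if_splits)
  qed
  have "AE x in M. h x \<le> 0" "AE x in M. - h x \<le> 0"
    using half[of 1] half[of "-1"] by auto
  then show ?thesis by eventually_elim simp
qed

section \<open>Integration by parts\<close>

lemma C_k_continuous: "C_k k f \<Longrightarrow> continuous_on UNIV f"
  by (induction k) (auto dest: C_k_Suc_imp simp del: C_k.simps(2))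

lemma C_1_differentiable: "C_k (Suc k) f \<Longrightarrow> f differentiable (at x)"
  by simp

lemma grad_inner_Basis: "b \<in> Basis \<Longrightarrow> grad f x \<bullet> b = frechet_derivative f (at x) b"
  unfolding grad_def by (simp add: inner_sum_left inner_Basis if_distrib cong: if_cong)

lemma C_k_grad: "C_k (Suc k) f \<Longrightarrow> C_k k (grad f)"
  unfolding grad_def by (intro C_k_sum C_k_scaleR C_k_const C_k_SucD(2))

lemma C_k_divergence: "C_k (Suc k) F \<Longrightarrow> C_k k (divergence F)"
  unfolding divergence_def by (intro C_k_sum C_k_inner C_k_const C_k_SucD(2))

lemma grad_eq_0_outside: "x \<notin> closure {x. f x \<noteq> 0} \<Longrightarrow> grad f x = 0"
proof (rule grad_has_derivative)
  assume x: "x \<notin> closure {x. f x \<noteq> 0}"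
  have "((\<lambda>_. 0) has_derivative (\<lambda>h. 0 \<bullet> h)) (at x)" by simp
  then show "(f has_derivative (\<lambda>h. 0 \<bullet> h)) (at x)"
    by (rule has_derivative_transform_within_open[where s = "- closure {x. f x \<noteq> 0}"])
      (use x closure_subset[of "{x. f x \<noteq> 0}"] in auto)
qed

lemma bounded_support_grad:
  assumes "bounded {x. f x \<noteq> 0}"
  shows "bounded {x. grad f x \<noteq> 0}"
proof (rule bounded_subset[OF bounded_closure[OF assms]])
  show "{x. grad f x \<noteq> 0} \<subseteq> closure {x. f x \<noteq> 0}" using grad_eq_0_outside by blast
qed

lemma bounded_support_mult:
  fixes f g :: "'a::real_normed_vector \<Rightarrow> real"
  assumes "bounded {x. f x \<noteq> 0}"
  shows "bounded {x. f x * g x \<noteq> 0}" "bounded {x. g x * f x \<noteq> 0}"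
  by (rule bounded_subset[OF assms], auto)+

lemma bounded_support_inner:
  assumes "bounded {x. f x \<noteq> 0}"
  shows "bounded {x. f x \<bullet> g x \<noteq> 0}"
  by (rule bounded_subset[OF assms]) auto

lemma test_C_k: "\<phi> \<in> test_functions \<Longrightarrow> C_k k \<phi>"
  by (simp add: test_functions_def smooth_def)

lemma test_support: "\<phi> \<in> test_functions \<Longrightarrow> bounded {x. \<phi> x \<noteq> 0}"
  unfolding test_functions_def by (auto intro: bounded_subset[OF compact_imp_bounded closure_subset])

lemma bounded_continuous_bounded_support:
  fixes f :: "'a::euclidean_space \<Rightarrow> 'b::real_normed_vector"
  assumes "continuous_on UNIV f" "bounded {x. f x \<noteq> 0}"
  obtains B where "B \<ge> 0" "\<And>x. norm (f x) \<le> B"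
proof -
  have "compact (f ` closure {x. f x \<noteq> 0})"
    using assms by (intro compact_continuous_image) (auto intro: continuous_on_subset simp: compact_closure)
  then obtain B where B: "\<And>y. y \<in> f ` closure {x. f x \<noteq> 0} \<Longrightarrow> norm y \<le> B"
    using compact_imp_bounded by (force simp: bounded_iff)
  have "norm (f x) \<le> max B 0" for x
    using B[of "f x"] closure_subset[of "{x. f x \<noteq> 0}"] by (cases "f x = 0") (force simp: le_max_iff_disj)+
  then show ?thesis using that[of "max B 0"] by simp
qed

lemma integrable_bounded_support:
  fixes f :: "'a::euclidean_space \<Rightarrow> 'b::euclidean_space"
  assumes "continuous_on UNIV f" "bounded {x. f x \<noteq> 0}"
  shows "integrable lborel f"
proof -
  let ?S = "closure {x. f x \<noteq> 0}"
  have "integrable lborel (\<lambda>x. indicator ?S x *\<^sub>R f x)"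
    using assms by (intro borel_integrable_compact) (auto intro: continuous_on_subset simp: compact_closure)
  moreover have "(\<lambda>x. indicator ?S x *\<^sub>R f x) = f"
    using closure_subset[of "{x. f x \<noteq> 0}"] by (auto simp: fun_eq_iff indicator_def)
  ultimately show ?thesis by simp
qed

lemma lborel_integral_translate:
  fixes f :: "'a::euclidean_space \<Rightarrow> 'b::euclidean_space"
  assumes "integrable lborel f"
  shows "integrable lborel (\<lambda>x. f (c + x))" "(LINT x|lborel. f (c + x)) = (LINT x|lborel. f x)"
proof -
  have [measurable]: "f \<in> borel_measurable borel" using borel_measurable_integrable[OF assms] by simp
  have "integrable (distr lborel borel ((+) c)) f" using assms by (simp add: lborel_distr_plus)
  then show "integrable lborel (\<lambda>x. f (c + x))" by (subst (asm) integrable_distr_eq) auto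
  have "(LINT x|lborel. f x) = (LINT x|distr lborel borel ((+) c). f x)" by (simp add: lborel_distr_plus)
  also have "\<dots> = (LINT x|lborel. f (c + x))" by (rule integral_distr) auto
  finally show "(LINT x|lborel. f (c + x)) = (LINT x|lborel. f x)" by simp
qed

text \<open>Translation invariance makes the integrals of the difference quotients vanish.\<close>

lemma integral_partial_derivative:
  fixes f :: "'a::euclidean_space \<Rightarrow> real"
  assumes f: "C_k (Suc 0) f" and supp: "bounded {x. f x \<noteq> 0}" and b: "b \<in> Basis"
  shows "(LINT x|lborel. frechet_derivative f (at x) b) = 0"
proof -
  define D where "D x = frechet_derivative f (at x) b" for x
  have contD: "continuous_on UNIV D" using C_k_SucD(2)[OF f b] by (simp add: D_def)
  have contf: "continuous_on UNIV f" by (rule C_k_continuous[OF f])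
  have [measurable]: "D \<in> borel_measurable borel" "f \<in> borel_measurable borel"
    using contD contf by (auto intro: borel_measurable_continuous_onI)
  have intf: "integrable lborel f" by (rule integrable_bounded_support[OF contf supp])
  have der: "((\<lambda>s. f (x + s *\<^sub>R b)) has_real_derivative D (x + t *\<^sub>R b)) (at t)" for x t
  proof -
    have "((\<lambda>s. x + s *\<^sub>R b) has_derivative (\<lambda>s. s *\<^sub>R b)) (at t)"
      by (auto intro!: derivative_eq_intros)
    from has_derivative_compose[OF this C_k_SucD(1)[OF f]]
    have "((\<lambda>s. f (x + s *\<^sub>R b)) has_derivative (\<lambda>s. frechet_derivative f (at (x + t *\<^sub>R b)) (s *\<^sub>R b))) (at t)" .
    moreover have "frechet_derivative f (at y) (s *\<^sub>R b) = D y * s" for y s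
      using linear_scale[OF has_derivative_linear[OF C_k_SucD(1)[OF f]]] by (simp add: D_def mult.commute)
    ultimately show ?thesis by (simp add: has_field_derivative_def)
  qed
  obtain R where R: "\<And>x. f x \<noteq> 0 \<Longrightarrow> norm x \<le> R" using supp by (auto simp: bounded_iff)
  \<comment> \<open>Shifts have length at most 1. Outside radius \<open>R + 1\<close> both the point
    and its shift miss the support; inside, the intermediate point of the mean value theorem has
    norm at most \<open>R + 2\<close>, where \<open>B\<close> bounds the derivative.\<close>
  define K where "K = cball (0::'a) (R + 1)"
  have "compact (D ` cball 0 (R + 2))"
    by (intro compact_continuous_image continuous_on_subset[OF contD]) auto
  then obtain B where B: "\<And>x. norm x \<le> R + 2 \<Longrightarrow> \<bar>D x\<bar> \<le> B"
    using compact_imp_bounded by (force simp: bounded_iff dist_norm)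
  define t where "t n = inverse (real (Suc n))" for n
  have t: "0 < t n" "t n \<le> 1" for n by (auto simp: t_def field_simps)
  have t0: "t \<longlonglongrightarrow> 0" unfolding t_def by (rule LIMSEQ_inverse_real_of_nat)
  define Q where "Q n x = (f (t n *\<^sub>R b + x) - f x) / t n" for n x
  have [measurable]: "Q n \<in> borel_measurable borel" for n unfolding Q_def by measurable
  have nb: "norm b = 1" using b by simp
  have "(\<lambda>n. LINT x|lborel. Q n x) \<longlonglongrightarrow> (LINT x|lborel. D x)"
  proof (rule integral_dominated_convergence[where w = "\<lambda>x. indicator K x * B"])
    show "integrable lborel (\<lambda>x. indicator K x * B)"
      unfolding K_def by (intro integrable_mult_left integrable_real_indicator) (auto intro: emeasure_bounded_finite[unfolded infinity_ennreal_def])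
    show "AE x in lborel. (\<lambda>n. Q n x) \<longlonglongrightarrow> D x"
    proof (intro always_eventually allI)
      fix x
      have "((\<lambda>h. (f (x + h *\<^sub>R b) - f x) / h) \<longlongrightarrow> D x) (at 0)"
        using der[of x 0] by (simp add: has_field_derivative_iff)
      moreover have "filterlim t (at 0) sequentially"
        using t0 t(1) by (auto simp: filterlim_at intro!: always_eventually less_imp_neq[symmetric])
      ultimately show "(\<lambda>n. Q n x) \<longlonglongrightarrow> D x"
        unfolding Q_def add.commute[of "_ *\<^sub>R b" x] by (rule filterlim_compose)
    qed
    show "AE x in lborel. norm (Q n x) \<le> indicator K x * B" for n
    proof (intro always_eventually allI)
      fix x
      show "norm (Q n x) \<le> indicator K x * B"
      proof (cases "x \<in> K")
        case True
        obtain s where s: "0 < s" "s < t n" "f (x + t n *\<^sub>R b) - f (x + 0 *\<^sub>R b) = (t n - 0) * D (x + s *\<^sub>R b)"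
          using MVT2[OF t(1) der, of n x] by blast
        have "norm (x + s *\<^sub>R b) \<le> R + 2"
          using norm_triangle_ineq[of x "s *\<^sub>R b"] True s t(2)[of n] nb by (simp add: K_def)
        then show ?thesis
          using B[of "x + s *\<^sub>R b"] s t(1)[of n] True by (simp add: Q_def add.commute)
      next
        case False
        then have "norm x > R + 1" by (simp add: K_def)
        moreover have "norm x \<le> norm (t n *\<^sub>R b + x) + norm (t n *\<^sub>R b)"
          using norm_triangle_ineq4[of "t n *\<^sub>R b + x" "t n *\<^sub>R b"] by simp
        ultimately have "norm (t n *\<^sub>R b + x) > R" "norm x > R" using t[of n] nb by auto
        then show ?thesis using R[of x] R[of "t n *\<^sub>R b + x"] False by (force simp: Q_def)
      qed
    qed
  qed auto
  moreover have "(LINT x|lborel. Q n x) = 0" for n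
    unfolding Q_def using lborel_integral_translate[OF intf, of "t n *\<^sub>R b"] intf by simp
  ultimately show ?thesis by (simp add: D_def LIMSEQ_const_iff)
qed

text \<open>Apply the vanishing of integrated partial derivatives to
  \<open>f * (F \<bullet> b)\<close> in direction \<open>b\<close> and sum over the basis. The
  bounded support of \<open>f\<close> alone makes all integrands integrable.\<close>

lemma integration_by_parts:
  fixes f :: "'a::euclidean_space \<Rightarrow> real" and F :: "'a \<Rightarrow> 'a"
  assumes f: "C_k (Suc 0) f" and supp: "bounded {x. f x \<noteq> 0}" and F: "C_k (Suc 0) F"
  shows "(LINT x|lborel. grad f x \<bullet> F x) = - (LINT x|lborel. f x * divergence F x)"
proof -
  have 1: "integrable lborel (\<lambda>x. grad f x \<bullet> F x)"
    by (intro integrable_bounded_support continuous_on_inner bounded_support_inner bounded_support_grad supp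
        C_k_continuous[OF C_k_grad[OF f]] C_k_continuous[OF F])
  have 2: "integrable lborel (\<lambda>x. f x * divergence F x)"
    by (intro integrable_bounded_support continuous_on_mult bounded_support_mult supp
        C_k_continuous[OF C_k_divergence[OF F]] C_k_continuous[OF f])
  let ?D = "\<lambda>b x. frechet_derivative (\<lambda>x. f x * (F x \<bullet> b)) (at x) b"
  have Fb: "C_k (Suc 0) (\<lambda>x. f x * (F x \<bullet> b))" for b
    by (intro C_k_mult C_k_inner f F C_k_const)
  have D: "?D b x = f x * (frechet_derivative F (at x) b \<bullet> b) + frechet_derivative f (at x) b * (F x \<bullet> b)" for b x
  proof -
    have "((\<lambda>x. f x * (F x \<bullet> b)) has_derivative
      (\<lambda>h. f x * (frechet_derivative F (at x) h \<bullet> b) + frechet_derivative f (at x) h * (F x \<bullet> b))) (at x)"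
      by (intro has_derivative_mult has_derivative_inner_left C_k_SucD(1)[OF f] C_k_SucD(1)[OF F])
    from frechet_derivative_at[OF this] show ?thesis by metis
  qed
  have sum_D: "(\<Sum>b\<in>Basis. ?D b x) = grad f x \<bullet> F x + f x * divergence F x" for x
  proof -
    have "grad f x \<bullet> F x = (\<Sum>b\<in>Basis. frechet_derivative f (at x) b * (F x \<bullet> b))"
      unfolding euclidean_inner[of "grad f x" "F x"] by (rule sum.cong) (simp_all add: grad_inner_Basis)
    then show ?thesis
      unfolding D by (simp add: sum.distrib divergence_def sum_distrib_left)
  qed
  have "integrable lborel (?D b)" if "b \<in> Basis" for b
  proof -
    have "integrable lborel (\<lambda>x. grad (\<lambda>x. f x * (F x \<bullet> b)) x \<bullet> b)"
      by (intro integrable_bounded_support continuous_on_inner bounded_support_inner bounded_support_grad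
          bounded_support_mult supp C_k_continuous[OF C_k_grad[OF Fb]] continuous_on_const)
    then show ?thesis using that by (simp add: grad_inner_Basis)
  qed
  then have "(LINT x|lborel. (\<Sum>b\<in>Basis. ?D b x)) = (\<Sum>b\<in>Basis. LINT x|lborel. ?D b x)"
    by (rule Bochner_Integration.integral_sum)
  also have "\<dots> = 0"
    by (intro sum.neutral ballI integral_partial_derivative Fb bounded_support_mult supp)
  finally show ?thesis using 1 2 by (simp add: sum_D)
qed

section \<open>The space \<open>L\<^sup>2(\<pi>)\<close>\<close>

locale smooth_density =
  fixes \<pi> :: "'a::euclidean_space \<Rightarrow> real"
  assumes smooth_density: "smooth \<pi>" and density_pos: "\<And>x. \<pi> x > 0"
    and prob_density: "prob_space (dens_measure \<pi>)"
begin

abbreviation M :: "'a measure" where "M \<equiv> dens_measure \<pi>"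

sublocale prob_space M by (rule prob_density)

lemma sets_M [simp, measurable_cong]: "sets M = sets borel"
  by (simp add: dens_measure_def)

lemma space_M [simp]: "space M = UNIV"
  by (simp add: dens_measure_def)

lemma prob_UNIV [simp]: "prob UNIV = 1"
  using prob_space by (simp del: prob_space)

lemma density_borel [measurable]: "\<pi> \<in> borel_measurable borel"
  by (intro borel_measurable_continuous_onI C_k_continuous[OF smoothD[OF smooth_density, of 0]])

lemma integral_M:
  fixes f :: "'a \<Rightarrow> 'b::euclidean_space"
  assumes [measurable]: "f \<in> borel_measurable borel"
  shows "(LINT x|M. f x) = (LINT x|lborel. \<pi> x *\<^sub>R f x)"
  unfolding dens_measure_def using density_pos by (intro integral_density) (auto intro: less_imp_le)

lemma L2_borel: "f \<in> L2 \<pi> \<Longrightarrow> f \<in> borel_measurable borel"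
  by (simp add: L2_def)

lemma L2_square_integrable: "f \<in> L2 \<pi> \<Longrightarrow> integrable M (\<lambda>x. (norm (f x))\<^sup>2)"
  by (simp add: L2_def)

lemma L2_I:
  assumes "f \<in> borel_measurable borel" "integrable M g" "\<And>x. (norm (f x))\<^sup>2 \<le> g x"
  shows "f \<in> L2 \<pi>"
proof -
  note [measurable] = assms(1)
  have "norm ((norm (f x))\<^sup>2) \<le> norm (g x)" for x
    using assms(3)[of x] by (simp add: abs_le_iff order.trans[OF zero_le_power2 assms(3)])
  then show ?thesis
    unfolding L2_def using assms by (auto intro!: Bochner_Integration.integrable_bound[OF assms(2)])
qed

lemma L2_bounded:
  assumes "f \<in> borel_measurable borel" "\<And>x. norm (f x) \<le> B"
  shows "f \<in> L2 \<pi>"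
  using assms by (intro L2_I[where g = "\<lambda>_. B\<^sup>2"]) (auto intro: power_mono)

lemma L2_const: "(\<lambda>x. c) \<in> L2 \<pi>"
  by (rule L2_bounded) auto

lemma L2_scaleR_bounded:
  assumes "f \<in> L2 \<pi>" "m \<in> borel_measurable borel" "\<And>x. \<bar>m x\<bar> \<le> B"
  shows "(\<lambda>x. m x *\<^sub>R f x) \<in> L2 \<pi>"
proof (rule L2_I)
  note [measurable] = L2_borel[OF assms(1)] assms(2)
  show "(\<lambda>x. m x *\<^sub>R f x) \<in> borel_measurable borel" by measurable
  show "integrable M (\<lambda>x. B\<^sup>2 * (norm (f x))\<^sup>2)" using L2_square_integrable[OF assms(1)] by simp
  show "(norm (m x *\<^sub>R f x))\<^sup>2 \<le> B\<^sup>2 * (norm (f x))\<^sup>2" for x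
    using power_mono[OF assms(3)[of x], of 2] by (simp add: power_mult_distrib mult_right_mono)
qed

lemma inner_bounded_square: "norm v \<le> B \<Longrightarrow> (norm (v \<bullet> w))\<^sup>2 \<le> B\<^sup>2 * (norm w)\<^sup>2"
  using power_mono[of "\<bar>v \<bullet> w\<bar>" "B * norm w" 2] Cauchy_Schwarz_ineq2[of v w] mult_right_mono[of "norm v" B "norm w"]
  by (simp add: power_mult_distrib)

lemma L2_inner_bounded:
  assumes "f \<in> L2 \<pi>" "v \<in> borel_measurable borel" "\<And>x. norm (v x) \<le> B"
  shows "(\<lambda>x. v x \<bullet> f x) \<in> L2 \<pi>"
proof (rule L2_I)
  note [measurable] = L2_borel[OF assms(1)] assms(2)
  show "(\<lambda>x. v x \<bullet> f x) \<in> borel_measurable borel" by measurable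
  show "integrable M (\<lambda>x. B\<^sup>2 * (norm (f x))\<^sup>2)" using L2_square_integrable[OF assms(1)] by simp
  show "(norm (v x \<bullet> f x))\<^sup>2 \<le> B\<^sup>2 * (norm (f x))\<^sup>2" for x
    by (rule inner_bounded_square[OF assms(3)])
qed

lemma L2_lincomb:
  assumes "f \<in> L2 \<pi>" "g \<in> L2 \<pi>"
  shows "(\<lambda>x. a *\<^sub>R f x + b *\<^sub>R g x) \<in> L2 \<pi>"
proof (rule L2_I)
  note [measurable] = L2_borel[OF assms(1)] L2_borel[OF assms(2)]
  show "(\<lambda>x. a *\<^sub>R f x + b *\<^sub>R g x) \<in> borel_measurable borel" by measurable
  show "integrable M (\<lambda>x. 2 * a\<^sup>2 * (norm (f x))\<^sup>2 + 2 * b\<^sup>2 * (norm (g x))\<^sup>2)"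
    using assms[THEN L2_square_integrable] by simp
  show "(norm (a *\<^sub>R f x + b *\<^sub>R g x))\<^sup>2 \<le> 2 * a\<^sup>2 * (norm (f x))\<^sup>2 + 2 * b\<^sup>2 * (norm (g x))\<^sup>2" for x
  proof -
    have "(norm (a *\<^sub>R f x + b *\<^sub>R g x))\<^sup>2 \<le> (\<bar>a\<bar> * norm (f x) + \<bar>b\<bar> * norm (g x))\<^sup>2"
      using norm_triangle_ineq[of "a *\<^sub>R f x" "b *\<^sub>R g x"] by (intro power_mono) auto
    also have "\<dots> \<le> 2 * (\<bar>a\<bar> * norm (f x))\<^sup>2 + 2 * (\<bar>b\<bar> * norm (g x))\<^sup>2"
      using sum_squares_bound[of "\<bar>a\<bar> * norm (f x)" "\<bar>b\<bar> * norm (g x)"] by (simp add: power2_sum)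
    finally show ?thesis by (simp add: power_mult_distrib)
  qed
qed

lemma L2_inner_integrable:
  assumes "f \<in> L2 \<pi>" "g \<in> L2 \<pi>"
  shows "integrable M (\<lambda>x. f x \<bullet> g x)"
proof (rule Bochner_Integration.integrable_bound)
  note [measurable] = L2_borel[OF assms(1)] L2_borel[OF assms(2)]
  show "integrable M (\<lambda>x. (norm (f x))\<^sup>2 + (norm (g x))\<^sup>2)" using assms[THEN L2_square_integrable] by simp
  show "(\<lambda>x. f x \<bullet> g x) \<in> borel_measurable M" by measurable
  show "AE x in M. norm (f x \<bullet> g x) \<le> norm ((norm (f x))\<^sup>2 + (norm (g x))\<^sup>2)"
  proof (intro always_eventually allI)
    fix x
    have "\<bar>f x \<bullet> g x\<bar> \<le> norm (f x) * norm (g x)" by (rule Cauchy_Schwarz_ineq2)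
    also have "\<dots> \<le> (norm (f x))\<^sup>2 + (norm (g x))\<^sup>2"
      using sum_squares_bound[of "norm (f x)" "norm (g x)"] mult_nonneg_nonneg[OF norm_ge_zero[of "f x"] norm_ge_zero[of "g x"]]
      by linarith
    finally show "norm (f x \<bullet> g x) \<le> norm ((norm (f x))\<^sup>2 + (norm (g x))\<^sup>2)" by simp
  qed
qed

abbreviation ip :: "('a \<Rightarrow> 'b::euclidean_space) \<Rightarrow> ('a \<Rightarrow> 'b) \<Rightarrow> real" where "ip \<equiv> L2_inner \<pi>"

abbreviation nm :: "('a \<Rightarrow> 'b::euclidean_space) \<Rightarrow> real" where "nm \<equiv> L2_norm \<pi>"

lemma semi_inner_L2: "semi_inner (L2 \<pi> :: ('a \<Rightarrow> 'b::euclidean_space) set) (L2_inner \<pi>)"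
proof
  fix f g h :: "'a \<Rightarrow> 'b" and a b :: real
  assume f: "f \<in> L2 \<pi>"
  show "0 \<le> ip f f" unfolding L2_inner_def by (intro integral_nonneg_AE) simp
  assume g: "g \<in> L2 \<pi>"
  show "(\<lambda>x. a *\<^sub>R f x + b *\<^sub>R g x) \<in> L2 \<pi>" using f g by (rule L2_lincomb)
  show "ip f g = ip g f" by (simp add: L2_inner_def inner_commute)
  assume h: "h \<in> L2 \<pi>"
  show "ip (\<lambda>x. a *\<^sub>R f x + b *\<^sub>R g x) h = a * ip f h + b * ip g h"
    using L2_inner_integrable[OF f h] L2_inner_integrable[OF g h]
    by (simp add: L2_inner_def inner_add_left)
qed (rule L2_const)

lemma L2_nrm: "semi_inner.nrm (L2_inner \<pi>) = (L2_norm \<pi> :: ('a \<Rightarrow> 'b::euclidean_space) \<Rightarrow> real)"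
  using semi_inner.nrm_def[OF semi_inner_L2] by (auto simp: L2_norm_def fun_eq_iff)

sublocale S: semi_inner "L2 \<pi> :: ('a \<Rightarrow> real) set" "ip"
  rewrites "semi_inner.nrm (L2_inner \<pi>) = (L2_norm \<pi> :: ('a \<Rightarrow> real) \<Rightarrow> real)"
  by (rule semi_inner_L2, rule L2_nrm)

sublocale W: semi_inner "L2 \<pi> :: ('a \<Rightarrow> 'a) set" "ip"
  rewrites "semi_inner.nrm (L2_inner \<pi>) = (L2_norm \<pi> :: ('a \<Rightarrow> 'a) \<Rightarrow> real)"
  by (rule semi_inner_L2, rule L2_nrm)

lemma L2_inner_self: "ip f f = (LINT x|M. (norm (f x))\<^sup>2)"
  by (simp add: L2_inner_def power2_norm_eq_inner)

lemma L2_norm_sq: "(L2_norm \<pi> f)\<^sup>2 = (LINT x|M. (norm (f x))\<^sup>2)"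
  unfolding L2_norm_def L2_inner_self by (intro real_sqrt_pow2 integral_nonneg_AE) simp

lemma L2_integrable:
  assumes "f \<in> L2 \<pi>"
  shows "integrable M f"
proof (rule Bochner_Integration.integrable_bound)
  note [measurable] = L2_borel[OF assms]
  show "integrable M (\<lambda>x. 1 + (norm (f x))\<^sup>2)" using L2_square_integrable[OF assms] by simp
  show "f \<in> borel_measurable M" by measurable
  have "norm (f x) \<le> 1 + (norm (f x))\<^sup>2" for x
    using sum_squares_bound[of "norm (f x)" 1] norm_ge_zero[of "f x"] by (simp del: norm_ge_zero)
  then show "AE x in M. norm (f x) \<le> norm (1 + (norm (f x))\<^sup>2)" by (intro always_eventually allI) simp
qed

lemma L2_inner_cong_AE:
  assumes "AE x in M. f x = f' x" "AE x in M. g x = g' x"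
    and "f \<in> L2 \<pi>" "f' \<in> L2 \<pi>" "g \<in> L2 \<pi>" "g' \<in> L2 \<pi>"
  shows "ip f g = ip f' g'"
  unfolding L2_inner_def
proof (rule integral_cong_AE)
  note [measurable] = assms(3-6)[THEN L2_borel]
  show "(\<lambda>x. f x \<bullet> g x) \<in> borel_measurable M" "(\<lambda>x. f' x \<bullet> g' x) \<in> borel_measurable M" by measurable
qed (use assms(1,2) in \<open>eventually_elim, simp\<close>)

lemma L2_inner_zero_AE:
  assumes "f \<in> L2 \<pi>" "ip f f = 0"
  shows "AE x in M. f x = 0"
proof -
  have "AE x in M. (norm (f x))\<^sup>2 = 0"
    using assms L2_square_integrable[OF assms(1)] by (simp add: L2_inner_self integral_nonneg_eq_0_iff_AE)
  then show ?thesis by eventually_elim simp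
qed

lemma L2_norm_zero_AE: "AE x in M. f x = 0 \<Longrightarrow> f \<in> borel_measurable borel \<Longrightarrow> nm f = 0"
proof -
  assume "AE x in M. f x = 0" and [measurable]: "f \<in> borel_measurable borel"
  then have "(LINT x|M. (norm (f x))\<^sup>2) = (LINT x|M. 0)"
    by (intro integral_cong_AE) auto
  then show ?thesis by (simp add: L2_norm_def L2_inner_self)
qed

lemma L2_nn_integral:
  assumes "f \<in> L2 \<pi>"
  shows "(\<integral>\<^sup>+x. ennreal ((norm (f x))\<^sup>2) \<partial>M) = ennreal ((L2_norm \<pi> f)\<^sup>2)"
  using L2_square_integrable[OF assms] by (simp add: nn_integral_eq_integral L2_norm_sq)

text \<open>Cauchy-Schwarz against the constant 1, which has norm 1 because the total mass is
  1.\<close>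

lemma L1_le_L2:
  assumes "f \<in> L2 \<pi>"
  shows "(LINT x|M. norm (f x)) \<le> nm f"
proof -
  have [measurable]: "f \<in> borel_measurable borel" by (rule L2_borel[OF assms])
  have g: "(\<lambda>x. norm (f x)) \<in> L2 \<pi>"
    using L2_square_integrable[OF assms] unfolding L2_def by simp
  have "nm (\<lambda>x. norm (f x)) = nm f" by (simp add: L2_norm_def L2_inner_self)
  moreover have "nm (\<lambda>x. 1::real) = 1" by (simp add: L2_norm_def L2_inner_self)
  ultimately show ?thesis using S.cauchy_schwarz[OF g L2_const[of 1]] by (simp add: L2_inner_def)
qed

text \<open>The Riesz-Fischer argument. Along a subsequence the increments have summable L1 norms,
  so they are absolutely summable almost everywhere and a pointwise limit exists; Fatou's lemma then
  bounds the distance of the original sequence to it.\<close>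

lemma L2_complete:
  fixes F :: "nat \<Rightarrow> 'a \<Rightarrow> 'b::euclidean_space"
  assumes F: "\<And>n. F n \<in> L2 \<pi>"
    and cauchy: "\<And>e. e > 0 \<Longrightarrow> \<exists>N. \<forall>m\<ge>N. \<forall>n\<ge>N. nm (\<lambda>x. F m x - F n x) < e"
  shows "\<exists>f\<in>L2 \<pi>. (\<lambda>n. nm (\<lambda>x. F n x - f x)) \<longlonglongrightarrow> 0"
proof -
  interpret B: semi_inner "L2 \<pi> :: ('a \<Rightarrow> 'b) set" "ip"
    rewrites "semi_inner.nrm (L2_inner \<pi>) = (L2_norm \<pi> :: ('a \<Rightarrow> 'b) \<Rightarrow> real)"
    by (rule semi_inner_L2, rule L2_nrm)
  note [measurable] = L2_borel[OF F]
  have "\<forall>k. \<exists>N. \<forall>m\<ge>N. \<forall>n\<ge>N. nm (\<lambda>x. F m x - F n x) < (1 / 2) ^ k"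
    using cauchy by simp
  then obtain N where N: "\<And>k m n. m \<ge> N k \<Longrightarrow> n \<ge> N k \<Longrightarrow> nm (\<lambda>x. F m x - F n x) < (1 / 2) ^ k"
    by metis
  \<comment> \<open>A sum dominates all of its terms, so \<open>r k\<close> lies beyond every
    \<open>N j\<close> with \<open>j\<close> at most \<open>k\<close>, in particular beyond the
    threshold for tolerance \<open>(1 / 2) ^ k\<close>.\<close>
  define r where "r k = (\<Sum>j\<le>k. N j)" for k
  have r_ge: "N j \<le> r k" if "j \<le> k" for j k
    unfolding r_def using that by (intro member_le_sum) auto
  define D where "D k x = norm (F (r (Suc k)) x - F (r k) x)" for k x
  have D_nonneg: "0 \<le> D k x" for k x by (simp add: D_def)
  have [measurable]: "D k \<in> borel_measurable borel" for k unfolding D_def by measurable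
  have D_int: "(\<integral>\<^sup>+x. ennreal (D k x) \<partial>M) \<le> ennreal ((1 / 2) ^ k)" for k
  proof -
    have L: "(\<lambda>x. F (r (Suc k)) x - F (r k) x) \<in> L2 \<pi>" by (rule B.V_diff[OF F F])
    have "(LINT x|M. D k x) \<le> (1 / 2) ^ k"
      using L1_le_L2[OF L] N[of k "r (Suc k)" "r k"] r_ge[of k] unfolding D_def by simp
    moreover have "integrable M (D k)"
      unfolding D_def by (rule integrable_norm[OF L2_integrable[OF L]])
    ultimately show ?thesis
      by (subst nn_integral_eq_integral) (auto simp: D_nonneg intro: ennreal_leI)
  qed
  have "(\<integral>\<^sup>+x. (\<Sum>k. ennreal (D k x)) \<partial>M) = (\<Sum>k. \<integral>\<^sup>+x. ennreal (D k x) \<partial>M)"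
    by (rule nn_integral_suminf) simp
  also have "\<dots> \<le> (\<Sum>k. ennreal ((1 / 2) ^ k))" by (rule suminf_le[OF D_int]) auto
  also have "\<dots> < \<infinity>"
    by (subst suminf_ennreal2) (auto intro!: summable_geometric)
  finally have "AE x in M. (\<Sum>k. ennreal (D k x)) \<noteq> \<infinity>"
    by (intro nn_integral_noteq_infinite) auto
  then have conv: "AE x in M. (\<lambda>k. F (r k) x) \<longlonglongrightarrow> lim (\<lambda>k. F (r k) x)"
  proof eventually_elim
    case (elim x)
    then have "summable (\<lambda>k. D k x)"
      by (intro summable_suminf_not_top) (auto simp: D_def)
    then have "summable (\<lambda>k. F (r (Suc k)) x - F (r k) x)"
      unfolding D_def by (rule summable_norm_cancel)
    then have "convergent (\<lambda>n. \<Sum>k<n. F (r (Suc k)) x - F (r k) x)"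
      by (simp add: summable_iff_convergent)
    then have "convergent (\<lambda>n. F (r n) x - F (r 0) x)"
      by (simp add: sum_lessThan_telescope[of "\<lambda>k. F (r k) x"])
    from convergent_add[OF this convergent_const[of "F (r 0) x"]]
    show ?case by (simp add: convergent_LIMSEQ_iff)
  qed
  \<comment> \<open>On the null set without convergence \<open>lim\<close> is a default value;
    \<open>f\<close> is still Borel measurable everywhere.\<close>
  define f where "f x = lim (\<lambda>k. F (r k) x)" for x
  have [measurable]: "f \<in> borel_measurable borel" unfolding f_def by measurable
  \<comment> \<open>Fatou yields membership and rate at once, which is why the membership of
    \<open>f\<close> is deduced from that of the difference afterwards.\<close>
  have key: "(\<lambda>x. F m x - f x) \<in> L2 \<pi> \<and> nm (\<lambda>x. F m x - f x) \<le> (1 / 2) ^ j" if m: "m \<ge> N j" for j m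
  proof -
    have "(\<integral>\<^sup>+x. ennreal ((norm (F m x - f x))\<^sup>2) \<partial>M)
      = (\<integral>\<^sup>+x. liminf (\<lambda>k. ennreal ((norm (F m x - F (r k) x))\<^sup>2)) \<partial>M)"
    proof (rule nn_integral_cong_AE)
      show "AE x in M. ennreal ((norm (F m x - f x))\<^sup>2) = liminf (\<lambda>k. ennreal ((norm (F m x - F (r k) x))\<^sup>2))"
        using conv
      proof eventually_elim
        case (elim x)
        have "(\<lambda>k. ennreal ((norm (F m x - F (r k) x))\<^sup>2)) \<longlonglongrightarrow> ennreal ((norm (F m x - f x))\<^sup>2)"
          unfolding f_def by (intro tendsto_ennrealI tendsto_intros elim)
        then show ?case by (intro lim_imp_Liminf[symmetric] sequentially_bot)
      qed
    qed
    also have "\<dots> \<le> liminf (\<lambda>k. \<integral>\<^sup>+x. ennreal ((norm (F m x - F (r k) x))\<^sup>2) \<partial>M)"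
      by (rule nn_integral_liminf) simp
    also have "\<dots> \<le> ennreal (((1 / 2) ^ j)\<^sup>2)"
    proof (rule Liminf_le)
      have "(\<integral>\<^sup>+x. ennreal ((norm (F m x - F (r k) x))\<^sup>2) \<partial>M) \<le> ennreal (((1 / 2) ^ j)\<^sup>2)" if "k \<ge> j" for k
        using L2_nn_integral[OF B.V_diff[OF F[of m] F[of "r k"]]] N[of j m "r k"] m r_ge[OF that]
          B.nrm_nonneg[OF B.V_diff[OF F[of m] F[of "r k"]]]
        by (auto intro!: ennreal_leI power_mono)
      then show "\<forall>\<^sub>F k in sequentially. (\<integral>\<^sup>+x. ennreal ((norm (F m x - F (r k) x))\<^sup>2) \<partial>M) \<le> ennreal (((1 / 2) ^ j)\<^sup>2)"
        by (auto simp: eventually_sequentially)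
    qed simp
    finally have fin: "(\<integral>\<^sup>+x. ennreal ((norm (F m x - f x))\<^sup>2) \<partial>M) \<le> ennreal (((1 / 2) ^ j)\<^sup>2)" .
    then have "(\<integral>\<^sup>+x. ennreal ((norm (F m x - f x))\<^sup>2) \<partial>M) < \<infinity>"
      by (simp add: le_less_trans)
    then have "integrable M (\<lambda>x. (norm (F m x - f x))\<^sup>2)"
      by (intro integrableI_nonneg) auto
    then have L: "(\<lambda>x. F m x - f x) \<in> L2 \<pi>" unfolding L2_def by simp
    have "(L2_norm \<pi> (\<lambda>x. F m x - f x))\<^sup>2 \<le> ((1 / 2) ^ j)\<^sup>2"
      using fin unfolding L2_nn_integral[OF L] by simp
    then show ?thesis using L by (auto intro: power2_le_imp_le)
  qed
  have "(\<lambda>x. F (N 0) x - f x) \<in> L2 \<pi>" using key[of 0 "N 0"] by simp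
  from B.V_diff[OF F[of "N 0"] this] have fL: "f \<in> L2 \<pi>" by simp
  moreover have "(\<lambda>n. nm (\<lambda>x. F n x - f x)) \<longlonglongrightarrow> 0"
  proof (rule LIMSEQ_I)
    fix e :: real assume "e > 0"
    then obtain j where "(1 / 2) ^ j < e" using real_arch_pow_inv[of e "1/2"] by auto
    then show "\<exists>n0. \<forall>n\<ge>n0. norm (L2_norm \<pi> (\<lambda>x. F n x - f x) - 0) < e"
      using key[of j] B.nrm_nonneg[OF B.V_diff[OF F fL]] by (intro exI[of _ "N j"]) force
  qed
  ultimately show ?thesis by blast
qed

end

section \<open>Weak gradients\<close>

lemma test_lincomb:
  assumes "\<phi> \<in> test_functions" "\<psi> \<in> test_functions"
  shows "(\<lambda>x. a * \<phi> x + b * \<psi> x) \<in> test_functions"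
proof -
  have "bounded {x. a * \<phi> x + b * \<psi> x \<noteq> 0}"
    by (rule bounded_subset[of "{x. \<phi> x \<noteq> 0} \<union> {x. \<psi> x \<noteq> 0}"])
      (use assms[THEN test_support] in auto)
  moreover have "smooth (\<lambda>x. a * \<phi> x + b * \<psi> x)"
    unfolding smooth_def by (intro allI C_k_add C_k_cmult assms[THEN test_C_k])
  ultimately show ?thesis by (simp add: test_functions_def compact_closure)
qed

lemma test_differentiable: "\<phi> \<in> test_functions \<Longrightarrow> \<phi> differentiable (at x)"
  using test_C_k[of \<phi> "Suc 0"] by simp

lemma grad_lincomb:
  assumes "f differentiable (at x)" "g differentiable (at x)"
  shows "grad (\<lambda>x. a * f x + b * g x) x = a *\<^sub>R grad f x + b *\<^sub>R grad g x"
proof (rule grad_has_derivative)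
  have "((\<lambda>x. a * f x + b * g x) has_derivative (\<lambda>h. a * (grad f x \<bullet> h) + b * (grad g x \<bullet> h))) (at x)"
    by (intro has_derivative_add has_derivative_mult_right has_derivative_grad assms)
  then show "((\<lambda>x. a * f x + b * g x) has_derivative (\<bullet>) (a *\<^sub>R grad f x + b *\<^sub>R grad g x)) (at x)"
    by (rule has_derivative_eq_rhs) (simp add: fun_eq_iff inner_add_left)
qed

lemma grad_mult:
  assumes "f differentiable (at x)" "g differentiable (at x)"
  shows "grad (\<lambda>x. f x * g x) x = f x *\<^sub>R grad g x + g x *\<^sub>R grad f x"
proof (rule grad_has_derivative)
  have "((\<lambda>x. f x * g x) has_derivative (\<lambda>h. f x * (grad g x \<bullet> h) + (grad f x \<bullet> h) * g x)) (at x)"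
    by (intro has_derivative_mult has_derivative_grad assms)
  then show "((\<lambda>x. f x * g x) has_derivative (\<bullet>) (f x *\<^sub>R grad g x + g x *\<^sub>R grad f x)) (at x)"
    by (rule has_derivative_eq_rhs) (simp add: fun_eq_iff inner_add_left mult.commute)
qed

context smooth_density
begin

lemma C_k_density: "C_k k \<pi>"
  by (rule smoothD[OF smooth_density])

lemma L2_bounded_support:
  fixes f :: "'a \<Rightarrow> 'b::euclidean_space"
  assumes "continuous_on UNIV f" "bounded {x. f x \<noteq> 0}"
  shows "f \<in> L2 \<pi>"
  by (rule bounded_continuous_bounded_support[OF assms])
    (auto intro: L2_bounded borel_measurable_continuous_onI assms)

lemma test_L2: "\<phi> \<in> test_functions \<Longrightarrow> \<phi> \<in> L2 \<pi>"
  by (intro L2_bounded_support C_k_continuous[OF test_C_k[of _ 0]] test_support)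

lemma test_grad_L2: "\<phi> \<in> test_functions \<Longrightarrow> grad \<phi> \<in> L2 \<pi>"
  by (intro L2_bounded_support C_k_continuous[OF C_k_grad[OF test_C_k[of _ "Suc 0"]]]
      bounded_support_grad test_support)

text \<open>Constants are integrable for a probability measure, so a uniform bound already serves as
  dominating function.\<close>

lemma L2_norm_bounded_tendsto:
  fixes f :: "'a \<Rightarrow> 'b::euclidean_space"
  assumes [measurable]: "\<And>n. F n \<in> borel_measurable borel"
    and B: "\<And>n x. norm (F n x) \<le> B" and lim: "\<And>x. (\<lambda>n. F n x) \<longlonglongrightarrow> f x"
  shows "(\<lambda>n. nm (\<lambda>x. F n x - f x)) \<longlonglongrightarrow> 0"
proof -
  have [measurable]: "f \<in> borel_measurable borel" by (rule borel_measurable_LIMSEQ_metric[OF _ lim]) simp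
  have Bf: "norm (f x) \<le> B" for x
    by (rule LIMSEQ_le_const2[OF tendsto_norm[OF lim]]) (use B in blast)
  have "(\<lambda>n. LINT x|M. (norm (F n x - f x))\<^sup>2) \<longlonglongrightarrow> (LINT x|M. 0)"
  proof (rule integral_dominated_convergence[where w = "\<lambda>_. (2 * B)\<^sup>2"])
    show "AE x in M. (\<lambda>n. (norm (F n x - f x))\<^sup>2) \<longlonglongrightarrow> 0"
    proof (intro always_eventually allI)
      fix x
      have "(\<lambda>n. (norm (F n x - f x))\<^sup>2) \<longlonglongrightarrow> (norm (f x - f x))\<^sup>2" by (intro tendsto_intros lim)
      then show "(\<lambda>n. (norm (F n x - f x))\<^sup>2) \<longlonglongrightarrow> 0" by simp
    qed
    show "AE x in M. norm ((norm (F n x - f x))\<^sup>2) \<le> (2 * B)\<^sup>2" for n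
    proof (intro always_eventually allI)
      fix x
      have "norm (F n x - f x) \<le> 2 * B" using norm_triangle_ineq4[of "F n x" "f x"] B[of n x] Bf[of x] by linarith
      then have "(norm (F n x - f x))\<^sup>2 \<le> (2 * B)\<^sup>2" by (intro power_mono) auto
      then show "norm ((norm (F n x - f x))\<^sup>2) \<le> (2 * B)\<^sup>2" by simp
    qed
  qed auto
  then have "(\<lambda>n. sqrt (LINT x|M. (norm (F n x - f x))\<^sup>2)) \<longlonglongrightarrow> sqrt 0"
    by (intro tendsto_real_sqrt) simp
  then show ?thesis by (simp add: L2_norm_def L2_inner_self)
qed

abbreviation L2_lim :: "(nat \<Rightarrow> 'a \<Rightarrow> 'b::euclidean_space) \<Rightarrow> ('a \<Rightarrow> 'b) \<Rightarrow> bool" where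
  "L2_lim F f \<equiv> (\<lambda>n. nm (\<lambda>x. F n x - f x)) \<longlonglongrightarrow> 0"

lemma gradient_L2: "has_L2_gradient \<pi> f G \<Longrightarrow> f \<in> L2 \<pi>" "has_L2_gradient \<pi> f G \<Longrightarrow> G \<in> L2 \<pi>"
  by (auto simp: has_L2_gradient_def)

lemma gradient_approx:
  assumes "has_L2_gradient \<pi> f G"
  obtains \<phi> where "\<And>n. \<phi> n \<in> test_functions" "L2_lim \<phi> f"
    "L2_lim (\<lambda>n. grad (\<phi> n)) G"
  using assms by (auto simp: has_L2_gradient_def)

text \<open>A diagonal choice: replace the n-th pair by one test function that is within
  \<open>1 / (n + 1)\<close> of it both in value and in gradient.\<close>

lemma gradient_closed:
  assumes F: "\<And>n. has_L2_gradient \<pi> (F n) (H n)" and f: "f \<in> L2 \<pi>" and G: "G \<in> L2 \<pi>"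
    and Ff: "L2_lim F f"
    and HG: "L2_lim H G"
  shows "has_L2_gradient \<pi> f G"
proof -
  note L2 = gradient_L2[OF F]
  have "\<exists>\<phi>\<in>test_functions. nm (\<lambda>x. \<phi> x - F n x) < inverse (real (Suc n)) \<and>
     nm (\<lambda>x. grad \<phi> x - H n x) < inverse (real (Suc n))" for n
  proof -
    obtain \<psi> where \<psi>: "\<And>k. \<psi> k \<in> test_functions" "(\<lambda>k. nm (\<lambda>x. \<psi> k x - F n x)) \<longlonglongrightarrow> 0"
      "(\<lambda>k. nm (\<lambda>x. grad (\<psi> k) x - H n x)) \<longlonglongrightarrow> 0"
      using gradient_approx[OF F[of n]] by blast
    have "\<forall>\<^sub>F k in sequentially. nm (\<lambda>x. \<psi> k x - F n x) < inverse (real (Suc n)) \<and>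
       nm (\<lambda>x. grad (\<psi> k) x - H n x) < inverse (real (Suc n))"
      by (intro eventually_conj order_tendstoD(2)[OF \<psi>(2)] order_tendstoD(2)[OF \<psi>(3)]) auto
    then show ?thesis using \<psi>(1) by (auto simp: eventually_sequentially)
  qed
  then obtain \<phi> where \<phi>: "\<And>n. \<phi> n \<in> test_functions"
      "\<And>n. nm (\<lambda>x. \<phi> n x - F n x) < inverse (real (Suc n))"
      "\<And>n. nm (\<lambda>x. grad (\<phi> n) x - H n x) < inverse (real (Suc n))"
    by metis
  have 1: "L2_lim \<phi> f"
  proof (rule S.lim_trans[OF L2(1) test_L2[OF \<phi>(1)] f _ Ff], rule Lim_null_comparison[OF _ LIMSEQ_inverse_real_of_nat])
    show "\<forall>\<^sub>F n in sequentially. norm (L2_norm \<pi> (\<lambda>x. \<phi> n x - F n x)) \<le> inverse (real (Suc n))"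
      using \<phi>(2)[THEN less_imp_le] S.nrm_nonneg[OF S.V_diff[OF test_L2[OF \<phi>(1)] L2(1)]]
      by (intro always_eventually) simp
  qed
  have 2: "L2_lim (\<lambda>n. grad (\<phi> n)) G"
  proof (rule W.lim_trans[OF L2(2) test_grad_L2[OF \<phi>(1)] G _ HG], rule Lim_null_comparison[OF _ LIMSEQ_inverse_real_of_nat])
    show "\<forall>\<^sub>F n in sequentially. norm (L2_norm \<pi> (\<lambda>x. grad (\<phi> n) x - H n x)) \<le> inverse (real (Suc n))"
      using \<phi>(3)[THEN less_imp_le] W.nrm_nonneg[OF W.V_diff[OF test_grad_L2[OF \<phi>(1)] L2(2)]]
      by (intro always_eventually) simp
  qed
  show ?thesis
    unfolding has_L2_gradient_def using f G \<phi>(1) 1 2 by blast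
qed

lemma gradient_test:
  assumes "\<phi> \<in> test_functions"
  shows "has_L2_gradient \<pi> \<phi> (grad \<phi>)"
  unfolding has_L2_gradient_def
  by (intro conjI test_L2 test_grad_L2 assms exI[of _ "\<lambda>_. \<phi>"])
    (simp_all add: assms L2_norm_zero_AE)

lemma gradient_lincomb:
  assumes "has_L2_gradient \<pi> f G" "has_L2_gradient \<pi> g H"
  shows "has_L2_gradient \<pi> (\<lambda>x. a * f x + b * g x) (\<lambda>x. a *\<^sub>R G x + b *\<^sub>R H x)"
proof -
  obtain \<phi> where \<phi>: "\<And>n. \<phi> n \<in> test_functions" "L2_lim \<phi> f"
    "L2_lim (\<lambda>n. grad (\<phi> n)) G"
    using gradient_approx[OF assms(1)] by blast
  obtain \<psi> where \<psi>: "\<And>n. \<psi> n \<in> test_functions" "L2_lim \<psi> g"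
    "L2_lim (\<lambda>n. grad (\<psi> n)) H"
    using gradient_approx[OF assms(2)] by blast
  note f = gradient_L2[OF assms(1)] and g = gradient_L2[OF assms(2)]
  let ?\<chi> = "\<lambda>n x. a * \<phi> n x + b * \<psi> n x"
  have 1: "(\<lambda>n. nm (\<lambda>x. ?\<chi> n x - (a * f x + b * g x))) \<longlonglongrightarrow> 0"
    using S.lim_lincomb[OF test_L2[OF \<phi>(1)] test_L2[OF \<psi>(1)] f(1) g(1) \<phi>(2) \<psi>(2)] by simp
  have 2: "(\<lambda>n. nm (\<lambda>x. grad (?\<chi> n) x - (a *\<^sub>R G x + b *\<^sub>R H x))) \<longlonglongrightarrow> 0"
    using W.lim_lincomb[OF test_grad_L2[OF \<phi>(1)] test_grad_L2[OF \<psi>(1)] f(2) g(2) \<phi>(3) \<psi>(3)]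
    by (simp add: grad_lincomb test_differentiable \<phi>(1) \<psi>(1))
  show ?thesis
    unfolding has_L2_gradient_def
    using S.V_lincomb[OF f(1) g(1), of a b] W.V_lincomb[OF f(2) g(2), of a b] 1 2
    by (auto intro!: exI[of _ ?\<chi>] test_lincomb \<phi> \<psi>)
qed

text \<open>The constant sequence with value \<open>f\<close> converges in L2 to any modification of
  \<open>f\<close>, so closedness of the gradient applies.\<close>

lemma gradient_cong_AE:
  assumes "has_L2_gradient \<pi> f G" "AE x in M. f x = f' x" "AE x in M. G x = G' x"
    and "f' \<in> borel_measurable borel" "G' \<in> borel_measurable borel"
  shows "has_L2_gradient \<pi> f' G'"
proof -
  note [measurable] = assms(4,5) gradient_L2(1)[OF assms(1), THEN L2_borel] gradient_L2(2)[OF assms(1), THEN L2_borel]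
  have f': "f' \<in> L2 \<pi>"
  proof -
    have "integrable M (\<lambda>x. (norm (f' x))\<^sup>2) \<longleftrightarrow> integrable M (\<lambda>x. (norm (f x))\<^sup>2)"
      by (rule integrable_cong_AE) (use assms(2) in \<open>auto\<close>)
    then show ?thesis using gradient_L2(1)[OF assms(1)] assms(4) by (simp add: L2_def)
  qed
  have G': "G' \<in> L2 \<pi>"
  proof -
    have "integrable M (\<lambda>x. (norm (G' x))\<^sup>2) \<longleftrightarrow> integrable M (\<lambda>x. (norm (G x))\<^sup>2)"
      by (rule integrable_cong_AE) (use assms(3) in \<open>auto\<close>)
    then show ?thesis using gradient_L2(2)[OF assms(1)] assms(5) by (simp add: L2_def)
  qed
  show ?thesis
    by (rule gradient_closed[OF assms(1) f' G'])
      (use assms(2,3) in \<open>auto simp: L2_norm_zero_AE\<close>)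
qed

text \<open>The cut-offs tend to 1 and their gradients to 0, both boundedly, hence in L2 of a finite
  measure. Subtracting a mean therefore stays within the domain of the gradient.\<close>

lemma gradient_const: "has_L2_gradient \<pi> (\<lambda>_. c) (\<lambda>_. 0)"
proof -
  have "has_L2_gradient \<pi> (\<lambda>_. 1) (\<lambda>_. 0)"
    unfolding has_L2_gradient_def
  proof (intro conjI exI[of _ cutoff] L2_const allI cutoff_test)
    show "(\<lambda>n. nm (\<lambda>x. cutoff n x - 1)) \<longlonglongrightarrow> 0"
      by (rule L2_norm_bounded_tendsto[where B = 1])
        (auto intro: test_borel cutoff_test cutoff_tendsto simp: cutoff_nonneg cutoff_le_1)
    show "(\<lambda>n. nm (\<lambda>x. grad (cutoff n) x - 0)) \<longlonglongrightarrow> 0"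
      by (rule L2_norm_bounded_tendsto[where B = 4])
        (auto intro: L2_borel test_grad_L2 cutoff_test grad_cutoff_tendsto grad_cutoff_bound)
  qed
  from gradient_lincomb[OF this this, of c 0] show ?thesis by simp
qed

text \<open>The quotient is the divergence adapted to the weight: up to sign, the adjoint of the
  gradient in L2(\<pi>). It is continuous with bounded support, hence an L2 function, so both sides
  are continuous in \<open>f\<close> and \<open>G\<close> and the case of test functions
  suffices.\<close>

lemma gradient_integration_by_parts:
  assumes "has_L2_gradient \<pi> f G" and F: "C_k (Suc 0) F" and supp: "bounded {x. F x \<noteq> 0}"
  shows "ip G F = - ip f (\<lambda>x. divergence (\<lambda>y. \<pi> y *\<^sub>R F y) x / \<pi> x)"
proof -
  let ?w = "\<lambda>x. divergence (\<lambda>y. \<pi> y *\<^sub>R F y) x / \<pi> x"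
  have piF: "C_k (Suc 0) (\<lambda>y. \<pi> y *\<^sub>R F y)" by (intro C_k_scaleR C_k_density F)
  have FL: "F \<in> L2 \<pi>" by (rule L2_bounded_support[OF C_k_continuous[OF F] supp])
  have "divergence (\<lambda>y. \<pi> y *\<^sub>R F y) x = 0" if x: "x \<notin> closure {x. F x \<noteq> 0}" for x
  proof -
    have "((\<lambda>_. 0) has_derivative (\<lambda>_. 0)) (at x)" by simp
    then have "((\<lambda>y. \<pi> y *\<^sub>R F y) has_derivative (\<lambda>_. 0)) (at x)"
      by (rule has_derivative_transform_within_open[where s = "- closure {x. F x \<noteq> 0}"])
        (use x closure_subset[of "{x. F x \<noteq> 0}"] in auto)
    from frechet_derivative_at[OF this, symmetric] show ?thesis by (simp add: divergence_def)
  qed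
  then have "{x. ?w x \<noteq> 0} \<subseteq> closure {x. F x \<noteq> 0}" by auto
  then have "bounded {x. ?w x \<noteq> 0}" by (rule bounded_subset[OF bounded_closure[OF supp]])
  moreover have "continuous_on UNIV ?w"
    using density_pos by (intro continuous_on_divide C_k_continuous[OF C_k_divergence[OF piF]] C_k_continuous[OF C_k_density[of 0]])
      (auto simp: less_imp_neq[symmetric])
  ultimately have wL: "?w \<in> L2 \<pi>" by (intro L2_bounded_support)
  have test: "ip (grad \<phi>) F = - ip \<phi> ?w" if \<phi>: "\<phi> \<in> test_functions" for \<phi>
  proof -
    have [measurable]: "divergence (\<lambda>y. \<pi> y *\<^sub>R F y) \<in> borel_measurable borel"
      by (rule borel_measurable_continuous_onI[OF C_k_continuous[OF C_k_divergence[OF piF]]])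
    note [measurable] = L2_borel[OF FL] L2_borel[OF wL] test_borel[OF \<phi>] test_grad_L2[OF \<phi>, THEN L2_borel]
    have "ip (grad \<phi>) F = (LINT x|lborel. grad \<phi> x \<bullet> (\<pi> x *\<^sub>R F x))"
      unfolding L2_inner_def by (subst integral_M) (auto simp: real_scaleR_def)
    also have "\<dots> = - (LINT x|lborel. \<phi> x * divergence (\<lambda>y. \<pi> y *\<^sub>R F y) x)"
      by (rule integration_by_parts[OF test_C_k[OF \<phi>] test_support[OF \<phi>] piF])
    also have "(LINT x|lborel. \<phi> x * divergence (\<lambda>y. \<pi> y *\<^sub>R F y) x) = ip \<phi> ?w"
      unfolding L2_inner_def using density_pos
      by (subst integral_M) (auto intro!: Bochner_Integration.integral_cong simp: less_imp_neq[symmetric])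
    finally show ?thesis .
  qed
  obtain \<phi> where \<phi>: "\<And>n. \<phi> n \<in> test_functions" "L2_lim \<phi> f"
    "L2_lim (\<lambda>n. grad (\<phi> n)) G"
    using gradient_approx[OF assms(1)] by blast
  note f = gradient_L2[OF assms(1)]
  have "(\<lambda>n. ip (grad (\<phi> n)) F) \<longlonglongrightarrow> ip G F"
    by (rule W.tendsto_q[OF _ _ _ _ \<phi>(3)]) (auto simp: test_grad_L2 \<phi> f FL L2_norm_zero_AE)
  then have "(\<lambda>n. - ip (\<phi> n) ?w) \<longlonglongrightarrow> ip G F"
    by (simp only: test[OF \<phi>(1)])
  moreover have "(\<lambda>n. ip (\<phi> n) ?w) \<longlonglongrightarrow> ip f ?w"
    by (rule S.tendsto_q[OF _ _ _ _ \<phi>(2)]) (auto simp: test_L2 \<phi> f wL L2_norm_zero_AE)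
  ultimately show ?thesis
    by (rule LIMSEQ_unique[OF _ tendsto_minus])
qed

text \<open>Closability of the gradient. The fields \<open>\<psi> x *\<^sub>R b\<close> with
  \<open>\<psi>\<close> a test function pair equally with both gradients, because each pairing is
  expressed through \<open>f\<close> alone; test functions then separate the components.\<close>

lemma gradient_unique:
  assumes "has_L2_gradient \<pi> f G" "has_L2_gradient \<pi> f H"
  shows "AE x in M. G x = H x"
proof -
  note L = gradient_L2(2)[OF assms(1)] gradient_L2(2)[OF assms(2)]
  have D: "(\<lambda>x. G x - H x) \<in> L2 \<pi>" by (rule W.V_diff[OF L])
  have "AE x in M. (G x - H x) \<bullet> b = 0" for b
  proof (rule test_separate)
    show "integrable M (\<lambda>x. (G x - H x) \<bullet> b)"
      by (rule L2_inner_integrable[OF D L2_const])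
    fix \<psi> :: "'a \<Rightarrow> real" assume \<psi>: "\<psi> \<in> test_functions"
    have F: "C_k (Suc 0) (\<lambda>x. \<psi> x *\<^sub>R b)" by (intro C_k_scaleR C_k_const test_C_k \<psi>)
    have supp: "bounded {x. \<psi> x *\<^sub>R b \<noteq> 0}"
      by (rule bounded_subset[OF test_support[OF \<psi>]]) auto
    have FL: "(\<lambda>x. \<psi> x *\<^sub>R b) \<in> L2 \<pi>" by (rule L2_bounded_support[OF C_k_continuous[OF F] supp])
    have "ip (\<lambda>x. G x - H x) (\<lambda>x. \<psi> x *\<^sub>R b) = 0"
      using W.q_diff[OF L FL] gradient_integration_by_parts[OF assms(1) F supp]
        gradient_integration_by_parts[OF assms(2) F supp] by simp
    then show "(LINT x|M. \<psi> x * ((G x - H x) \<bullet> b)) = 0"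
      by (simp add: L2_inner_def)
  qed simp
  then have "AE x in M. \<forall>b\<in>Basis. (G x - H x) \<bullet> b = 0"
    by (intro AE_finite_allI) auto
  then show ?thesis
    by eventually_elim (simp add: euclidean_eq_iff[of "G _"] inner_diff_left)
qed

lemma L2_norm_inner_bounded:
  assumes "f \<in> L2 \<pi>" "v \<in> borel_measurable borel" "\<And>x. norm (v x) \<le> B" "B \<ge> 0"
  shows "nm (\<lambda>x. v x \<bullet> f x) \<le> B * nm f"
proof -
  have "(L2_norm \<pi> (\<lambda>x. v x \<bullet> f x))\<^sup>2 \<le> (LINT x|M. B\<^sup>2 * (norm (f x))\<^sup>2)"
    unfolding L2_norm_sq
  proof (rule integral_mono)
    show "integrable M (\<lambda>x. (norm (v x \<bullet> f x))\<^sup>2)" by (rule L2_square_integrable[OF L2_inner_bounded[OF assms(1-3)]])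
    show "integrable M (\<lambda>x. B\<^sup>2 * (norm (f x))\<^sup>2)" using L2_square_integrable[OF assms(1)] by simp
    show "(norm (v x \<bullet> f x))\<^sup>2 \<le> B\<^sup>2 * (norm (f x))\<^sup>2" for x
      by (rule inner_bounded_square[OF assms(3)])
  qed
  also have "\<dots> = (B * nm f)\<^sup>2" by (simp add: power_mult_distrib L2_norm_sq)
  finally show ?thesis
    by (rule power2_le_imp_le) (simp add: assms L2_norm_def L2_inner_self integral_nonneg_AE)
qed

text \<open>For test functions the sum of the two pairings is the integral of the gradient of the
  product against \<open>\<pi> \<gamma>\<close>, a divergence-free field. Boundedness of
  \<open>\<gamma>\<close> makes the drift depend continuously on the gradient, so the identity
  survives the limit.\<close>

lemma divergence_free_antisymmetric:
  assumes \<gamma>: "C_k (Suc 0) \<gamma>" and bounded: "\<And>x. norm (\<gamma> x) \<le> B"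
    and div: "\<And>x. divergence (\<lambda>y. \<pi> y *\<^sub>R \<gamma> y) x = 0"
    and f: "has_L2_gradient \<pi> f G" and g: "has_L2_gradient \<pi> g H"
  shows "ip (\<lambda>x. \<gamma> x \<bullet> G x) g = - ip f (\<lambda>x. \<gamma> x \<bullet> H x)"
proof -
  have B: "B \<ge> 0" using norm_ge_zero order.trans bounded by blast
  have pig: "C_k (Suc 0) (\<lambda>y. \<pi> y *\<^sub>R \<gamma> y)" by (intro C_k_scaleR C_k_density \<gamma>)
  have \<gamma>b[measurable]: "\<gamma> \<in> borel_measurable borel" by (rule borel_measurable_continuous_onI[OF C_k_continuous[OF \<gamma>]])
  have \<gamma>L: "(\<lambda>x. \<gamma> x \<bullet> F x) \<in> L2 \<pi>" if "F \<in> L2 \<pi>" for F by (rule L2_inner_bounded[OF that \<gamma>b bounded])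
  have test: "ip (\<lambda>x. \<gamma> x \<bullet> grad \<phi> x) \<psi> = - ip \<phi> (\<lambda>x. \<gamma> x \<bullet> grad \<psi> x)"
    if \<phi>: "\<phi> \<in> test_functions" and \<psi>: "\<psi> \<in> test_functions" for \<phi> \<psi>
  proof -
    note [measurable] = test_borel[OF \<phi>] test_grad_L2[OF \<phi>, THEN L2_borel]
      test_borel[OF \<psi>] test_grad_L2[OF \<psi>, THEN L2_borel]
    have "ip (\<lambda>x. \<gamma> x \<bullet> grad \<phi> x) \<psi> + ip \<phi> (\<lambda>x. \<gamma> x \<bullet> grad \<psi> x)
       = (LINT x|M. (\<gamma> x \<bullet> grad \<phi> x) * \<psi> x + \<phi> x * (\<gamma> x \<bullet> grad \<psi> x))"
      using L2_inner_integrable[OF \<gamma>L[OF test_grad_L2[OF \<phi>]] test_L2[OF \<psi>]]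
        L2_inner_integrable[OF test_L2[OF \<phi>] \<gamma>L[OF test_grad_L2[OF \<psi>]]]
      by (simp add: L2_inner_def)
    also have "\<dots> = (LINT x|lborel. grad (\<lambda>x. \<phi> x * \<psi> x) x \<bullet> (\<pi> x *\<^sub>R \<gamma> x))"
      by (subst integral_M)
        (auto intro!: Bochner_Integration.integral_cong simp: grad_mult test_differentiable \<phi> \<psi>
          inner_add_left inner_add_right inner_commute algebra_simps)
    also have "\<dots> = 0"
      using integration_by_parts[OF C_k_mult[OF test_C_k[OF \<phi>] test_C_k[OF \<psi>]]
          bounded_support_mult(1)[OF test_support[OF \<phi>]] pig]
      by (simp add: div)
    finally show ?thesis by simp
  qed
  note L = gradient_L2[OF f] gradient_L2[OF g]
  obtain \<phi> where \<phi>: "\<And>n. \<phi> n \<in> test_functions" "L2_lim \<phi> f"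
    "L2_lim (\<lambda>n. grad (\<phi> n)) G"
    using gradient_approx[OF f] by blast
  obtain \<psi> where \<psi>: "\<And>n. \<psi> n \<in> test_functions" "L2_lim \<psi> g"
    "L2_lim (\<lambda>n. grad (\<psi> n)) H"
    using gradient_approx[OF g] by blast
  have conv: "(\<lambda>n. nm (\<lambda>x. \<gamma> x \<bullet> Q n x - \<gamma> x \<bullet> R x)) \<longlonglongrightarrow> 0"
    if "\<And>n. Q n \<in> L2 \<pi>" "R \<in> L2 \<pi>" and lim: "L2_lim Q R" for Q R
  proof (rule Lim_null_comparison)
    have QR: "(\<lambda>x. Q n x - R x) \<in> L2 \<pi>" for n using that by (intro W.V_diff)
    show "\<forall>\<^sub>F n in sequentially. norm (L2_norm \<pi> (\<lambda>x. \<gamma> x \<bullet> Q n x - \<gamma> x \<bullet> R x)) \<le> B * nm (\<lambda>x. Q n x - R x)"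
      using L2_norm_inner_bounded[OF QR \<gamma>b bounded B] S.nrm_nonneg[OF \<gamma>L[OF QR]]
      by (intro always_eventually allI) (simp add: inner_diff_right)
    show "(\<lambda>n. B * nm (\<lambda>x. Q n x - R x)) \<longlonglongrightarrow> 0" by (intro tendsto_mult_right_zero lim)
  qed
  have "(\<lambda>n. ip (\<lambda>x. \<gamma> x \<bullet> grad (\<phi> n) x) (\<psi> n)) \<longlonglongrightarrow> ip (\<lambda>x. \<gamma> x \<bullet> G x) g"
    by (intro S.tendsto_q conv \<gamma>L test_grad_L2 test_L2 \<phi> \<psi> L)
  then have "(\<lambda>n. - ip (\<phi> n) (\<lambda>x. \<gamma> x \<bullet> grad (\<psi> n) x)) \<longlonglongrightarrow> ip (\<lambda>x. \<gamma> x \<bullet> G x) g"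
    by (simp only: test[OF \<phi>(1) \<psi>(1)])
  moreover have "(\<lambda>n. ip (\<phi> n) (\<lambda>x. \<gamma> x \<bullet> grad (\<psi> n) x)) \<longlonglongrightarrow> ip f (\<lambda>x. \<gamma> x \<bullet> H x)"
    by (intro S.tendsto_q conv \<gamma>L test_grad_L2 test_L2 \<phi> \<psi> L)
  ultimately show ?thesis
    by (rule LIMSEQ_unique[OF _ tendsto_minus])
qed

end

section \<open>The Poincare inequality\<close>

text \<open>The difference is the integral of the directional derivative along the segment, so
  Jensen's inequality bounds its square. The right side is a nonnegative integral to prepare for
  exchanging the order of integration.\<close>

lemma square_difference_le_segment_integral:
  fixes f :: "'a::euclidean_space \<Rightarrow> real"
  assumes f: "C_k (Suc 0) f"
  shows "ennreal ((f x - f y)\<^sup>2)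
    \<le> (\<integral>\<^sup>+t. indicator {0..1} t * ennreal ((norm (x - y))\<^sup>2 * (norm (grad f (y + t *\<^sub>R (x - y))))\<^sup>2) \<partial>lborel)"
proof -
  define h where "h t = grad f (y + t *\<^sub>R (x - y)) \<bullet> (x - y)" for t
  define I where "I g = (LINT t|lborel. indicator {0..1} t *\<^sub>R g t)" for g :: "real \<Rightarrow> real"
  have cg: "continuous_on UNIV (\<lambda>t. grad f (y + t *\<^sub>R (x - y)))"
    by (intro continuous_on_compose2[OF C_k_continuous[OF C_k_grad[OF f]]] continuous_intros) auto
  have ch: "continuous_on UNIV h" unfolding h_def by (intro continuous_intros cg)
  have der: "((\<lambda>t. f (y + t *\<^sub>R (x - y))) has_real_derivative h t) (at t)" for t
  proof -
    have "((\<lambda>t. y + t *\<^sub>R (x - y)) has_derivative (\<lambda>s. s *\<^sub>R (x - y))) (at t)"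
      by (auto intro!: derivative_eq_intros)
    from has_derivative_compose[OF this has_derivative_grad[OF C_1_differentiable[OF f]]]
    show ?thesis by (simp add: has_field_derivative_def h_def mult_commute_abs)
  qed
  have "(LINT t|lborel. h t * indicator {0..1} t) = f (y + 1 *\<^sub>R (x - y)) - f (y + 0 *\<^sub>R (x - y))"
    by (rule integral_FTC_Icc_real) (use ch der in \<open>auto simp: continuous_on_eq_continuous_at\<close>)
  then have Ih: "I h = f x - f y" by (simp add: I_def mult.commute)
  have int: "integrable lborel (\<lambda>t. indicator {0..1} t *\<^sub>R g t)" if "continuous_on UNIV g" for g :: "real \<Rightarrow> real"
    using that by (intro borel_integrable_compact) (auto intro: continuous_on_subset)
  \<comment> \<open>Jensen's inequality in the form of a nonnegative variance over the unit
    interval.\<close>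
  have "0 \<le> I (\<lambda>t. (h t - I h)\<^sup>2)" unfolding I_def by (intro integral_nonneg_AE) auto
  also have "I (\<lambda>t. (h t - I h)\<^sup>2) = I (\<lambda>t. (h t)\<^sup>2) - 2 * I h * I h + (I h)\<^sup>2 * I (\<lambda>_. 1)"
  proof -
    have "(\<lambda>t. indicator {0..1} t *\<^sub>R (h t - I h)\<^sup>2) = (\<lambda>t. indicator {0..1} t *\<^sub>R (h t)\<^sup>2
       - (2 * I h) * (indicator {0..1} t *\<^sub>R h t) + (I h)\<^sup>2 * (indicator {0..1} t *\<^sub>R 1))"
      by (auto simp: fun_eq_iff power2_diff algebra_simps)
    then show ?thesis
      unfolding I_def[of "\<lambda>t. (h t - I h)\<^sup>2"]
      using int[OF ch] int[OF continuous_on_power[OF ch, of 2]] int[of "\<lambda>_. 1"]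
      by (simp add: I_def)
  qed
  finally have "0 \<le> I (\<lambda>t. (h t)\<^sup>2) - 2 * I h * I h + (I h)\<^sup>2 * I (\<lambda>_. 1)" .
  moreover have "I (\<lambda>_. 1) = 1" by (simp add: I_def)
  ultimately have le: "(f x - f y)\<^sup>2 \<le> I (\<lambda>t. (h t)\<^sup>2)"
    unfolding Ih[symmetric] by (simp add: power2_eq_square algebra_simps)
  have "ennreal (I (\<lambda>t. (h t)\<^sup>2)) = (\<integral>\<^sup>+t. ennreal (indicator {0..1} t *\<^sub>R (h t)\<^sup>2) \<partial>lborel)"
    unfolding I_def by (rule nn_integral_eq_integral[symmetric, OF int[OF continuous_on_power[OF ch]]]) simp
  also have "\<dots> \<le> (\<integral>\<^sup>+t. indicator {0..1} t * ennreal ((norm (x - y))\<^sup>2 * (norm (grad f (y + t *\<^sub>R (x - y))))\<^sup>2) \<partial>lborel)"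
  proof (rule nn_integral_mono)
    fix t
    have "(h t)\<^sup>2 \<le> (norm (x - y))\<^sup>2 * (norm (grad f (y + t *\<^sub>R (x - y))))\<^sup>2"
      unfolding h_def power2_norm_eq_inner
      using Cauchy_Schwarz_ineq[of "grad f (y + t *\<^sub>R (x - y))" "x - y"] by (simp only: mult.commute)
    then show "ennreal (indicator {0..1} t *\<^sub>R (h t)\<^sup>2)
      \<le> indicator {0..1} t * ennreal ((norm (x - y))\<^sup>2 * (norm (grad f (y + t *\<^sub>R (x - y))))\<^sup>2)"
      by (auto simp: indicator_def intro: ennreal_leI)
  qed
  finally show ?thesis using le by (meson ennreal_leI order.trans)
qed

text \<open>The dilation about \<open>y\<close> by \<open>t\<close> has Jacobian
  \<open>t ^ DIM('a)\<close>, at least \<open>2 ^ (- DIM('a))\<close>, and maps the convex set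
  \<open>K\<close> into itself.\<close>

lemma nn_integral_convex_dilation:
  fixes K :: "'a::euclidean_space set" and G :: "'a \<Rightarrow> ennreal"
  assumes K: "convex K" and [measurable]: "K \<in> sets borel" "G \<in> borel_measurable borel"
    and t: "1 / 2 \<le> t" "t \<le> 1" and y: "y \<in> K"
  shows "(\<integral>\<^sup>+x. indicator K x * G ((1 - t) *\<^sub>R y + t *\<^sub>R x) \<partial>lborel)
    \<le> 2 ^ DIM('a) * (\<integral>\<^sup>+z. indicator K z * G z \<partial>lborel)"
proof -
  let ?g = "\<lambda>z. indicator K z * G z :: ennreal"
  let ?T = "\<lambda>x. (1 - t) *\<^sub>R y + t *\<^sub>R x"
  have "(\<integral>\<^sup>+z. ?g z \<partial>lborel) = (\<integral>\<^sup>+z. ?g z \<partial>density (distr lborel borel ?T) (\<lambda>_. ennreal (\<bar>t\<bar> ^ DIM('a))))"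
    using lborel_affine[of t "(1 - t) *\<^sub>R y"] t by simp
  also have "\<dots> = ennreal (t ^ DIM('a)) * (\<integral>\<^sup>+x. ?g (?T x) \<partial>lborel)"
    using t by (subst nn_integral_density) (auto simp: nn_integral_distr nn_integral_cmult)
  finally have eq: "(\<integral>\<^sup>+z. ?g z \<partial>lborel) = ennreal (t ^ DIM('a)) * (\<integral>\<^sup>+x. ?g (?T x) \<partial>lborel)" .
  have "(\<integral>\<^sup>+x. indicator K x * G (?T x) \<partial>lborel) \<le> (\<integral>\<^sup>+x. ?g (?T x) \<partial>lborel)"
    using convexD[OF K y, of _ "1 - t" t] t
    by (intro nn_integral_mono) (auto simp: indicator_def)
  also have "\<dots> \<le> ennreal (2 ^ DIM('a) * t ^ DIM('a)) * (\<integral>\<^sup>+x. ?g (?T x) \<partial>lborel)"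
  proof -
    have "1 \<le> (2 * t) ^ DIM('a)" using t by (intro one_le_power) simp
    then have "1 \<le> ennreal (2 ^ DIM('a) * t ^ DIM('a))" by (simp add: power_mult_distrib)
    then show ?thesis using mult_right_mono[of 1] by fastforce
  qed
  also have "\<dots> = 2 ^ DIM('a) * (\<integral>\<^sup>+z. ?g z \<partial>lborel)"
    unfolding eq using t by (simp add: ennreal_mult ennreal_power[symmetric] mult.assoc)
  finally show ?thesis .
qed

text \<open>On the segment from \<open>y\<close> to \<open>x\<close> the point with parameter \<open>t\<close> is a dilation by a factor at least
  \<open>1 / 2\<close> in \<open>x\<close> or in \<open>y\<close>, according to whether \<open>t \<ge> 1 / 2\<close>; so for fixed \<open>t\<close> one of the two integrations
  is a change of variables with bounded Jacobian.\<close>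

lemma double_integral_square_difference_le:
  fixes f :: "'a::euclidean_space \<Rightarrow> real" and K :: "'a set"
  assumes f: "C_k (Suc 0) f" and K: "convex K" "K \<in> sets borel"
    and diam: "\<And>x y. x \<in> K \<Longrightarrow> y \<in> K \<Longrightarrow> norm (x - y) \<le> D"
  shows "(\<integral>\<^sup>+x. indicator K x * (\<integral>\<^sup>+y. indicator K y * ennreal ((f x - f y)\<^sup>2) \<partial>lborel) \<partial>lborel)
    \<le> ennreal (D\<^sup>2) * 2 ^ DIM('a) * emeasure lborel K * (\<integral>\<^sup>+z. indicator K z * ennreal ((norm (grad f z))\<^sup>2) \<partial>lborel)"
proof -
  note [measurable] = K(2)
  define G where "G z = ennreal ((norm (grad f z))\<^sup>2)" for z
  have [measurable]: "f \<in> borel_measurable borel" "grad f \<in> borel_measurable borel"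
    using C_k_continuous[OF f] C_k_continuous[OF C_k_grad[OF f]] by (auto intro: borel_measurable_continuous_onI)
  have [measurable]: "G \<in> borel_measurable borel" unfolding G_def by measurable
  let ?J = "\<integral>\<^sup>+z. indicator K z * G z \<partial>lborel"
  let ?k = "\<lambda>x. indicator K x :: ennreal" and ?T = "\<lambda>t x y. (1 - t) *\<^sub>R y + t *\<^sub>R x"
  have slice: "(\<integral>\<^sup>+x. ?k x * (\<integral>\<^sup>+y. ?k y * G (?T t x y) \<partial>lborel) \<partial>lborel) \<le> 2 ^ DIM('a) * ?J * emeasure lborel K"
    if t: "0 \<le> t" "t \<le> 1" for t
  proof (cases "1 / 2 \<le> t")
    case True
    have "(\<integral>\<^sup>+x. ?k x * (\<integral>\<^sup>+y. ?k y * G (?T t x y) \<partial>lborel) \<partial>lborel)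
        = (\<integral>\<^sup>+x. \<integral>\<^sup>+y. ?k x * (?k y * G (?T t x y)) \<partial>lborel \<partial>lborel)"
      by (intro nn_integral_cong) (simp add: nn_integral_cmult)
    also have "\<dots> = (\<integral>\<^sup>+y. \<integral>\<^sup>+x. ?k x * (?k y * G (?T t x y)) \<partial>lborel \<partial>lborel)"
      by (rule lborel_pair.Fubini') measurable
    also have "\<dots> \<le> (\<integral>\<^sup>+y. ?k y * (2 ^ DIM('a) * ?J) \<partial>lborel)"
    proof (rule nn_integral_mono)
      fix y
      have "(\<integral>\<^sup>+x. ?k x * (?k y * G (?T t x y)) \<partial>lborel) = ?k y * (\<integral>\<^sup>+x. ?k x * G (?T t x y) \<partial>lborel)"
        by (simp add: mult.left_commute[of "?k _" "?k y"] nn_integral_cmult)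
      also have "\<dots> \<le> ?k y * (2 ^ DIM('a) * ?J)"
        using nn_integral_convex_dilation[OF K(1) K(2) _ True t(2), of G y] by (auto simp: indicator_def)
      finally show "(\<integral>\<^sup>+x. ?k x * (?k y * G (?T t x y)) \<partial>lborel) \<le> ?k y * (2 ^ DIM('a) * ?J)" .
    qed
    finally show ?thesis by (simp add: nn_integral_multc mult_ac)
  next
    case False
    have "(\<integral>\<^sup>+x. ?k x * (\<integral>\<^sup>+y. ?k y * G (?T t x y) \<partial>lborel) \<partial>lborel) \<le> (\<integral>\<^sup>+x. ?k x * (2 ^ DIM('a) * ?J) \<partial>lborel)"
    proof (rule nn_integral_mono)
      fix x
      show "?k x * (\<integral>\<^sup>+y. ?k y * G (?T t x y) \<partial>lborel) \<le> ?k x * (2 ^ DIM('a) * ?J)"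
        using nn_integral_convex_dilation[OF K(1) K(2), of G "1 - t" x] False t
        by (auto simp: indicator_def add.commute)
    qed
    then show ?thesis by (simp add: nn_integral_multc mult_ac)
  qed
  have "(\<integral>\<^sup>+x. ?k x * (\<integral>\<^sup>+y. ?k y * ennreal ((f x - f y)\<^sup>2) \<partial>lborel) \<partial>lborel)
    \<le> (\<integral>\<^sup>+x. ?k x * (\<integral>\<^sup>+y. ?k y * (\<integral>\<^sup>+t. indicator {0..1} t * (ennreal (D\<^sup>2) * G (?T t x y)) \<partial>lborel) \<partial>lborel) \<partial>lborel)"
  proof -
    have "ennreal ((f x - f y)\<^sup>2) \<le> (\<integral>\<^sup>+t. indicator {0..1} t * (ennreal (D\<^sup>2) * G (?T t x y)) \<partial>lborel)"
      if "x \<in> K" "y \<in> K" for x y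
    proof (rule order.trans[OF square_difference_le_segment_integral[OF f]], rule nn_integral_mono)
      fix t :: real
      have eq: "y + t *\<^sub>R (x - y) = ?T t x y" by (simp add: algebra_simps)
      have "(norm (x - y))\<^sup>2 \<le> D\<^sup>2" using diam[OF that] by (intro power_mono) auto
      then show "indicator {0..1} t * ennreal ((norm (x - y))\<^sup>2 * (norm (grad f (y + t *\<^sub>R (x - y))))\<^sup>2)
         \<le> indicator {0..1} t * (ennreal (D\<^sup>2) * G (?T t x y))"
        unfolding eq G_def by (subst ennreal_mult[symmetric]) (auto intro!: mult_left_mono ennreal_leI mult_right_mono)
    qed
    then show ?thesis
      by (intro nn_integral_mono) (auto simp: indicator_def intro!: nn_integral_mono)
  qed
  \<comment> \<open>All factors are pulled inside so that two exchanges bring \<open>t\<close>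
    outermost; \<open>slice\<close> bounds the double integral only for a fixed
    \<open>t\<close>.\<close>
  also have "\<dots> = (\<integral>\<^sup>+x. \<integral>\<^sup>+y. \<integral>\<^sup>+t. indicator {0..1} t * (ennreal (D\<^sup>2) * (?k x * (?k y * G (?T t x y)))) \<partial>lborel \<partial>lborel \<partial>lborel)"
    by (simp add: nn_integral_cmult[symmetric] mult_ac)
  also have "\<dots> = (\<integral>\<^sup>+x. \<integral>\<^sup>+t. \<integral>\<^sup>+y. indicator {0..1} t * (ennreal (D\<^sup>2) * (?k x * (?k y * G (?T t x y)))) \<partial>lborel \<partial>lborel \<partial>lborel)"
    by (intro nn_integral_cong lborel_pair.Fubini') measurable
  also have "\<dots> = (\<integral>\<^sup>+t. \<integral>\<^sup>+x. \<integral>\<^sup>+y. indicator {0..1} t * (ennreal (D\<^sup>2) * (?k x * (?k y * G (?T t x y)))) \<partial>lborel \<partial>lborel \<partial>lborel)"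
    by (rule lborel_pair.Fubini') measurable
  also have "\<dots> = (\<integral>\<^sup>+t. indicator {0..1} t * (ennreal (D\<^sup>2) * (\<integral>\<^sup>+x. ?k x * (\<integral>\<^sup>+y. ?k y * G (?T t x y) \<partial>lborel) \<partial>lborel)) \<partial>lborel)"
    by (simp add: nn_integral_cmult)
  also have "\<dots> \<le> (\<integral>\<^sup>+t. indicator {0..1} t * (ennreal (D\<^sup>2) * (2 ^ DIM('a) * ?J * emeasure lborel K)) \<partial>(lborel::real measure))"
  proof (rule nn_integral_mono)
    fix t :: real
    show "indicator {0..1} t * (ennreal (D\<^sup>2) * (\<integral>\<^sup>+x. ?k x * (\<integral>\<^sup>+y. ?k y * G (?T t x y) \<partial>lborel) \<partial>lborel))
      \<le> indicator {0..1} t * (ennreal (D\<^sup>2) * (2 ^ DIM('a) * ?J * emeasure lborel K))"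
      using slice[of t] by (cases "t \<in> {0..1}") (auto intro!: mult_left_mono)
  qed
  also have "\<dots> = ennreal (D\<^sup>2) * (2 ^ DIM('a) * ?J * emeasure lborel K)"
    by (subst nn_integral_multc) auto
  finally show ?thesis by (simp add: G_def mult_ac)
qed

text \<open>The double integral of the squared differences is \<open>2 * (v * q - s^2)\<close>,
  which is \<open>2 * v\<close> times the squared deviation from the mean \<open>s / v\<close>. The
  bound on that double integral carries the volume as a factor, so it cancels, and this mean serves
  as \<open>m\<close>.\<close>

lemma local_poincare:
  fixes K :: "'a::euclidean_space set"
  assumes K: "convex K" "compact K" and v: "0 < measure lborel K"
  obtains C where "C \<ge> 0" "\<And>f. C_k (Suc 0) f \<Longrightarrow>
    \<exists>m. (LINT x|lborel. indicator K x * (f x - m)\<^sup>2) \<le> C * (LINT x|lborel. indicator K x * (norm (grad f x))\<^sup>2)"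
proof -
  let ?v = "measure lborel K"
  have Kb[measurable]: "K \<in> sets borel" using K(2) by (simp add: borel_compact)
  have Kfin: "emeasure lborel K < \<infinity>" by (rule emeasure_bounded_finite[OF compact_imp_bounded[OF K(2)]])
  have Kv: "emeasure lborel K = ennreal ?v" using Kfin by (simp add: emeasure_eq_ennreal_measure)
  obtain D where D: "\<And>x y. x \<in> K \<Longrightarrow> y \<in> K \<Longrightarrow> norm (x - y) \<le> D"
    using K(2)[THEN compact_imp_bounded] by (auto simp: bounded_two_points dist_norm)
  define C where "C = D\<^sup>2 * 2 ^ DIM('a)"
  have C0: "C \<ge> 0" by (simp add: C_def)
  have "\<exists>m. (LINT x|lborel. indicator K x * (f x - m)\<^sup>2) \<le> C * (LINT x|lborel. indicator K x * (norm (grad f x))\<^sup>2)"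
    if f: "C_k (Suc 0) f" for f
  proof -
    have int: "integrable lborel (\<lambda>x. indicator K x * g x)" if "continuous_on UNIV g" for g :: "'a \<Rightarrow> real"
      using borel_integrable_compact[OF K(2), of g] that by (auto intro: continuous_on_subset)
    have cf: "continuous_on UNIV f" by (rule C_k_continuous[OF f])
    have cf2: "continuous_on UNIV (\<lambda>x. (f x)\<^sup>2)" by (intro continuous_intros cf)
    define s where "s = (LINT x|lborel. indicator K x * f x)"
    define q where "q = (LINT x|lborel. indicator K x * (f x)\<^sup>2)"
    define g where "g = (LINT x|lborel. indicator K x * (norm (grad f x))\<^sup>2)"
    have i1: "(LINT x|lborel. indicator K x) = ?v" by simp
    have i1': "integrable lborel (indicator K :: 'a \<Rightarrow> real)" using int[of "\<lambda>_. 1"] by simp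
    have dev: "(LINT y|lborel. indicator K y * (m - f y)\<^sup>2) = ?v * m\<^sup>2 - 2 * m * s + q" for m
    proof -
      have "(\<lambda>y. indicator K y * (m - f y)\<^sup>2)
        = (\<lambda>y. m\<^sup>2 * indicator K y - 2 * m * (indicator K y * f y) + indicator K y * (f y)\<^sup>2)"
        by (auto simp: fun_eq_iff power2_diff algebra_simps)
      then show ?thesis using int[OF cf] int[OF cf2] i1' by (simp add: s_def q_def mult.commute)
    qed
    have inner: "(\<integral>\<^sup>+y. indicator K y * ennreal ((f x - f y)\<^sup>2) \<partial>lborel) = ennreal (?v * (f x)\<^sup>2 - 2 * f x * s + q)" for x
    proof -
      have "(\<integral>\<^sup>+y. indicator K y * ennreal ((f x - f y)\<^sup>2) \<partial>lborel) = (\<integral>\<^sup>+y. ennreal (indicator K y * (f x - f y)\<^sup>2) \<partial>lborel)"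
        by (intro nn_integral_cong) (auto simp: indicator_def)
      also have "\<dots> = ennreal (LINT y|lborel. indicator K y * (f x - f y)\<^sup>2)"
        by (intro nn_integral_eq_integral int continuous_intros cf) auto
      finally show ?thesis by (simp only: dev)
    qed
    have inner_nonneg: "0 \<le> ?v * (f x)\<^sup>2 - 2 * f x * s + q" for x
      unfolding dev[symmetric] by (intro integral_nonneg_AE) auto
    have "(\<integral>\<^sup>+x. indicator K x * (\<integral>\<^sup>+y. indicator K y * ennreal ((f x - f y)\<^sup>2) \<partial>lborel) \<partial>lborel)
      = (\<integral>\<^sup>+x. ennreal (indicator K x * (?v * (f x)\<^sup>2 - 2 * f x * s + q)) \<partial>lborel)"
      unfolding inner by (intro nn_integral_cong) (auto simp: indicator_def)
    also have "\<dots> = ennreal (LINT x|lborel. indicator K x * (?v * (f x)\<^sup>2 - 2 * f x * s + q))"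
      by (intro nn_integral_eq_integral int continuous_intros cf) (auto intro!: mult_nonneg_nonneg inner_nonneg)
    also have "(LINT x|lborel. indicator K x * (?v * (f x)\<^sup>2 - 2 * f x * s + q)) = 2 * (?v * q - s\<^sup>2)"
    proof -
      have "(\<lambda>x. indicator K x * (?v * (f x)\<^sup>2 - 2 * f x * s + q))
        = (\<lambda>x. ?v * (indicator K x * (f x)\<^sup>2) - 2 * s * (indicator K x * f x) + q * indicator K x)"
        by (auto simp: fun_eq_iff algebra_simps)
      then have "(LINT x|lborel. indicator K x * (?v * (f x)\<^sup>2 - 2 * f x * s + q)) = ?v * q - 2 * s * s + q * ?v"
        using int[OF cf] int[OF cf2] i1' by (simp add: s_def[symmetric] q_def[symmetric])
      then show ?thesis by (simp add: power2_eq_square)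
    qed
    finally have lhs: "(\<integral>\<^sup>+x. indicator K x * (\<integral>\<^sup>+y. indicator K y * ennreal ((f x - f y)\<^sup>2) \<partial>lborel) \<partial>lborel)
      = ennreal (2 * (?v * q - s\<^sup>2))" .
    have cg: "continuous_on UNIV (\<lambda>x. (norm (grad f x))\<^sup>2)"
      by (intro continuous_intros C_k_continuous[OF C_k_grad[OF f]])
    have "(\<integral>\<^sup>+z. indicator K z * ennreal ((norm (grad f z))\<^sup>2) \<partial>lborel) = (\<integral>\<^sup>+z. ennreal (indicator K z * (norm (grad f z))\<^sup>2) \<partial>lborel)"
      by (intro nn_integral_cong) (auto simp: indicator_def)
    also have "\<dots> = ennreal g"
      unfolding g_def by (intro nn_integral_eq_integral int cg) auto
    finally have rhs: "(\<integral>\<^sup>+z. indicator K z * ennreal ((norm (grad f z))\<^sup>2) \<partial>lborel) = ennreal g" .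
    have g0: "g \<ge> 0" unfolding g_def by (intro integral_nonneg_AE) auto
    have "ennreal (2 * (?v * q - s\<^sup>2)) \<le> ennreal (D\<^sup>2) * 2 ^ DIM('a) * ennreal ?v * ennreal g"
      using double_integral_square_difference_le[OF f K(1) Kb D] unfolding lhs rhs Kv .
    also have "\<dots> = ennreal (C * ?v * g)"
      using g0 by (simp add: C_def ennreal_mult ennreal_power[symmetric])
    finally have le: "2 * (?v * q - s\<^sup>2) \<le> C * ?v * g"
      using C0 g0 by (simp add: ennreal_le_iff)
    have "(LINT x|lborel. indicator K x * (f x - s / ?v)\<^sup>2) = q - s\<^sup>2 / ?v"
      unfolding power2_commute[of "f _" "s / ?v"] dev using v by (simp add: power2_eq_square)
    also have "\<dots> = (?v * q - s\<^sup>2) / ?v" using v by (simp add: field_simps)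
    also have "\<dots> \<le> (C * ?v * g) / ?v"
    proof (rule divide_right_mono)
      \<comment> \<open>The factor 2 produced by the symmetry in the two points is given
        away.\<close>
      have half: "X \<le> Y" if "2 * X \<le> Y" "0 \<le> Y" for X Y :: real using that by linarith
      show "?v * q - s\<^sup>2 \<le> C * ?v * g" by (rule half[OF le]) (use C0 g0 in simp)
    qed simp
    also have "\<dots> = C * g" using v by simp
    finally show ?thesis unfolding g_def by blast
  qed
  then show ?thesis using that C0 by blast
qed

context smooth_density
begin

section \<open>The Lyapunov potential and the global inequality\<close>

lemma grad_ln_density: "grad (\<lambda>y. ln (\<pi> y)) x = inverse (\<pi> x) *\<^sub>R grad \<pi> x"
proof (rule grad_has_derivative)
  have "((\<lambda>y. ln (\<pi> y)) has_derivative (\<lambda>h. inverse (\<pi> x) * (grad \<pi> x \<bullet> h))) (at x)"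
    using has_derivative_ln[OF density_pos has_derivative_grad[OF C_1_differentiable[OF C_k_density]]]
    by (rule has_derivative_eq_rhs) (auto simp: fun_eq_iff)
  then show "((\<lambda>y. ln (\<pi> y)) has_derivative (\<bullet>) (inverse (\<pi> x) *\<^sub>R grad \<pi> x)) (at x)"
    by (rule has_derivative_eq_rhs) (simp add: fun_eq_iff)
qed

text \<open>Rewrites the hypothesis through \<open>divergence (grad \<pi>) x / \<pi> x\<close>, the
  quantity that integration by parts produces.\<close>

lemma laplacian_ln_density:
  "laplacian (\<lambda>y. ln (\<pi> y)) x = divergence (grad \<pi>) x / \<pi> x - (norm (grad (\<lambda>y. ln (\<pi> y)) x))\<^sup>2"
proof -
  let ?D = "frechet_derivative (grad \<pi>) (at x)"
  have G: "C_k (Suc 0) (grad \<pi>)" by (rule C_k_grad[OF C_k_density])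
  have "((\<lambda>y. inverse (\<pi> y) *\<^sub>R grad \<pi> y) has_derivative
     (\<lambda>h. inverse (\<pi> x) *\<^sub>R ?D h + (- (inverse (\<pi> x) * (grad \<pi> x \<bullet> h) * inverse (\<pi> x))) *\<^sub>R grad \<pi> x)) (at x)"
    by (rule has_derivative_scaleR[OF Deriv.has_derivative_inverse[OF _ has_derivative_grad[OF C_1_differentiable[OF C_k_density]]]
          C_k_SucD(1)[OF G]]) (use density_pos[of x] in simp)
  from frechet_derivative_at[OF this, symmetric]
  have "laplacian (\<lambda>y. ln (\<pi> y)) x = (\<Sum>b\<in>Basis. inverse (\<pi> x) * (?D b \<bullet> b)
     - (inverse (\<pi> x))\<^sup>2 * ((grad \<pi> x \<bullet> b) * (grad \<pi> x \<bullet> b)))"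
    unfolding laplacian_def divergence_def grad_ln_density[abs_def]
    by (simp add: inner_add_left inner_diff_left power2_eq_square mult_ac)
  also have "\<dots> = inverse (\<pi> x) * divergence (grad \<pi>) x - (inverse (\<pi> x))\<^sup>2 * (grad \<pi> x \<bullet> grad \<pi> x)"
    unfolding euclidean_inner[of "grad \<pi> x" "grad \<pi> x"] by (simp add: sum_subtractf sum_distrib_left divergence_def)
  finally show ?thesis
    using density_pos[of x]
    by (simp add: grad_ln_density power2_norm_eq_inner[symmetric] power_mult_distrib divide_inverse mult.commute)
qed

text \<open>For \<open>V = \<pi>^(-\<beta>)\<close> this is \<open>- (S V) / V\<close>, computed
  from the gradient and Laplacian of \<open>V\<close>.\<close>

definition lyapunov_potential :: "real \<Rightarrow> 'a \<Rightarrow> real" where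
  "lyapunov_potential \<beta> x =
     \<beta> * ((1 - \<beta>) * (norm (grad (\<lambda>y. ln (\<pi> y)) x))\<^sup>2 + laplacian (\<lambda>y. ln (\<pi> y)) x)"

lemma lyapunov_potential_continuous: "continuous_on UNIV (lyapunov_potential \<beta>)"
  unfolding lyapunov_potential_def[abs_def] laplacian_ln_density grad_ln_density
  by (intro continuous_intros C_k_continuous[OF C_k_density[of 0]] C_k_continuous[OF C_k_grad[OF C_k_density[of "Suc 0"]]]
      C_k_continuous[OF C_k_divergence[OF C_k_grad[OF C_k_density[of "Suc (Suc 0)"]]]])
    (use density_pos in \<open>auto simp: less_imp_neq[symmetric]\<close>)

text \<open>This is \<open>\<integral> \<bar>\<nabla>\<phi> + \<beta> \<phi> \<nabla> log \<pi>\<bar>\<^sup>2 d\<pi> \<ge> 0\<close> with the cross term integrated by parts; it plays the role of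
  the Lyapunov function \<open>\<pi>\<^bsup>-\<beta>\<^esup>\<close>.\<close>

lemma lyapunov_inequality:
  assumes \<phi>: "\<phi> \<in> test_functions"
  shows "(LINT x|M. lyapunov_potential \<beta> x * (\<phi> x)\<^sup>2) \<le> (L2_norm \<pi> (grad \<phi>))\<^sup>2"
proof -
  define w where "w = grad (\<lambda>y. ln (\<pi> y))"
  have w: "w x = inverse (\<pi> x) *\<^sub>R grad \<pi> x" for x by (simp add: w_def grad_ln_density)
  have c\<pi>: "continuous_on UNIV \<pi>" by (rule C_k_continuous[OF C_k_density[of 0]])
  have cg: "continuous_on UNIV (grad \<pi>)" by (rule C_k_continuous[OF C_k_grad[OF C_k_density[of "Suc 0"]]])
  have cw: "continuous_on UNIV w"
    unfolding w by (intro continuous_intros c\<pi> cg) (use density_pos in \<open>auto simp: less_imp_neq[symmetric]\<close>)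
  have c\<phi>: "continuous_on UNIV \<phi>" by (rule C_k_continuous[OF test_C_k[OF \<phi>, of 0]])
  have cg\<phi>: "continuous_on UNIV (grad \<phi>)" by (rule C_k_continuous[OF C_k_grad[OF test_C_k[OF \<phi>, of "Suc 0"]]])
  note supp = test_support[OF \<phi>]
  have G: "C_k (Suc 0) (grad \<pi>)" by (rule C_k_grad[OF C_k_density])
  have int: "integrable M g" if "continuous_on UNIV g" "bounded {x. g x \<noteq> 0}" for g :: "'a \<Rightarrow> real"
    by (rule L2_integrable[OF L2_bounded_support[OF that]])
  have supp': "bounded {x. h x \<noteq> 0}" if "\<And>x. \<phi> x = 0 \<Longrightarrow> h x = 0" for h :: "'a \<Rightarrow> real"
    by (rule bounded_subset[OF supp]) (use that in auto)
  let ?\<Delta> = "divergence (grad \<pi>)"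
  have c\<Delta>: "continuous_on UNIV ?\<Delta>" by (rule C_k_continuous[OF C_k_divergence[OF C_k_grad[OF C_k_density[of "Suc (Suc 0)"]]]])
  have cross: "(LINT x|M. 2 * \<phi> x * (grad \<phi> x \<bullet> w x)) = - (LINT x|M. (\<phi> x)\<^sup>2 * (?\<Delta> x / \<pi> x))"
  proof -
    have [measurable]: "\<phi> \<in> borel_measurable borel" "grad \<phi> \<in> borel_measurable borel" "w \<in> borel_measurable borel"
      "?\<Delta> \<in> borel_measurable borel"
      using c\<phi> cg\<phi> cw c\<Delta> by (auto intro: borel_measurable_continuous_onI)
    have "(LINT x|M. 2 * \<phi> x * (grad \<phi> x \<bullet> w x)) = (LINT x|lborel. \<pi> x *\<^sub>R (2 * \<phi> x * (grad \<phi> x \<bullet> w x)))"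
      by (rule integral_M) measurable
    \<comment> \<open>\<open>2 * \<phi>\<close> times the gradient of \<open>\<phi>\<close> is the
      gradient of its square, and the weight turns the logarithmic gradient \<open>w\<close> into
      \<open>grad \<pi>\<close>.\<close>
    also have "(\<lambda>x. \<pi> x *\<^sub>R (2 * \<phi> x * (grad \<phi> x \<bullet> w x))) = (\<lambda>x. grad (\<lambda>x. \<phi> x * \<phi> x) x \<bullet> grad \<pi> x)"
      using density_pos
      by (auto simp: fun_eq_iff grad_mult test_differentiable \<phi> w inner_add_left less_imp_neq[symmetric])
    also have "(LINT x|lborel. grad (\<lambda>x. \<phi> x * \<phi> x) x \<bullet> grad \<pi> x) = - (LINT x|lborel. (\<phi> x * \<phi> x) * ?\<Delta> x)"
      by (rule integration_by_parts[OF C_k_mult[OF test_C_k[OF \<phi>] test_C_k[OF \<phi>]]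
            bounded_support_mult(1)[OF supp] G])
    also have "(LINT x|lborel. (\<phi> x * \<phi> x) * ?\<Delta> x) = (LINT x|M. (\<phi> x)\<^sup>2 * (?\<Delta> x / \<pi> x))"
      using density_pos by (subst integral_M)
        (auto intro!: Bochner_Integration.integral_cong simp: power2_eq_square less_imp_neq[symmetric])
    finally show ?thesis .
  qed
  have i1: "integrable M (\<lambda>x. (norm (grad \<phi> x))\<^sup>2)" by (rule L2_square_integrable[OF test_grad_L2[OF \<phi>]])
  have i2: "integrable M (\<lambda>x. 2 * \<phi> x * (grad \<phi> x \<bullet> w x))"
    by (intro int supp' continuous_intros c\<phi> cg\<phi> cw) simp
  have i3: "integrable M (\<lambda>x. (\<phi> x)\<^sup>2 * (norm (w x))\<^sup>2)"
    by (intro int supp' continuous_intros c\<phi> cw) simp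
  have i4: "integrable M (\<lambda>x. (\<phi> x)\<^sup>2 * (?\<Delta> x / \<pi> x))"
    by (intro int supp' continuous_intros c\<phi> c\<Delta> c\<pi>) (use density_pos in \<open>auto simp: less_imp_neq[symmetric]\<close>)
  have "0 \<le> (LINT x|M. (norm (grad \<phi> x + (\<beta> * \<phi> x) *\<^sub>R w x))\<^sup>2)"
    by (intro integral_nonneg_AE) simp
  also have "(\<lambda>x. (norm (grad \<phi> x + (\<beta> * \<phi> x) *\<^sub>R w x))\<^sup>2)
    = (\<lambda>x. (norm (grad \<phi> x))\<^sup>2 + \<beta> * (2 * \<phi> x * (grad \<phi> x \<bullet> w x)) + \<beta>\<^sup>2 * ((\<phi> x)\<^sup>2 * (norm (w x))\<^sup>2))"
    unfolding power2_norm_eq_inner fun_eq_iff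
    by (simp add: inner_commute power2_eq_square algebra_simps)
  also have "(LINT x|M. (norm (grad \<phi> x))\<^sup>2 + \<beta> * (2 * \<phi> x * (grad \<phi> x \<bullet> w x)) + \<beta>\<^sup>2 * ((\<phi> x)\<^sup>2 * (norm (w x))\<^sup>2))
    = (L2_norm \<pi> (grad \<phi>))\<^sup>2 + \<beta> * (LINT x|M. 2 * \<phi> x * (grad \<phi> x \<bullet> w x)) + \<beta>\<^sup>2 * (LINT x|M. (\<phi> x)\<^sup>2 * (norm (w x))\<^sup>2)"
    using i1 i2 i3 by (simp only: Bochner_Integration.integral_add Bochner_Integration.integrable_add integrable_mult_right
        integral_mult_right_zero L2_norm_sq)
  finally have le: "\<beta> * (LINT x|M. (\<phi> x)\<^sup>2 * (?\<Delta> x / \<pi> x)) - \<beta>\<^sup>2 * (LINT x|M. (\<phi> x)\<^sup>2 * (norm (w x))\<^sup>2)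
    \<le> (L2_norm \<pi> (grad \<phi>))\<^sup>2"
    unfolding cross by simp
  have "(\<lambda>x. lyapunov_potential \<beta> x * (\<phi> x)\<^sup>2)
     = (\<lambda>x. \<beta> * ((\<phi> x)\<^sup>2 * (?\<Delta> x / \<pi> x)) - \<beta>\<^sup>2 * ((\<phi> x)\<^sup>2 * (norm (w x))\<^sup>2))"
    by (auto simp: fun_eq_iff lyapunov_potential_def laplacian_ln_density w_def[symmetric] power2_eq_square algebra_simps)
  then have "(LINT x|M. lyapunov_potential \<beta> x * (\<phi> x)\<^sup>2)
     = \<beta> * (LINT x|M. (\<phi> x)\<^sup>2 * (?\<Delta> x / \<pi> x)) - \<beta>\<^sup>2 * (LINT x|M. (\<phi> x)\<^sup>2 * (norm (w x))\<^sup>2)"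
    using i3 i4 by (simp only: Bochner_Integration.integral_diff integrable_mult_right integral_mult_right_zero)
  then show ?thesis using le by simp
qed

text \<open>The potential is bounded below by a positive constant only outside a ball. On the ball
  the missing mass is controlled after subtracting a local mean; since the global mean is the best
  constant in L2(\<pi>), any local choice bounds the variance.\<close>

lemma poincare_inequality:
  assumes "0 < \<beta>" and lim: "Liminf at_infinity (\<lambda>x. ereal ((1 - \<beta>) * (norm (grad (\<lambda>y. ln (\<pi> y)) x))\<^sup>2
             + laplacian (\<lambda>y. ln (\<pi> y)) x)) > 0"
  obtains C where "C > 0" "\<And>f G. has_L2_gradient \<pi> f G \<Longrightarrow> (LINT x|M. f x) = 0 \<Longrightarrow> nm f \<le> C * nm G"
proof -
  let ?q = "lyapunov_potential \<beta>"
  obtain c0 where c0: "0 < c0" and ev: "\<forall>\<^sub>F x in at_infinity. c0 < (1 - \<beta>) * (norm (grad (\<lambda>y. ln (\<pi> y)) x))\<^sup>2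
             + laplacian (\<lambda>y. ln (\<pi> y)) x"
    using ereal_dense2[OF lim] by (auto dest!: less_LiminfD)
  define c where "c = \<beta> * c0"
  have c: "c > 0" using c0 \<open>0 < \<beta>\<close> by (simp add: c_def)
  obtain R0 where R0: "\<And>x. norm x \<ge> R0 \<Longrightarrow> c \<le> ?q x"
    using ev \<open>0 < \<beta>\<close> by (force simp: eventually_at_infinity c_def lyapunov_potential_def intro!: mult_left_mono)
  define R where "R = max R0 1"
  \<comment> \<open>The maximum in \<open>R\<close> gives the ball positive volume, as
    \<open>local_poincare\<close> requires.\<close>
  define K where "K = cball (0::'a) R"
  have R: "R > 0" by (simp add: R_def)
  have K: "compact K" "convex K" by (simp_all add: K_def)
  have Kb[measurable]: "K \<in> sets borel" by (simp add: K_def)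
  have Kne: "0 \<in> K" using R by (simp add: K_def)
  have "compact (?q ` K)" by (intro compact_continuous_image continuous_on_subset[OF lyapunov_potential_continuous] K) auto
  then obtain Q where Q: "\<And>x. x \<in> K \<Longrightarrow> \<bar>?q x\<bar> \<le> Q"
    using compact_imp_bounded by (force simp: bounded_iff)
  have Q0: "Q \<ge> 0" using Q[OF Kne] by linarith
  \<comment> \<open>On \<open>K\<close> the potential is at least \<open>-Q = c - L\<close>, outside
    it is at least \<open>c\<close>; one inequality with an indicator covers both.\<close>
  define L where "L = c + Q"
  have L: "L \<ge> 0" using c Q0 by (simp add: L_def)
  have q_ge: "c - L * indicator K x \<le> ?q x" for x
    using R0[of x] Q[of x] by (cases "x \<in> K") (auto simp: L_def K_def R_def abs_le_iff)
  have L2K: "(\<lambda>x. indicator K x * f x) \<in> L2 \<pi>" if "f \<in> L2 \<pi>" for f :: "'a \<Rightarrow> real"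
    using L2_scaleR_bounded[OF that, of "indicator K" 1] by (simp add: indicator_def)
  \<comment> \<open>Stated for all functions with a gradient, because it is applied to a test
    function minus a constant, which need not be a test function.\<close>
  have base: "c * ip f f \<le> ip G G + L * ip (\<lambda>x. indicator K x * f x) f"
    if fG: "has_L2_gradient \<pi> f G" for f G
  proof -
    have test: "c * ip \<phi> \<phi> \<le> ip (grad \<phi>) (grad \<phi>) + L * ip (\<lambda>x. indicator K x * \<phi> x) \<phi>"
      if \<phi>: "\<phi> \<in> test_functions" for \<phi>
    proof -
      have p: "\<phi> \<in> L2 \<pi>" by (rule test_L2[OF \<phi>])
      have i: "integrable M (\<lambda>x. \<phi> x * \<phi> x)" "integrable M (\<lambda>x. indicator K x * \<phi> x * \<phi> x)"
        using L2_inner_integrable[OF p p] L2_inner_integrable[OF L2K[OF p] p] by simp_all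
      have "c * ip \<phi> \<phi> - L * ip (\<lambda>x. indicator K x * \<phi> x) \<phi>
         = (LINT x|M. c * (\<phi> x * \<phi> x) - L * (indicator K x * \<phi> x * \<phi> x))"
        using i by (simp add: L2_inner_def)
      also have "\<dots> \<le> (LINT x|M. ?q x * (\<phi> x)\<^sup>2)"
      proof (rule integral_mono)
        show "integrable M (\<lambda>x. c * (\<phi> x * \<phi> x) - L * (indicator K x * \<phi> x * \<phi> x))" using i by simp
        show "integrable M (\<lambda>x. ?q x * (\<phi> x)\<^sup>2)"
        proof (rule L2_integrable[OF L2_bounded_support])
          show "continuous_on UNIV (\<lambda>x. ?q x * (\<phi> x)\<^sup>2)"
            by (intro continuous_intros lyapunov_potential_continuous C_k_continuous[OF test_C_k[OF \<phi>, of 0]])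
          show "bounded {x. ?q x * (\<phi> x)\<^sup>2 \<noteq> 0}"
            by (rule bounded_subset[OF test_support[OF \<phi>]]) auto
        qed
        show "c * (\<phi> x * \<phi> x) - L * (indicator K x * \<phi> x * \<phi> x) \<le> ?q x * (\<phi> x)\<^sup>2" for x
          using mult_right_mono[OF q_ge[of x], of "(\<phi> x)\<^sup>2"] by (simp add: power2_eq_square algebra_simps)
      qed
      also have "\<dots> \<le> ip (grad \<phi>) (grad \<phi>)"
        using lyapunov_inequality[OF \<phi>] by (simp add: W.nrm_sq test_grad_L2 \<phi>)
      finally show ?thesis by simp
    qed
    obtain \<phi> where \<phi>: "\<And>n. \<phi> n \<in> test_functions" "L2_lim \<phi> f"
      "L2_lim (\<lambda>n. grad (\<phi> n)) G"
      using gradient_approx[OF fG] by blast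
    note fL = gradient_L2[OF fG]
    have \<phi>K: "(\<lambda>n. nm (\<lambda>x. indicator K x * \<phi> n x - indicator K x * f x)) \<longlonglongrightarrow> 0"
    proof (rule Lim_null_comparison[OF _ \<phi>(2)], intro always_eventually allI)
      fix n
      have d: "(\<lambda>x. \<phi> n x - f x) \<in> L2 \<pi>" by (intro S.V_diff test_L2 \<phi> fL)
      show "norm (L2_norm \<pi> (\<lambda>x. indicator K x * \<phi> n x - indicator K x * f x)) \<le> nm (\<lambda>x. \<phi> n x - f x)"
        using L2_norm_inner_bounded[OF d, of "indicator K :: 'a \<Rightarrow> real" 1] S.nrm_nonneg[OF L2K[OF d]]
        by (simp add: indicator_def right_diff_distrib)
    qed
    show ?thesis
    proof (rule LIMSEQ_le)
      show "(\<lambda>n. c * ip (\<phi> n) (\<phi> n)) \<longlonglongrightarrow> c * ip f f"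
        by (intro tendsto_intros S.tendsto_q test_L2 \<phi> fL)
      show "(\<lambda>n. ip (grad (\<phi> n)) (grad (\<phi> n)) + L * ip (\<lambda>x. indicator K x * \<phi> n x) (\<phi> n))
         \<longlonglongrightarrow> ip G G + L * ip (\<lambda>x. indicator K x * f x) f"
        by (intro tendsto_intros S.tendsto_q W.tendsto_q test_L2 test_grad_L2 \<phi> \<phi>K L2K fL)
    qed (use test \<phi>(1) in blast)
  qed
  \<comment> \<open>On the compact ball the weight is comparable with Lebesgue measure:
    \<open>P\<close> passes from \<pi> to Lebesgue, \<open>p\<close> passes back.\<close>
  obtain p P where p: "p > 0" "\<And>x. x \<in> K \<Longrightarrow> p \<le> \<pi> x" and P: "\<And>x. x \<in> K \<Longrightarrow> \<pi> x \<le> P"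
  proof -
    have ct: "continuous_on K \<pi>" by (rule continuous_on_subset[OF C_k_continuous[OF C_k_density[of 0]]]) simp
    have ne: "K \<noteq> {}" using Kne by auto
    obtain a b where "\<And>x. x \<in> K \<Longrightarrow> \<pi> a \<le> \<pi> x" "\<And>x. x \<in> K \<Longrightarrow> \<pi> x \<le> \<pi> b"
      using continuous_attains_inf[OF K(1) ne ct] continuous_attains_sup[OF K(1) ne ct] by blast
    then show ?thesis using that density_pos by blast
  qed
  have P0: "P > 0" using P[OF Kne] density_pos[of 0] by linarith
  obtain C0 where C0: "C0 \<ge> 0" "\<And>f. C_k (Suc 0) f \<Longrightarrow>
    \<exists>m. (LINT x|lborel. indicator K x * (f x - m)\<^sup>2) \<le> C0 * (LINT x|lborel. indicator K x * (norm (grad f x))\<^sup>2)"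
    using local_poincare[OF K(2,1)] content_cball_pos[OF R, of 0] unfolding K_def by blast
  \<comment> \<open>Collects the losses: \<open>P\<close> and \<open>1 / p\<close> for changing
    measures, \<open>C0\<close> from the ball, \<open>L\<close> for the defect of the potential
    there, and \<open>c\<close> from its lower bound at infinity.\<close>
  define C where "C = (1 + L * P * C0 / p) / c"
  have "L * P * C0 / p \<ge> 0" using L P0 C0 p by simp
  then have C: "C > 0" using c unfolding C_def by (intro divide_pos_pos) linarith+
  have var: "ip \<phi> \<phi> - (L2_inner \<pi> \<phi> (\<lambda>_. 1))\<^sup>2 \<le> C * ip (grad \<phi>) (grad \<phi>)"
    if \<phi>: "\<phi> \<in> test_functions" for \<phi>
  proof -
    have C1: "C_k (Suc 0) \<phi>" by (rule test_C_k[OF \<phi>])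
    obtain m where m: "(LINT x|lborel. indicator K x * (\<phi> x - m)\<^sup>2) \<le> C0 * (LINT x|lborel. indicator K x * (norm (grad \<phi> x))\<^sup>2)"
      using C0(2)[OF C1] by blast
    let ?f = "\<lambda>x. \<phi> x - m"
    have grad: "has_L2_gradient \<pi> ?f (grad \<phi>)"
      using gradient_lincomb[OF gradient_test[OF \<phi>] gradient_const[of m], of 1 "-1"] by simp
    have fL: "?f \<in> L2 \<pi>" by (rule gradient_L2(1)[OF grad])
    have gL: "grad \<phi> \<in> L2 \<pi>" by (rule gradient_L2(2)[OF grad])
    have pL: "\<phi> \<in> L2 \<pi>" by (rule test_L2[OF \<phi>])
    note [measurable] = L2_borel[OF fL] L2_borel[OF gL]
    have c\<phi>: "continuous_on UNIV \<phi>" by (rule C_k_continuous[OF C1])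
    have cg: "continuous_on UNIV (grad \<phi>)" by (rule C_k_continuous[OF C_k_grad[OF C1]])
    have c\<pi>: "continuous_on UNIV \<pi>" by (rule C_k_continuous[OF C_k_density[of 0]])
    have int: "integrable lborel (\<lambda>x. indicator K x * g x)" if "continuous_on UNIV g" for g :: "'a \<Rightarrow> real"
      using borel_integrable_compact[OF K(1), of g] that by (auto intro: continuous_on_subset)
    have "ip (\<lambda>x. indicator K x * ?f x) ?f = (LINT x|lborel. indicator K x * (\<pi> x * (?f x)\<^sup>2))"
      unfolding L2_inner_def by (subst integral_M) (auto simp: power2_eq_square mult_ac)
    also have "\<dots> \<le> (LINT x|lborel. P * (indicator K x * (?f x)\<^sup>2))"
      by (intro integral_mono integrable_mult_right int continuous_intros c\<phi> c\<pi>)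
        (auto simp: indicator_def intro!: mult_right_mono P)
    also have "\<dots> = P * (LINT x|lborel. indicator K x * (?f x)\<^sup>2)" by simp
    also have "\<dots> \<le> P * (C0 * (LINT x|lborel. indicator K x * (norm (grad \<phi> x))\<^sup>2))"
      using m P0 by simp
    also have "(LINT x|lborel. indicator K x * (norm (grad \<phi> x))\<^sup>2) \<le> (LINT x|lborel. inverse p * (\<pi> x * (norm (grad \<phi> x))\<^sup>2))"
    proof (rule integral_mono)
      show "integrable lborel (\<lambda>x. indicator K x * (norm (grad \<phi> x))\<^sup>2)" by (intro int continuous_intros cg)
      show "integrable lborel (\<lambda>x. inverse p * (\<pi> x * (norm (grad \<phi> x))\<^sup>2))"
        by (intro integrable_mult_right integrable_bounded_support continuous_intros c\<pi> cg)
          (rule bounded_subset[OF bounded_support_grad[OF test_support[OF \<phi>]]], auto)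
      show "indicator K x * (norm (grad \<phi> x))\<^sup>2 \<le> inverse p * (\<pi> x * (norm (grad \<phi> x))\<^sup>2)" for x
      proof (cases "x \<in> K")
        case True
        have "1 \<le> inverse p * \<pi> x" using p(1) p(2)[OF True] by (simp add: field_simps)
        from mult_right_mono[OF this, of "(norm (grad \<phi> x))\<^sup>2"] show ?thesis using True by (simp add: mult_ac)
      next
        case False
        then show ?thesis using p(1) density_pos[of x] by (simp add: less_imp_le)
      qed
    qed
    also have "\<dots> = inverse p * ip (grad \<phi>) (grad \<phi>)"
      unfolding L2_inner_def by (subst integral_M) (auto simp: power2_norm_eq_inner)
    finally have loc: "ip (\<lambda>x. indicator K x * ?f x) ?f \<le> P * (C0 * (inverse p * ip (grad \<phi>) (grad \<phi>)))"
      using P0 C0(1) by (simp add: mult_left_mono)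
    have "c * ip ?f ?f \<le> ip (grad \<phi>) (grad \<phi>) + L * (P * (C0 * (inverse p * ip (grad \<phi>) (grad \<phi>))))"
      using base[OF grad] mult_left_mono[OF loc L] by linarith
    also have "\<dots> = c * (C * ip (grad \<phi>) (grad \<phi>))"
      using c unfolding C_def by (simp add: field_simps)
    finally have "ip ?f ?f \<le> C * ip (grad \<phi>) (grad \<phi>)" using c by simp
    \<comment> \<open>Bias-variance decomposition; dropping the square of the bias replaces
      \<open>m\<close> by the global mean.\<close>
    moreover have "ip ?f ?f = ip \<phi> \<phi> - (L2_inner \<pi> \<phi> (\<lambda>_. 1))\<^sup>2 + (L2_inner \<pi> \<phi> (\<lambda>_. 1) - m)\<^sup>2"
    proof -
      have "ip (\<lambda>_. 1) (\<lambda>_. 1 :: real) = 1" by (simp add: L2_inner_def)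
      then show ?thesis
        using S.quadratic_expand[OF pL L2_const[of 1], of 1 "- m"] by (simp add: power2_diff)
    qed
    ultimately show ?thesis using zero_le_power2[of "ip \<phi> (\<lambda>_. 1) - m"] by linarith
  qed
  have "nm f \<le> sqrt C * nm G" if fG: "has_L2_gradient \<pi> f G" and mean: "(LINT x|M. f x) = 0" for f G
  proof -
    obtain \<phi> where \<phi>: "\<And>n. \<phi> n \<in> test_functions" "L2_lim \<phi> f"
      "L2_lim (\<lambda>n. grad (\<phi> n)) G"
      using gradient_approx[OF fG] by blast
    note fL = gradient_L2[OF fG]
    have "ip f f - (L2_inner \<pi> f (\<lambda>_. 1))\<^sup>2 \<le> C * ip G G"
    proof (rule LIMSEQ_le)
      have "(\<lambda>n. nm (\<lambda>x. (1::real) - 1)) \<longlonglongrightarrow> 0" by (simp add: L2_norm_zero_AE)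
      then show "(\<lambda>n. ip (\<phi> n) (\<phi> n) - (L2_inner \<pi> (\<phi> n) (\<lambda>_. 1))\<^sup>2)
          \<longlonglongrightarrow> ip f f - (L2_inner \<pi> f (\<lambda>_. 1))\<^sup>2"
        by (intro tendsto_intros S.tendsto_q test_L2 \<phi> fL L2_const)
      show "(\<lambda>n. C * ip (grad (\<phi> n)) (grad (\<phi> n))) \<longlonglongrightarrow> C * ip G G"
        by (intro tendsto_intros W.tendsto_q test_grad_L2 \<phi> fL)
    qed (use var \<phi>(1) in blast)
    then have "ip f f \<le> C * ip G G" using mean by (simp add: L2_inner_def)
    then show ?thesis unfolding L2_norm_def by (metis real_sqrt_le_mono real_sqrt_mult)
  qed
  then show ?thesis using that[of "sqrt C"] C by simp
qed

end

section \<open>The form domain\<close>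

lemma op_scaleI: "(f, u) \<in> T \<Longrightarrow> (f, \<lambda>x. c * u x) \<in> op_scale c T"
  by (auto simp: op_scale_def)

lemma op_plusI: "(f, u) \<in> T \<Longrightarrow> (f, v) \<in> U \<Longrightarrow> (f, \<lambda>x. u x + v x) \<in> op_plus T U"
  by (auto simp: op_plus_def)

lemma Domain_op_scale: "Domain (op_scale c T) = Domain T"
  by (auto simp: op_scale_def)

lemma Domain_op_plus: "Domain (op_plus T U) = Domain T \<inter> Domain U"
  by (auto simp: op_plus_def)

lemma is_operator_AE:
  assumes "is_operator \<pi> T" "(f, u) \<in> T" "g \<in> L20 \<pi>" "v \<in> L20 \<pi>" "AE x in dens_measure \<pi>. f x = g x"
  shows "(g, v) \<in> T \<longleftrightarrow> (AE x in dens_measure \<pi>. u x = v x)"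
  by (rule assms(1)[unfolded is_operator_def, THEN conjunct2, THEN conjunct2, rule_format, OF assms(2-5)])

context smooth_density
begin

section \<open>Mean-zero functions and the Dirichlet form\<close>

lemma L20_L2: "f \<in> L20 \<pi> \<Longrightarrow> f \<in> L2 \<pi>"
  by (simp add: L20_def)

lemma L20_iff: "f \<in> L20 \<pi> \<longleftrightarrow> f \<in> L2 \<pi> \<and> ip f (\<lambda>_. 1) = 0"
  by (auto simp: L20_def L2_inner_def)

lemma L20_lincomb: "f \<in> L20 \<pi> \<Longrightarrow> g \<in> L20 \<pi> \<Longrightarrow> (\<lambda>x. a * f x + b * g x) \<in> L20 \<pi>"
  unfolding L20_iff using S.V_lincomb[of f g a b] S.q_lincomb[of f g "\<lambda>_. 1" a b] L2_const[of 1] by simp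

lemma L20_scale: "f \<in> L20 \<pi> \<Longrightarrow> (\<lambda>x. a * f x) \<in> L20 \<pi>"
  using L20_lincomb[of f f a 0] by simp

lemma L20_zero: "(\<lambda>x. 0) \<in> L20 \<pi>"
  by (simp add: L20_def L2_const)

lemma L20_AE_eq:
  assumes "f \<in> L20 \<pi>" "g \<in> L20 \<pi>" "\<And>h. h \<in> L20 \<pi> \<Longrightarrow> ip f h = ip g h"
  shows "AE x in M. f x = g x"
proof -
  have d: "(\<lambda>x. f x - g x) \<in> L20 \<pi>" using L20_lincomb[OF assms(1,2), of 1 "-1"] by simp
  have "AE x in M. f x - g x = 0"
    using assms(3)[OF d] d assms(1,2) by (intro L2_inner_zero_AE) (simp_all add: S.q_diff L20_L2)
  then show ?thesis by eventually_elim simp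
qed

lemma H1_L20: "f \<in> H1 \<pi> \<Longrightarrow> f \<in> L20 \<pi>"
  by (simp add: H1_def)

lemma H1_L2: "f \<in> H1 \<pi> \<Longrightarrow> f \<in> L2 \<pi>"
  by (simp add: H1_L20 L20_L2)

lemma H1_gradient: "f \<in> H1 \<pi> \<Longrightarrow> has_L2_gradient \<pi> f (L2_grad \<pi> f)"
  unfolding H1_def L2_grad_def by (auto intro: someI[of "has_L2_gradient \<pi> f"])

lemma H1_I: "f \<in> L20 \<pi> \<Longrightarrow> has_L2_gradient \<pi> f G \<Longrightarrow> f \<in> H1 \<pi>"
  unfolding H1_def by auto

lemma L2_grad_L2: "f \<in> H1 \<pi> \<Longrightarrow> L2_grad \<pi> f \<in> L2 \<pi>"
  by (rule gradient_L2(2)[OF H1_gradient])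

lemma L2_grad_AE: "f \<in> H1 \<pi> \<Longrightarrow> has_L2_gradient \<pi> f G \<Longrightarrow> AE x in M. L2_grad \<pi> f x = G x"
  by (rule gradient_unique[OF H1_gradient])

lemma H1_lincomb: "f \<in> H1 \<pi> \<Longrightarrow> g \<in> H1 \<pi> \<Longrightarrow> (\<lambda>x. a * f x + b * g x) \<in> H1 \<pi>"
  by (rule H1_I[OF L20_lincomb gradient_lincomb[OF H1_gradient H1_gradient]]) (auto intro: H1_L20)

lemma H1_cong_AE:
  assumes "f \<in> H1 \<pi>" "AE x in M. f x = g x" "g \<in> L20 \<pi>"
  shows "g \<in> H1 \<pi>"
  by (rule H1_I[OF assms(3) gradient_cong_AE[OF H1_gradient[OF assms(1)] assms(2)]])
    (use assms in \<open>auto intro: L2_borel L20_L2 L2_grad_L2\<close>)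

text \<open>\<open>L2_grad\<close> is a choice depending on the representative, so equal classes
  have gradients that agree only almost everywhere.\<close>

lemma L2_grad_cong_AE:
  assumes "f \<in> H1 \<pi>" "g \<in> H1 \<pi>" "AE x in M. f x = g x"
  shows "AE x in M. L2_grad \<pi> f x = L2_grad \<pi> g x"
proof -
  have "has_L2_gradient \<pi> g (L2_grad \<pi> f)"
    by (rule gradient_cong_AE[OF H1_gradient[OF assms(1)] assms(3)])
      (use assms in \<open>auto intro: L2_borel H1_L2 L2_grad_L2\<close>)
  from L2_grad_AE[OF assms(2) this] show ?thesis by eventually_elim simp
qed

lemma L2_grad_lincomb_AE:
  assumes "f \<in> H1 \<pi>" "g \<in> H1 \<pi>"
  shows "AE x in M. L2_grad \<pi> (\<lambda>x. a * f x + b * g x) x = a *\<^sub>R L2_grad \<pi> f x + b *\<^sub>R L2_grad \<pi> g x"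
  by (rule L2_grad_AE[OF H1_lincomb[OF assms] gradient_lincomb[OF assms[THEN H1_gradient]]])

lemma semi_inner_dirichlet: "semi_inner (H1 \<pi>) (dirichlet \<pi>)"
proof
  show "(\<lambda>x. 0) \<in> H1 \<pi>" by (rule H1_I[OF L20_zero gradient_const])
  fix f g h :: "'a \<Rightarrow> real" and a b :: real
  assume f: "f \<in> H1 \<pi>"
  show "0 \<le> dirichlet \<pi> f f" unfolding dirichlet_def by (intro W.q_nonneg L2_grad_L2 f)
  assume g: "g \<in> H1 \<pi>"
  show "(\<lambda>x. a *\<^sub>R f x + b *\<^sub>R g x) \<in> H1 \<pi>" using H1_lincomb[OF f g] by simp
  show "dirichlet \<pi> f g = dirichlet \<pi> g f" unfolding dirichlet_def by (intro W.q_sym L2_grad_L2 f g)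
  assume h: "h \<in> H1 \<pi>"
  note L = L2_grad_L2[OF f] L2_grad_L2[OF g] L2_grad_L2[OF h]
  have "dirichlet \<pi> (\<lambda>x. a * f x + b * g x) h
    = ip (\<lambda>x. a *\<^sub>R L2_grad \<pi> f x + b *\<^sub>R L2_grad \<pi> g x) (L2_grad \<pi> h)"
    unfolding dirichlet_def
    by (rule L2_inner_cong_AE[OF L2_grad_lincomb_AE[OF f g]])
      (auto intro: W.V_lincomb L L2_grad_L2 H1_lincomb f g)
  then show "dirichlet \<pi> (\<lambda>x. a *\<^sub>R f x + b *\<^sub>R g x) h = a * dirichlet \<pi> f h + b * dirichlet \<pi> g h"
    using L by (simp add: dirichlet_def W.q_lincomb)
qed

sublocale D: semi_inner "H1 \<pi>" "dirichlet \<pi>"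
  by (rule semi_inner_dirichlet)

lemma D_nrm: "D.nrm f = nm (L2_grad \<pi> f)"
  by (simp add: D.nrm_def L2_norm_def dirichlet_def)

text \<open>Test functions minus their means lie in H1 and already separate. This density makes the
  value of an operator defined weakly by a form unique up to null sets.\<close>

lemma H1_dense:
  assumes h: "h \<in> L20 \<pi>" "h' \<in> L20 \<pi>" and eq: "\<And>g. g \<in> H1 \<pi> \<Longrightarrow> ip h g = ip h' g"
  shows "AE x in M. h x = h' x"
proof -
  define k where "k x = h x - h' x" for x
  have k: "k \<in> L20 \<pi>" unfolding k_def using L20_lincomb[OF h, of 1 "-1"] by simp
  have zero: "ip k g = 0" if "g \<in> H1 \<pi>" for g
    unfolding k_def using eq[OF that] h that by (simp add: S.q_diff L20_L2 H1_L2)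
  have "AE x in M. k x = 0"
  proof (rule test_separate)
    show "integrable M k" by (rule L2_integrable[OF L20_L2[OF k]])
    fix \<phi> :: "'a \<Rightarrow> real" assume \<phi>: "\<phi> \<in> test_functions"
    define m where "m = (LINT x|M. \<phi> x)"
    have \<phi>L: "\<phi> \<in> L2 \<pi>" by (rule test_L2[OF \<phi>])
    have grad: "has_L2_gradient \<pi> (\<lambda>x. \<phi> x - m) (grad \<phi>)"
      using gradient_lincomb[OF gradient_test[OF \<phi>] gradient_const[of m], of 1 "-1"] by simp
    have "(\<lambda>x. \<phi> x - m) \<in> L20 \<pi>"
      unfolding L20_def using gradient_L2(1)[OF grad] L2_integrable[OF \<phi>L] by (simp add: m_def)
    then have "(\<lambda>x. \<phi> x - m) \<in> H1 \<pi>" using grad by (rule H1_I)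
    then have "ip k (\<lambda>x. \<phi> x - m) = 0" by (rule zero)
    \<comment> \<open>As \<open>k\<close> has mean zero, subtracting the mean \<open>m\<close> does
      not change the pairing.\<close>
    moreover have "ip k (\<lambda>x. m) = 0"
      using S.q_scale_right[OF L2_const[of 1] L20_L2[OF k], of m] k by (simp add: L20_iff)
    ultimately show "(LINT x|M. \<phi> x * k x) = 0"
      using S.q_diff_right[OF \<phi>L L2_const[of m] L20_L2[OF k]] by (simp add: L2_inner_def mult.commute)
  qed simp
  then show ?thesis by eventually_elim (simp add: k_def)
qed

end

section \<open>The operators\<close>

text \<open>The drift bound \<open>B\<close> and the Poincare constant \<open>C\<close> are
  parameters, so that operator bounds can be given explicitly in terms of them.\<close>

locale divergence_free_drift = smooth_density +
  fixes \<gamma> :: "'a \<Rightarrow> 'a" and B C :: real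
  assumes drift_C1: "C_k (Suc 0) \<gamma>" and drift_bounded: "\<And>x. norm (\<gamma> x) \<le> B"
    and drift_divergence: "\<And>x. divergence (\<lambda>y. \<pi> y *\<^sub>R \<gamma> y) x = 0"
    and poincare_pos: "0 < C"
    and poincare: "\<And>f G. has_L2_gradient \<pi> f G \<Longrightarrow> (LINT x|M. f x) = 0 \<Longrightarrow> nm f \<le> C * nm G"
begin

lemma B_nonneg: "0 \<le> B"
  using norm_ge_zero order.trans drift_bounded by blast

lemma H1_poincare: "f \<in> H1 \<pi> \<Longrightarrow> nm f \<le> C * D.nrm f"
  unfolding D_nrm using poincare[OF H1_gradient] H1_L20 by (auto simp: L20_def)

text \<open>By the Poincare inequality a sequence that is Cauchy for the gradients is also Cauchy in
  L2. Closedness of the gradient joins the two limits, and the mean, a pairing with 1, stays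
  zero.\<close>

lemma H1_complete:
  assumes F: "\<And>n. F n \<in> H1 \<pi>"
    and cauchy: "\<And>e. e > 0 \<Longrightarrow> \<exists>N. \<forall>m\<ge>N. \<forall>n\<ge>N. D.nrm (\<lambda>x. F m x - F n x) < e"
  shows "\<exists>f\<in>H1 \<pi>. (\<lambda>n. D.nrm (\<lambda>x. F n x - f x)) \<longlonglongrightarrow> 0"
proof -
  have nrm_diff: "D.nrm (\<lambda>x. f x - g x) = nm (\<lambda>x. L2_grad \<pi> f x - G x)"
    if "f \<in> H1 \<pi>" "g \<in> H1 \<pi>" "has_L2_gradient \<pi> g G" for f g G
  proof -
    have grad: "has_L2_gradient \<pi> (\<lambda>x. f x - g x) (\<lambda>x. L2_grad \<pi> f x - G x)"
      using gradient_lincomb[OF H1_gradient[OF that(1)] that(3), of 1 "-1"] by simp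
    have d: "(\<lambda>x. f x - g x) \<in> H1 \<pi>" using that by (intro D.V_diff)
    show ?thesis
      unfolding D_nrm L2_norm_def
      by (intro arg_cong[of _ _ sqrt] L2_inner_cong_AE L2_grad_AE[OF d grad] L2_grad_L2[OF d] gradient_L2(2)[OF grad])
  qed
  have "\<exists>f\<in>L2 \<pi>. L2_lim F f"
  proof (rule L2_complete[OF H1_L2[OF F]])
    fix e :: real assume "e > 0"
    then obtain N where N: "\<forall>m\<ge>N. \<forall>n\<ge>N. D.nrm (\<lambda>x. F m x - F n x) < e / C"
      using cauchy[of "e / C"] poincare_pos by auto
    show "\<exists>N. \<forall>m\<ge>N. \<forall>n\<ge>N. nm (\<lambda>x. F m x - F n x) < e"
    proof (intro exI allI impI)
      fix m n assume "m \<ge> N" "n \<ge> N"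
      then have "D.nrm (\<lambda>x. F m x - F n x) < e / C" using N by blast
      then have "C * D.nrm (\<lambda>x. F m x - F n x) < e" using poincare_pos by (simp add: field_simps)
      then show "nm (\<lambda>x. F m x - F n x) < e"
        using H1_poincare[OF D.V_diff[OF F[of m] F[of n]]] by linarith
    qed
  qed
  then obtain f where f: "f \<in> L2 \<pi>" "L2_lim F f" by blast
  have "\<exists>G\<in>L2 \<pi>. L2_lim (\<lambda>n. L2_grad \<pi> (F n)) G"
    by (rule L2_complete[OF L2_grad_L2[OF F]])
      (use cauchy in \<open>simp add: nrm_diff[OF F F H1_gradient[OF F]]\<close>)
  then obtain G where G: "G \<in> L2 \<pi>" "L2_lim (\<lambda>n. L2_grad \<pi> (F n)) G" by blast
  have grad: "has_L2_gradient \<pi> f G" by (rule gradient_closed[OF H1_gradient[OF F] f(1) G(1) f(2) G(2)])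
  have "(\<lambda>n. ip (F n) (\<lambda>_. 1)) \<longlonglongrightarrow> ip f (\<lambda>_. 1)"
    by (rule S.tendsto_q[OF H1_L2[OF F] L2_const f(1) L2_const f(2)]) (simp add: L2_norm_zero_AE)
  moreover have "ip (F n) (\<lambda>_. 1) = 0" for n using H1_L20[OF F] by (simp add: L20_iff)
  ultimately have "f \<in> L20 \<pi>" using f(1) by (simp add: L20_iff LIMSEQ_const_iff)
  then have fH: "f \<in> H1 \<pi>" using grad by (rule H1_I)
  show ?thesis by (rule bexI[OF _ fH]) (use G(2) in \<open>simp add: nrm_diff[OF F fH grad]\<close>)
qed

text \<open>One fixed representative of \<open>A f\<close>; the graph \<open>A_op\<close> also
  contains its modifications on null sets.\<close>

definition adv :: "('a \<Rightarrow> real) \<Rightarrow> 'a \<Rightarrow> real" where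
  "adv f x = \<gamma> x \<bullet> L2_grad \<pi> f x"

lemma \<gamma>_borel [measurable]: "\<gamma> \<in> borel_measurable borel"
  by (rule borel_measurable_continuous_onI[OF C_k_continuous[OF drift_C1]])

lemma adv_L2: "f \<in> H1 \<pi> \<Longrightarrow> adv f \<in> L2 \<pi>"
  unfolding adv_def[abs_def] by (rule L2_inner_bounded[OF L2_grad_L2 \<gamma>_borel drift_bounded])

text \<open>The mean of \<open>\<gamma> \<bullet> \<nabla>f\<close> vanishes because the constants have gradient zero.\<close>

lemma adv_L20: "f \<in> H1 \<pi> \<Longrightarrow> adv f \<in> L20 \<pi>"
  using divergence_free_antisymmetric[OF drift_C1 drift_bounded drift_divergence H1_gradient gradient_const[of 1]] adv_L2
  by (simp add: L20_iff adv_def[abs_def] L2_inner_def)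

lemma adv_antisymmetric:
  "f \<in> H1 \<pi> \<Longrightarrow> g \<in> H1 \<pi> \<Longrightarrow> ip (adv f) g = - ip f (adv g)"
  unfolding adv_def[abs_def]
  by (rule divergence_free_antisymmetric[OF drift_C1 drift_bounded drift_divergence H1_gradient H1_gradient])

lemma adv_self: "f \<in> H1 \<pi> \<Longrightarrow> ip (adv f) f = 0"
  using adv_antisymmetric[of f f] S.q_sym[of f "adv f"] adv_L2 H1_L2 by simp

lemma adv_norm: "f \<in> H1 \<pi> \<Longrightarrow> nm (adv f) \<le> B * D.nrm f"
  unfolding adv_def[abs_def] D_nrm by (intro L2_norm_inner_bounded L2_grad_L2 \<gamma>_borel drift_bounded B_nonneg)

lemma adv_cong_AE:
  "f \<in> H1 \<pi> \<Longrightarrow> g \<in> H1 \<pi> \<Longrightarrow> AE x in M. f x = g x \<Longrightarrow> AE x in M. adv f x = adv g x"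
  using L2_grad_cong_AE[of f g] by (auto simp: adv_def)

text \<open>The chosen gradients combine linearly only off a null set; pairing with \<open>h\<close>
  turns this into an exact equality.\<close>

lemma adv_lincomb:
  assumes "f \<in> H1 \<pi>" "g \<in> H1 \<pi>" "h \<in> L2 \<pi>"
  shows "ip (adv (\<lambda>x. a * f x + b * g x)) h = a * ip (adv f) h + b * ip (adv g) h"
proof -
  have "AE x in M. adv (\<lambda>x. a * f x + b * g x) x = a *\<^sub>R adv f x + b *\<^sub>R adv g x"
    using L2_grad_lincomb_AE[OF assms(1,2), of a b] by eventually_elim (simp add: adv_def inner_add_right)
  then have "ip (adv (\<lambda>x. a * f x + b * g x)) h = ip (\<lambda>x. a *\<^sub>R adv f x + b *\<^sub>R adv g x) h"
    by (rule L2_inner_cong_AE) (auto intro: adv_L2 S.V_lincomb H1_lincomb assms simp del: real_scaleR_def)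
  then show ?thesis using assms by (simp only: S.q_lincomb adv_L2)
qed

text \<open>A common weak description for -S, -L and the effective operator. Both conditions see
  \<open>f\<close> and \<open>h\<close> only through integrals, which is what makes such graphs
  stable under changes on null sets.\<close>

definition form_operator :: "(('a \<Rightarrow> real) \<Rightarrow> ('a \<Rightarrow> real) \<Rightarrow> real) \<Rightarrow> 'a operator" where
  "form_operator b = {(f, h). f \<in> H1 \<pi> \<and> h \<in> L20 \<pi> \<and> (\<forall>g\<in>H1 \<pi>. b f g = ip h g)}"

lemma form_operator_iff:
  "(f, h) \<in> form_operator b \<longleftrightarrow> f \<in> H1 \<pi> \<and> h \<in> L20 \<pi> \<and> (\<forall>g\<in>H1 \<pi>. b f g = ip h g)"
  by (simp add: form_operator_def)

text \<open>Coercivity gives injectivity and the bound on the inverse, density of H1 makes the value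
  unique, and solvability gives full range. The rest is stability of the graph and of its converse
  under almost-everywhere changes.\<close>

lemma invertible_form_operator:
  assumes lin: "\<And>f f' g a c. f \<in> H1 \<pi> \<Longrightarrow> f' \<in> H1 \<pi> \<Longrightarrow> g \<in> H1 \<pi> \<Longrightarrow>
      b (\<lambda>x. a * f x + c * f' x) g = a * b f g + c * b f' g"
    and coercive: "\<And>f. f \<in> H1 \<pi> \<Longrightarrow> dirichlet \<pi> f f \<le> b f f"
    and cong: "\<And>f f' g. f \<in> H1 \<pi> \<Longrightarrow> f' \<in> H1 \<pi> \<Longrightarrow> g \<in> H1 \<pi> \<Longrightarrow> AE x in M. f x = f' x \<Longrightarrow> b f g = b f' g"
    and surj: "\<And>h. h \<in> L20 \<pi> \<Longrightarrow> \<exists>f\<in>H1 \<pi>. \<forall>g\<in>H1 \<pi>. b f g = ip h g"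
  shows "invertible_operator \<pi> (form_operator b)"
proof -
  let ?T = "form_operator b"
  \<comment> \<open>One factor \<open>C\<close> for each of the two copies of \<open>f\<close> in
    its squared norm; testing the equation with \<open>f\<close> itself bounds the energy by
    \<open>ip h f\<close>.\<close>
  have bound: "nm f \<le> C\<^sup>2 * nm h" if "(f, h) \<in> ?T" for f h
  proof -
    have f: "f \<in> H1 \<pi>" and h: "h \<in> L20 \<pi>" and eq: "b f f = ip h f"
      using that by (auto simp: form_operator_iff)
    have f2: "f \<in> L2 \<pi>" and h2: "h \<in> L2 \<pi>" using f h by (auto intro: H1_L2 L20_L2)
    have "(L2_norm \<pi> f)\<^sup>2 \<le> (C * D.nrm f)\<^sup>2"
      by (intro power_mono H1_poincare f S.nrm_nonneg f2)
    also have "\<dots> = C\<^sup>2 * dirichlet \<pi> f f" using f by (simp add: power_mult_distrib D.nrm_sq)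
    also have "\<dots> \<le> C\<^sup>2 * (L2_norm \<pi> h * nm f)"
      using coercive[OF f] eq S.cauchy_schwarz[OF h2 f2] by (intro mult_left_mono) auto
    finally have "nm f * nm f \<le> (C\<^sup>2 * nm h) * nm f"
      by (simp add: power2_eq_square mult_ac)
    then show ?thesis
      using S.nrm_nonneg[OF f2] S.nrm_nonneg[OF h2] by (cases "nm f = 0") auto
  qed
  have lincomb: "(\<lambda>x. a * f x + c * f' x, \<lambda>x. a * h x + c * h' x) \<in> ?T"
    if "(f, h) \<in> ?T" "(f', h') \<in> ?T" for f h f' h' a c
    using that S.q_lincomb[of h h' _ a c]
    by (auto simp: form_operator_iff lin H1_L2 L20_L2 intro: H1_lincomb L20_lincomb)
  \<comment> \<open>Linearity reduces this to \<open>bound\<close> for the difference, whose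
    right-hand side has norm zero.\<close>
  have inj: "AE x in M. f x = f' x" if "(f, h) \<in> ?T" "(f', h') \<in> ?T" "AE x in M. h x = h' x" for f f' h h'
  proof -
    have L: "f \<in> L2 \<pi>" "f' \<in> L2 \<pi>" "h \<in> L2 \<pi>" "h' \<in> L2 \<pi>"
      using that by (auto simp: form_operator_iff intro: H1_L2 L20_L2)
    have "nm (\<lambda>x. 1 * f x + - 1 * f' x) \<le> C\<^sup>2 * nm (\<lambda>x. 1 * h x + - 1 * h' x)"
      by (rule bound[OF lincomb[OF that(1,2)]])
    also have "nm (\<lambda>x. 1 * h x + - 1 * h' x) = 0"
      using that(3) S.V_diff[OF L(3,4)] by (intro L2_norm_zero_AE) (auto simp: L2_borel)
    finally have "nm (\<lambda>x. f x - f' x) = 0" using S.nrm_nonneg[OF S.V_diff[OF L(1,2)]] by simp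
    then have "AE x in M. f x - f' x = 0"
      using S.V_diff[OF L(1,2)] by (intro L2_inner_zero_AE) (auto simp: L2_norm_def)
    then show ?thesis by eventually_elim simp
  qed
  have inner_cong: "ip h g = ip h' g"
    if "AE x in M. h x = h' x" "h \<in> L20 \<pi>" "h' \<in> L20 \<pi>" "g \<in> H1 \<pi>" for h h' g
    using that by (intro L2_inner_cong_AE) (auto intro: L20_L2 H1_L2)
  have closed: "(f', h') \<in> ?T"
    if T: "(f, h) \<in> ?T" and ae: "AE x in M. f x = f' x" "AE x in M. h x = h' x" and L: "f' \<in> L20 \<pi>" "h' \<in> L20 \<pi>"
    for f f' h h'
  proof -
    have f: "f \<in> H1 \<pi>" and h: "h \<in> L20 \<pi>" and eq: "\<And>g. g \<in> H1 \<pi> \<Longrightarrow> b f g = ip h g"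
      using T by (auto simp: form_operator_iff)
    have f': "f' \<in> H1 \<pi>" by (rule H1_cong_AE[OF f ae(1) L(1)])
    show ?thesis
      unfolding form_operator_iff using f' L(2) eq cong[OF f f' _ ae(1)] inner_cong[OF ae(2) h L(2)] by simp
  qed
  have single: "AE x in M. h x = h' x" if "(f, h) \<in> ?T" "(f', h') \<in> ?T" "AE x in M. f x = f' x" for f f' h h'
    using that cong[OF _ _ _ that(3)] by (intro H1_dense) (auto simp: form_operator_iff)
  have sub: "?T \<subseteq> L20 \<pi> \<times> L20 \<pi>" by (auto simp: form_operator_iff intro: H1_L20)
  have "is_operator \<pi> ?T"
    unfolding is_operator_def
  proof (intro conjI sub allI impI)
    fix f u g v assume T: "(f, u) \<in> ?T" and L: "g \<in> L20 \<pi>" "v \<in> L20 \<pi>" and ae: "AE x in M. f x = g x"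
    show "((g, v) \<in> ?T) = (AE x in M. u x = v x)"
      using single[OF T _ ae] closed[OF T ae _ L] by blast
  qed (rule lincomb)
  moreover have "is_operator \<pi> (?T\<inverse>)"
    unfolding is_operator_def converse_iff
  proof (intro conjI allI impI)
    show "?T\<inverse> \<subseteq> L20 \<pi> \<times> L20 \<pi>" using sub by auto
    fix f u g v assume T: "(u, f) \<in> ?T" and L: "g \<in> L20 \<pi>" "v \<in> L20 \<pi>" and ae: "AE x in M. f x = g x"
    show "((v, g) \<in> ?T) = (AE x in M. u x = v x)"
      using inj[OF T _ ae] closed[OF T _ ae L(2,1)] by blast
  qed (rule lincomb)
  moreover have "Domain (?T\<inverse>) = L20 \<pi>"
  proof -
    have "L20 \<pi> \<subseteq> Range ?T"
      using surj unfolding Range_iff subset_iff form_operator_iff by blast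
    then show ?thesis using sub by auto
  qed
  moreover have "\<exists>c. \<forall>(h, f)\<in>?T\<inverse>. nm f \<le> c * nm h"
    using bound by (intro exI[of _ "C\<^sup>2"]) auto
  ultimately show ?thesis by (simp add: invertible_operator_def bounded_operator_def)
qed

section \<open>Solving the variational equations\<close>

lemma L2_inner_bounded_functional: "h \<in> L20 \<pi> \<Longrightarrow> f \<in> H1 \<pi> \<Longrightarrow> \<bar>ip h f\<bar> \<le> (L2_norm \<pi> h * C) * D.nrm f"
  using S.cauchy_schwarz[of h f] mult_left_mono[OF H1_poincare[of f], of "nm h"] S.nrm_nonneg[of h]
  by (simp add: L20_L2 H1_L2 mult_ac)

lemma poisson_solvable: "h \<in> L20 \<pi> \<Longrightarrow> \<exists>u\<in>H1 \<pi>. \<forall>g\<in>H1 \<pi>. dirichlet \<pi> u g = ip h g"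
  by (rule D.riesz_representation[OF H1_complete _ L2_inner_bounded_functional])
    (auto simp: S.q_lincomb_right[simplified] H1_L2 L20_L2)

text \<open>\<open>inv_adv\<close> is \<open>(-S)\<^sup>-\<^sup>1 A\<close>.\<close>

definition inv_adv :: "('a \<Rightarrow> real) \<Rightarrow> 'a \<Rightarrow> real" where
  "inv_adv f = (SOME u. u \<in> H1 \<pi> \<and> (\<forall>g\<in>H1 \<pi>. dirichlet \<pi> u g = ip (adv f) g))"

lemma inv_adv:
  assumes "f \<in> H1 \<pi>"
  shows "inv_adv f \<in> H1 \<pi>" "g \<in> H1 \<pi> \<Longrightarrow> dirichlet \<pi> (inv_adv f) g = ip (adv f) g"
  using someI_ex[OF poisson_solvable[OF adv_L20[OF assms], unfolded Bex_def]]
  unfolding inv_adv_def by auto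

text \<open>Test the defining equation with the solution itself: its squared energy is a pairing
  with \<open>adv f\<close>. The bound on the drift contributes \<open>B\<close>, the Poincare
  inequality \<open>C\<close>.\<close>

lemma inv_adv_norm: "f \<in> H1 \<pi> \<Longrightarrow> D.nrm (inv_adv f) \<le> B * C * D.nrm f"
proof -
  assume f: "f \<in> H1 \<pi>"
  let ?u = "inv_adv f"
  note u = inv_adv(1)[OF f]
  have "D.nrm ?u * D.nrm ?u = ip (adv f) ?u"
    using D.nrm_sq[OF u] inv_adv(2)[OF f u] by (simp add: power2_eq_square)
  also have "\<dots> \<le> nm (adv f) * C * D.nrm ?u"
    using L2_inner_bounded_functional[OF adv_L20[OF f] u] by linarith
  also have "\<dots> \<le> (B * D.nrm f) * C * D.nrm ?u"
    using poincare_pos D.nrm_nonneg[OF u] by (intro mult_right_mono adv_norm f) auto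
  finally have "D.nrm ?u * D.nrm ?u \<le> (B * C * D.nrm f) * D.nrm ?u" by (simp add: mult_ac)
  then show ?thesis
    using D.nrm_nonneg[OF u] D.nrm_nonneg[OF f] B_nonneg poincare_pos by (cases "D.nrm ?u = 0") auto
qed

lemma adv_inv_adv_nonneg: "f \<in> H1 \<pi> \<Longrightarrow> 0 \<le> ip (adv f) (inv_adv f)"
  using inv_adv(2)[of f "inv_adv f"] inv_adv(1)[of f] D.q_nonneg[of "inv_adv f"] by simp

definition drift_form :: "real \<Rightarrow> ('a \<Rightarrow> real) \<Rightarrow> ('a \<Rightarrow> real) \<Rightarrow> real" where
  "drift_form \<alpha> f g = dirichlet \<pi> f g - \<alpha> * ip (adv f) g"

text \<open>Weak form of the effective operator, with the adjoint and the inverse moved to the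
  second argument. This makes linearity and null-set invariance in \<open>f\<close> those of
  \<open>adv\<close>; \<open>effective_form_eq\<close> shows the symmetric version.\<close>

definition effective_form :: "real \<Rightarrow> ('a \<Rightarrow> real) \<Rightarrow> ('a \<Rightarrow> real) \<Rightarrow> real" where
  "effective_form \<alpha> f g = dirichlet \<pi> f g + \<alpha>\<^sup>2 * ip (adv f) (inv_adv g)"

lemma effective_form_eq:
  "f \<in> H1 \<pi> \<Longrightarrow> g \<in> H1 \<pi> \<Longrightarrow> effective_form \<alpha> f g = dirichlet \<pi> f g + \<alpha>\<^sup>2 * dirichlet \<pi> (inv_adv f) (inv_adv g)"
  by (simp add: effective_form_def inv_adv)

text \<open>Antisymmetry of A combined with symmetry of the Dirichlet form: this is antisymmetry of
  \<open>K\<close> in H1.\<close>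

lemma adv_inv_adv:
  "f \<in> H1 \<pi> \<Longrightarrow> g \<in> H1 \<pi> \<Longrightarrow> ip (adv (inv_adv f)) g = - ip (adv f) (inv_adv g)"
  using adv_antisymmetric[OF inv_adv(1)] inv_adv S.q_sym[of "inv_adv f" "adv g"] D.q_sym[of "inv_adv f" "inv_adv g"]
  by (simp add: H1_L2 adv_L2)

lemma semi_inner_effective_form: "semi_inner (H1 \<pi>) (effective_form \<alpha>)"
proof
  show "(\<lambda>x. 0) \<in> H1 \<pi>" by (rule D.V_zero)
  fix f g h :: "'a \<Rightarrow> real" and a b :: real
  assume f: "f \<in> H1 \<pi>"
  show "0 \<le> effective_form \<alpha> f f"
    using f by (simp add: effective_form_def adv_inv_adv_nonneg D.q_nonneg)
  assume g: "g \<in> H1 \<pi>"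
  show "(\<lambda>x. a *\<^sub>R f x + b *\<^sub>R g x) \<in> H1 \<pi>" using f g by (rule D.V_lincomb)
  show "effective_form \<alpha> f g = effective_form \<alpha> g f"
    using f g D.q_sym[of f g] D.q_sym[of "inv_adv f" "inv_adv g"] by (simp add: effective_form_eq inv_adv)
  assume h: "h \<in> H1 \<pi>"
  show "effective_form \<alpha> (\<lambda>x. a *\<^sub>R f x + b *\<^sub>R g x) h = a * effective_form \<alpha> f h + b * effective_form \<alpha> g h"
    using D.q_lincomb[OF f g h, of a b] adv_lincomb[OF f g H1_L2[OF inv_adv(1)[OF h]], of a b]
    by (simp add: effective_form_def algebra_simps)
qed

text \<open>The squared effective norm adds \<open>\<alpha>^2\<close> times the squared energy of
  \<open>K f\<close>. It thus dominates the Dirichlet norm and is at most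
  \<open>1 + |\<alpha>| * B * C\<close> times it, so completeness and bounded functionals
  transfer.\<close>

lemma effective_form_solvable:
  assumes h: "h \<in> L20 \<pi>"
  shows "\<exists>u\<in>H1 \<pi>. \<forall>g\<in>H1 \<pi>. effective_form \<alpha> u g = ip h g"
proof -
  interpret E: semi_inner "H1 \<pi>" "effective_form \<alpha>" by (rule semi_inner_effective_form)
  have le: "D.nrm f \<le> E.nrm f" if "f \<in> H1 \<pi>" for f
    using that by (simp add: D.nrm_def E.nrm_def effective_form_def adv_inv_adv_nonneg)
  have ge: "E.nrm f \<le> (1 + \<bar>\<alpha>\<bar> * (B * C)) * D.nrm f" if f: "f \<in> H1 \<pi>" for f
  proof (rule power2_le_imp_le)
    have n: "0 \<le> D.nrm f" and nu: "0 \<le> D.nrm (inv_adv f)" by (intro D.nrm_nonneg inv_adv f)+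
    have BC: "0 \<le> B * C" using B_nonneg poincare_pos by simp
    have "(E.nrm f)\<^sup>2 = (D.nrm f)\<^sup>2 + (\<bar>\<alpha>\<bar> * D.nrm (inv_adv f))\<^sup>2"
      using f by (simp add: E.nrm_sq D.nrm_sq inv_adv effective_form_eq power_mult_distrib)
    also have "\<dots> \<le> (D.nrm f)\<^sup>2 + (\<bar>\<alpha>\<bar> * (B * C * D.nrm f))\<^sup>2"
      using nu by (intro add_left_mono power_mono mult_left_mono inv_adv_norm f) auto
    also have "\<dots> \<le> (D.nrm f + \<bar>\<alpha>\<bar> * (B * C * D.nrm f))\<^sup>2"
      using n BC by (simp add: power2_sum)
    also have "\<dots> = ((1 + \<bar>\<alpha>\<bar> * (B * C)) * D.nrm f)\<^sup>2" by (simp add: algebra_simps)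
    finally show "(E.nrm f)\<^sup>2 \<le> ((1 + \<bar>\<alpha>\<bar> * (B * C)) * D.nrm f)\<^sup>2" .
    show "0 \<le> (1 + \<bar>\<alpha>\<bar> * (B * C)) * D.nrm f" using n BC by simp
  qed
  show ?thesis
  proof (rule E.riesz_representation)
    fix F :: "nat \<Rightarrow> 'a \<Rightarrow> real"
    assume F: "\<And>n. F n \<in> H1 \<pi>"
      and cauchy: "\<And>e. e > 0 \<Longrightarrow> \<exists>N. \<forall>m\<ge>N. \<forall>n\<ge>N. E.nrm (\<lambda>x. F m x - F n x) < e"
    have "\<exists>f\<in>H1 \<pi>. (\<lambda>n. D.nrm (\<lambda>x. F n x - f x)) \<longlonglongrightarrow> 0"
    proof (rule H1_complete[OF F])
      fix e :: real assume "e > 0"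
      from cauchy[OF this] show "\<exists>N. \<forall>m\<ge>N. \<forall>n\<ge>N. D.nrm (\<lambda>x. F m x - F n x) < e"
        using le[OF D.V_diff[OF F F]] by (meson le_less_trans)
    qed
    then obtain f where f: "f \<in> H1 \<pi>" "(\<lambda>n. D.nrm (\<lambda>x. F n x - f x)) \<longlonglongrightarrow> 0" by blast
    have "(\<lambda>n. E.nrm (\<lambda>x. F n x - f x)) \<longlonglongrightarrow> 0"
    proof (rule Lim_null_comparison)
      show "\<forall>\<^sub>F n in sequentially. norm (E.nrm (\<lambda>x. F n x - f x)) \<le> (1 + \<bar>\<alpha>\<bar> * (B * C)) * D.nrm (\<lambda>x. F n x - f x)"
        using ge[OF D.V_diff[OF F f(1)]] E.nrm_nonneg[OF D.V_diff[OF F f(1)]] by (intro always_eventually allI) simp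
      show "(\<lambda>n. (1 + \<bar>\<alpha>\<bar> * (B * C)) * D.nrm (\<lambda>x. F n x - f x)) \<longlonglongrightarrow> 0"
        by (intro tendsto_mult_right_zero f(2))
    qed
    then show "\<exists>f\<in>H1 \<pi>. (\<lambda>n. E.nrm (\<lambda>x. F n x - f x)) \<longlonglongrightarrow> 0" using f(1) by blast
  next
    fix f g :: "'a \<Rightarrow> real" and a b :: real assume "f \<in> H1 \<pi>" "g \<in> H1 \<pi>"
    then show "ip h (\<lambda>x. a *\<^sub>R f x + b *\<^sub>R g x) = a * ip h f + b * ip h g"
      using h by (intro S.q_lincomb_right H1_L2 L20_L2)
  next
    fix f assume f: "f \<in> H1 \<pi>"
    show "\<bar>ip h f\<bar> \<le> (L2_norm \<pi> h * C) * E.nrm f"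
      using L2_inner_bounded_functional[OF h f] mult_left_mono[OF le[OF f], of "nm h * C"]
        S.nrm_nonneg[OF L20_L2[OF h]] poincare_pos by simp
  qed
qed

text \<open>With \<open>K = (-S)\<^sup>-\<^sup>1 A\<close> one has \<open>1 - \<alpha>\<^sup>2 K\<^sup>2 = (1 - \<alpha> K) (1 + \<alpha> K)\<close>, so a solution \<open>\<psi>\<close> of the symmetric
  problem gives the solution \<open>(1 + \<alpha> K) \<psi>\<close> of the nonsymmetric one.\<close>

lemma drift_form_solvable:
  assumes h: "h \<in> L20 \<pi>"
  shows "\<exists>u\<in>H1 \<pi>. \<forall>g\<in>H1 \<pi>. drift_form \<alpha> u g = ip h g"
proof -
  obtain \<psi> where \<psi>: "\<psi> \<in> H1 \<pi>" and eq: "\<And>g. g \<in> H1 \<pi> \<Longrightarrow> effective_form \<alpha> \<psi> g = ip h g"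
    using effective_form_solvable[OF h] by blast
  note K = inv_adv(1)[OF \<psi>]
  have "drift_form \<alpha> (\<lambda>x. 1 * \<psi> x + \<alpha> * inv_adv \<psi> x) g = ip h g" if g: "g \<in> H1 \<pi>" for g
  proof -
    have d: "dirichlet \<pi> (\<lambda>x. 1 * \<psi> x + \<alpha> * inv_adv \<psi> x) g = dirichlet \<pi> \<psi> g + \<alpha> * ip (adv \<psi>) g"
      using D.q_lincomb[OF \<psi> K g, of 1 \<alpha>] inv_adv(2)[OF \<psi> g] by simp
    have a: "ip (adv (\<lambda>x. 1 * \<psi> x + \<alpha> * inv_adv \<psi> x)) g
        = ip (adv \<psi>) g - \<alpha> * ip (adv \<psi>) (inv_adv g)"
      using adv_lincomb[OF \<psi> K H1_L2[OF g], of 1 \<alpha>] adv_inv_adv[OF \<psi> g] by simp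
    \<comment> \<open>The terms \<open>\<alpha> * ip (adv \<psi>) g\<close> cancel, leaving exactly
      the effective form of \<open>\<psi>\<close>.\<close>
    show ?thesis
      unfolding drift_form_def d a eq[OF g, symmetric] effective_form_def by (simp add: power2_eq_square algebra_simps)
  qed
  then show ?thesis using H1_lincomb[OF \<psi> K] by blast
qed

lemma dirichlet_cong_AE:
  assumes "f \<in> H1 \<pi>" "f' \<in> H1 \<pi>" "g \<in> H1 \<pi>" "AE x in M. f x = f' x"
  shows "dirichlet \<pi> f g = dirichlet \<pi> f' g"
  unfolding dirichlet_def using L2_grad_cong_AE[OF assms(1,2,4)]
  by (rule L2_inner_cong_AE) (auto intro: L2_grad_L2 assms)

lemma adv_inner_cong_AE:
  assumes "f \<in> H1 \<pi>" "f' \<in> H1 \<pi>" "g \<in> H1 \<pi>" "AE x in M. f x = f' x"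
  shows "ip (adv f) g = ip (adv f') g"
  using adv_cong_AE[OF assms(1,2,4)]
  by (rule L2_inner_cong_AE) (auto intro: adv_L2 H1_L2 assms)

text \<open>The drift vanishes on the diagonal by antisymmetry, so the form is coercive with
  constant 1 whatever the size of \<open>\<alpha>\<close>.\<close>

lemma invertible_drift: "invertible_operator \<pi> (form_operator (drift_form \<alpha>))"
proof (rule invertible_form_operator)
  fix f f' g :: "'a \<Rightarrow> real" and a c :: real
  assume f: "f \<in> H1 \<pi>" and f': "f' \<in> H1 \<pi>" and g: "g \<in> H1 \<pi>"
  show "drift_form \<alpha> (\<lambda>x. a * f x + c * f' x) g = a * drift_form \<alpha> f g + c * drift_form \<alpha> f' g"
    using D.q_lincomb[OF f f' g, of a c] adv_lincomb[OF f f' H1_L2[OF g], of a c]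
    by (simp add: drift_form_def algebra_simps)
  assume "AE x in M. f x = f' x"
  then show "drift_form \<alpha> f g = drift_form \<alpha> f' g"
    using dirichlet_cong_AE[OF f f' g] adv_inner_cong_AE[OF f f' g] by (simp add: drift_form_def)
qed (simp_all add: drift_form_def adv_self drift_form_solvable[unfolded drift_form_def])

lemma invertible_effective: "invertible_operator \<pi> (form_operator (effective_form \<alpha>))"
proof (rule invertible_form_operator)
  fix f f' g :: "'a \<Rightarrow> real" and a c :: real
  assume f: "f \<in> H1 \<pi>" and f': "f' \<in> H1 \<pi>" and g: "g \<in> H1 \<pi>"
  show "effective_form \<alpha> (\<lambda>x. a * f x + c * f' x) g = a * effective_form \<alpha> f g + c * effective_form \<alpha> f' g"
    using semi_inner.q_lincomb[OF semi_inner_effective_form f f' g, of \<alpha> a c] by simp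
  assume "AE x in M. f x = f' x"
  then show "effective_form \<alpha> f g = effective_form \<alpha> f' g"
    using dirichlet_cong_AE[OF f f' g] adv_inner_cong_AE[OF f f' inv_adv(1)[OF g]] by (simp add: effective_form_def)
qed (simp_all add: effective_form_def adv_inv_adv_nonneg effective_form_solvable[unfolded effective_form_def])

lemma form_operator_unique:
  assumes "invertible_operator \<pi> (form_operator b)" "(f, h) \<in> form_operator b" "(f', h) \<in> form_operator b"
  shows "AE x in M. f x = f' x"
proof -
  have op: "is_operator \<pi> ((form_operator b)\<inverse>)"
    using assms(1) by (simp add: invertible_operator_def bounded_operator_def)
  have L: "h \<in> L20 \<pi>" "f' \<in> L20 \<pi>" using assms(2,3) by (auto simp: form_operator_iff intro: H1_L20)
  show ?thesis
    using is_operator_AE[OF op _ L, of h f] assms(2,3) by simp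
qed

lemma form_operator_closed:
  assumes "invertible_operator \<pi> (form_operator b)" "(f, h) \<in> form_operator b" "AE x in M. f x = f' x" "f' \<in> L20 \<pi>"
  shows "(f', h) \<in> form_operator b"
proof -
  have op: "is_operator \<pi> (form_operator b)" using assms(1) by (simp add: invertible_operator_def)
  have "h \<in> L20 \<pi>" using assms(2) by (simp add: form_operator_iff)
  then show ?thesis using is_operator_AE[OF op assms(2,4) _ assms(3), of h] by simp
qed

section \<open>Identification of the concrete operators\<close>

lemma A_op_iff: "(f, h) \<in> A_op \<pi> \<gamma> \<longleftrightarrow> f \<in> H1 \<pi> \<and> h \<in> L20 \<pi> \<and> (AE x in M. h x = adv f x)"
  by (simp add: A_op_def adv_def)

lemma A_op_adv: "f \<in> H1 \<pi> \<Longrightarrow> (f, adv f) \<in> A_op \<pi> \<gamma>"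
  by (simp add: A_op_iff adv_L20)

lemma Domain_A_op: "Domain (A_op \<pi> \<gamma>) = H1 \<pi>"
proof
  show "Domain (A_op \<pi> \<gamma>) \<subseteq> H1 \<pi>" by (auto simp: A_op_iff)
  show "H1 \<pi> \<subseteq> Domain (A_op \<pi> \<gamma>)" using A_op_adv by blast
qed

text \<open>For \<open>g\<close> in H1 the adjoint value is fixed by its pairings with H1:
  antisymmetry identifies these as the pairings of \<open>- adv g\<close>, and H1 is dense.\<close>

lemma adjoint_A_op_iff:
  assumes g: "g \<in> H1 \<pi>"
  shows "(g, h) \<in> op_adjoint \<pi> (A_op \<pi> \<gamma>) \<longleftrightarrow> h \<in> L20 \<pi> \<and> (AE x in M. h x = - adv g x)"
proof
  have nadv: "(\<lambda>x. - adv g x) \<in> L20 \<pi>" using L20_scale[OF adv_L20[OF g], of "-1"] by simp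
  assume adj: "(g, h) \<in> op_adjoint \<pi> (A_op \<pi> \<gamma>)"
  then have h: "h \<in> L20 \<pi>" by (simp add: op_adjoint_def)
  have "ip h f = ip (\<lambda>x. - adv g x) f" if f: "f \<in> H1 \<pi>" for f
  proof -
    have "(f, adv f) \<in> A_op \<pi> \<gamma>" by (rule A_op_adv[OF f])
    then have "ip (adv f) g = ip f h" using adj by (auto simp: op_adjoint_def)
    then show ?thesis
      using adv_antisymmetric[OF f g] S.q_sym[of h f] S.q_sym[of f "adv g"] S.q_uminus[of "adv g" f] f g h
      by (simp add: H1_L2 L20_L2 adv_L2)
  qed
  then show "h \<in> L20 \<pi> \<and> (AE x in M. h x = - adv g x)" using H1_dense[OF h nadv] h by blast
next
  assume h: "h \<in> L20 \<pi> \<and> (AE x in M. h x = - adv g x)"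
  have "ip u g = ip f h" if "(f, u) \<in> A_op \<pi> \<gamma>" for f u
  proof -
    have f: "f \<in> H1 \<pi>" and u: "u \<in> L20 \<pi>" "AE x in M. u x = adv f x" using that by (auto simp: A_op_iff)
    have "ip u g = ip (adv f) g"
      by (rule L2_inner_cong_AE[OF u(2)]) (use f g u in \<open>auto intro: adv_L2 H1_L2 L20_L2\<close>)
    also have "\<dots> = ip f (\<lambda>x. - adv g x)"
      using adv_antisymmetric[OF f g] S.q_uminus_right[of "adv g" f] f g by (simp add: adv_L2 H1_L2)
    also have "\<dots> = ip f h"
      using h by (intro L2_inner_cong_AE) (use f g h in \<open>auto intro: S.V_uminus adv_L2 H1_L2 L20_L2 elim: AE_mp\<close>)
    finally show ?thesis .
  qed
  then show "(g, h) \<in> op_adjoint \<pi> (A_op \<pi> \<gamma>)"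
    using h H1_L20[OF g] by (auto simp: op_adjoint_def)
qed

text \<open>The adjoint in L20 can have a domain larger than H1 (for \<open>\<gamma> = 0\<close> it
  is all of L20), hence the restriction.\<close>

lemma adjoint_A_op: "op_restrict (op_adjoint \<pi> (A_op \<pi> \<gamma>)) (H1 \<pi>) = op_scale (- 1) (A_op \<pi> \<gamma>)"
proof -
  have "(g, h) \<in> op_restrict (op_adjoint \<pi> (A_op \<pi> \<gamma>)) (H1 \<pi>) \<longleftrightarrow> (g, h) \<in> op_scale (- 1) (A_op \<pi> \<gamma>)" for g h
  proof
    assume "(g, h) \<in> op_restrict (op_adjoint \<pi> (A_op \<pi> \<gamma>)) (H1 \<pi>)"
    then have g: "g \<in> H1 \<pi>" and h: "h \<in> L20 \<pi>" "AE x in M. h x = - adv g x"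
      using adjoint_A_op_iff by (auto simp: op_restrict_def)
    have "(g, \<lambda>x. - h x) \<in> A_op \<pi> \<gamma>"
      unfolding A_op_iff using g L20_scale[OF h(1), of "-1"] h(2) by auto
    then show "(g, h) \<in> op_scale (- 1) (A_op \<pi> \<gamma>)"
      unfolding op_scale_def by (auto intro!: exI[of _ "\<lambda>x. - h x"])
  next
    assume "(g, h) \<in> op_scale (- 1) (A_op \<pi> \<gamma>)"
    then obtain u where u: "(g, u) \<in> A_op \<pi> \<gamma>" "h = (\<lambda>x. - 1 * u x)" by (auto simp: op_scale_def)
    then have g: "g \<in> H1 \<pi>" and "u \<in> L20 \<pi>" "AE x in M. u x = adv g x" by (auto simp: A_op_iff)
    then have "h \<in> L20 \<pi> \<and> (AE x in M. h x = - adv g x)"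
      unfolding u(2) using L20_scale[of u "-1"] by auto
    then show "(g, h) \<in> op_restrict (op_adjoint \<pi> (A_op \<pi> \<gamma>)) (H1 \<pi>)"
      using g adjoint_A_op_iff[OF g] by (simp add: op_restrict_def)
  qed
  then show ?thesis by auto
qed

lemma neg_S_form: "neg_S \<pi> = form_operator (dirichlet \<pi>)"
proof -
  have "(f, h) \<in> neg_S \<pi> \<longleftrightarrow> (f, h) \<in> form_operator (dirichlet \<pi>)" for f h
  proof
    assume "(f, h) \<in> neg_S \<pi>"
    then obtain u where u: "h = (\<lambda>x. - 1 * u x)" "(f, u) \<in> S_op \<pi>" by (auto simp: op_scale_def)
    then show "(f, h) \<in> form_operator (dirichlet \<pi>)"
      using L20_scale[of u "-1"] S.q_uminus[of u] by (auto simp: S_op_def form_operator_iff L20_L2 H1_L2)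
  next
    assume "(f, h) \<in> form_operator (dirichlet \<pi>)"
    then have "(f, \<lambda>x. - h x) \<in> S_op \<pi>"
      using L20_scale[of h "-1"] S.q_uminus[of h] by (auto simp: S_op_def form_operator_iff L20_L2 H1_L2)
    then show "(f, h) \<in> neg_S \<pi>" unfolding op_scale_def by (auto intro!: exI[of _ "\<lambda>x. - h x"])
  qed
  then show ?thesis by auto
qed

text \<open>Integration against H1 functions turns the sum of graphs into one weak equation;
  conversely, a weak solution has to be split into values of S and A.\<close>

lemma neg_L_form: "neg_L \<pi> \<gamma> \<alpha> = form_operator (drift_form \<alpha>)"
proof -
  have "(f, h) \<in> neg_L \<pi> \<gamma> \<alpha> \<longleftrightarrow> (f, h) \<in> form_operator (drift_form \<alpha>)" for f h
  proof
    assume "(f, h) \<in> neg_L \<pi> \<gamma> \<alpha>"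
    then obtain s u where h: "h = (\<lambda>x. - 1 * (s x + \<alpha> * u x))" and s: "(f, s) \<in> S_op \<pi>" and u: "(f, u) \<in> A_op \<pi> \<gamma>"
      unfolding op_scale_def L_op_def op_plus_def by blast
    have f: "f \<in> H1 \<pi>" and sL: "s \<in> L20 \<pi>" and eq: "\<And>g. g \<in> H1 \<pi> \<Longrightarrow> dirichlet \<pi> f g = - ip s g"
      using s by (auto simp: S_op_def)
    have uL: "u \<in> L20 \<pi>" and ae: "AE x in M. u x = adv f x" using u by (auto simp: A_op_iff)
    have h': "h = (\<lambda>x. - 1 * s x + (- \<alpha>) * u x)" by (simp add: h algebra_simps)
    have "drift_form \<alpha> f g = ip h g" if g: "g \<in> H1 \<pi>" for g
    proof -
      have "ip u g = ip (adv f) g"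
        by (rule L2_inner_cong_AE[OF ae]) (use f g uL in \<open>auto intro: adv_L2 H1_L2 L20_L2\<close>)
      then show ?thesis
        using eq[OF g] S.q_lincomb[OF L20_L2[OF sL] L20_L2[OF uL] H1_L2[OF g], of "-1" "-\<alpha>"]
        by (simp add: h' drift_form_def)
    qed
    then show "(f, h) \<in> form_operator (drift_form \<alpha>)"
      unfolding form_operator_iff using f L20_lincomb[OF sL uL, of "-1" "-\<alpha>"] by (simp add: h')
  next
    assume "(f, h) \<in> form_operator (drift_form \<alpha>)"
    then have f: "f \<in> H1 \<pi>" and hL: "h \<in> L20 \<pi>" and eq: "\<And>g. g \<in> H1 \<pi> \<Longrightarrow> drift_form \<alpha> f g = ip h g"
      by (auto simp: form_operator_iff)
    \<comment> \<open>A takes the representative \<open>adv f\<close>, and \<open>s\<close> absorbs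
      the remainder, so the sum reproduces \<open>h\<close> as a function and not only up to a null
      set.\<close>
    define s where "s = (\<lambda>x. - 1 * h x + (- \<alpha>) * adv f x)"
    have "dirichlet \<pi> f g = - ip s g" if g: "g \<in> H1 \<pi>" for g
      using eq[OF g] S.q_lincomb[OF L20_L2[OF hL] adv_L2[OF f] H1_L2[OF g], of "-1" "-\<alpha>"]
      by (simp add: s_def drift_form_def)
    then have "(f, s) \<in> S_op \<pi>"
      unfolding S_op_def s_def using f L20_lincomb[OF hL adv_L20[OF f], of "-1" "-\<alpha>"] by simp
    moreover have "(f, adv f) \<in> A_op \<pi> \<gamma>" by (rule A_op_adv[OF f])
    ultimately have "(f, \<lambda>x. - 1 * (s x + \<alpha> * adv f x)) \<in> neg_L \<pi> \<gamma> \<alpha>"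
      unfolding L_op_def by (intro op_plusI op_scaleI)
    then show "(f, h) \<in> neg_L \<pi> \<gamma> \<alpha>" by (simp add: s_def)
  qed
  then show ?thesis by auto
qed

text \<open>The middle element of the composition solves a Poisson problem and so lies in H1, where
  the adjoint of A is known. Testing with \<open>g\<close> then shifts A and the inverse of -S onto
  \<open>g\<close>.\<close>

lemma effective_op_form: "effective_op \<pi> \<gamma> \<alpha> = form_operator (effective_form \<alpha>)"
proof -
  let ?N = "A_op \<pi> \<gamma> O (neg_S \<pi>)\<inverse> O op_adjoint \<pi> (A_op \<pi> \<gamma>)"
  have "(f, h) \<in> effective_op \<pi> \<gamma> \<alpha> \<longleftrightarrow> (f, h) \<in> form_operator (effective_form \<alpha>)" for f h
  proof
    assume "(f, h) \<in> effective_op \<pi> \<gamma> \<alpha>"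
    then obtain s w where h: "h = (\<lambda>x. s x + \<alpha>\<^sup>2 * w x)" and s: "(f, s) \<in> neg_S \<pi>" and w: "(f, w) \<in> ?N"
      unfolding effective_op_def op_plus_def op_scale_def[of "\<alpha>\<^sup>2"] by blast
    obtain u k where u: "(f, u) \<in> A_op \<pi> \<gamma>" and k: "(k, u) \<in> neg_S \<pi>" and kw: "(k, w) \<in> op_adjoint \<pi> (A_op \<pi> \<gamma>)"
      using w by auto
    have f: "f \<in> H1 \<pi>" and sL: "s \<in> L20 \<pi>" and eq: "\<And>g. g \<in> H1 \<pi> \<Longrightarrow> dirichlet \<pi> f g = ip s g"
      using s by (auto simp: neg_S_form form_operator_iff)
    have uL: "u \<in> L20 \<pi>" and ae: "AE x in M. u x = adv f x" using u by (auto simp: A_op_iff)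
    have kH: "k \<in> H1 \<pi>" and keq: "\<And>g. g \<in> H1 \<pi> \<Longrightarrow> dirichlet \<pi> k g = ip u g"
      using k by (auto simp: neg_S_form form_operator_iff)
    have wL: "w \<in> L20 \<pi>" and wae: "AE x in M. w x = - adv k x" using kw adjoint_A_op_iff[OF kH] by auto
    have "effective_form \<alpha> f g = ip h g" if g: "g \<in> H1 \<pi>" for g
    proof -
      note Kg = inv_adv(1)[OF g]
      have "ip w g = ip (\<lambda>x. - adv k x) g"
        by (rule L2_inner_cong_AE[OF wae]) (use g kH wL in \<open>auto intro: S.V_uminus adv_L2 H1_L2 L20_L2\<close>)
      also have "\<dots> = ip (adv g) k"
        using adv_antisymmetric[OF kH g] S.q_uminus[of "adv k" g] S.q_sym[of k "adv g"] kH g by (simp add: adv_L2 H1_L2)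
      also have "\<dots> = dirichlet \<pi> k (inv_adv g)"
        using inv_adv(2)[OF g kH] D.q_sym[OF Kg kH] by simp
      also have "\<dots> = ip u (inv_adv g)" by (rule keq[OF Kg])
      also have "\<dots> = ip (adv f) (inv_adv g)"
        by (rule L2_inner_cong_AE[OF ae]) (use f Kg uL in \<open>auto intro: adv_L2 H1_L2 L20_L2\<close>)
      finally show ?thesis
        using eq[OF g] S.q_lincomb[OF L20_L2[OF sL] L20_L2[OF wL] H1_L2[OF g], of 1 "\<alpha>\<^sup>2"]
        by (simp add: h effective_form_def)
    qed
    then show "(f, h) \<in> form_operator (effective_form \<alpha>)"
      unfolding form_operator_iff using f L20_lincomb[OF sL wL, of 1 "\<alpha>\<^sup>2"] by (simp add: h)
  next
    assume "(f, h) \<in> form_operator (effective_form \<alpha>)"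
    then have f: "f \<in> H1 \<pi>" and hL: "h \<in> L20 \<pi>" and eq: "\<And>g. g \<in> H1 \<pi> \<Longrightarrow> effective_form \<alpha> f g = ip h g"
      by (auto simp: form_operator_iff)
    note K = inv_adv(1)[OF f]
    define w where "w = (\<lambda>x. - adv (inv_adv f) x)"
    have wL: "w \<in> L20 \<pi>" unfolding w_def using L20_scale[OF adv_L20[OF K], of "-1"] by simp
    have "(f, w) \<in> ?N"
    proof (intro relcompI)
      show "(f, adv f) \<in> A_op \<pi> \<gamma>" by (rule A_op_adv[OF f])
      show "(adv f, inv_adv f) \<in> (neg_S \<pi>)\<inverse>"
        using f adv_L20[OF f] by (simp add: neg_S_form form_operator_iff inv_adv)
      show "(inv_adv f, w) \<in> op_adjoint \<pi> (A_op \<pi> \<gamma>)"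
        unfolding adjoint_A_op_iff[OF K] using wL by (simp add: w_def)
    qed
    \<comment> \<open>The value of -S is again chosen as the exact remainder after the second
      term.\<close>
    moreover have "(f, \<lambda>x. 1 * h x + (- \<alpha>\<^sup>2) * w x) \<in> neg_S \<pi>"
    proof -
      have "dirichlet \<pi> f g = ip (\<lambda>x. 1 * h x + (- \<alpha>\<^sup>2) * w x) g" if g: "g \<in> H1 \<pi>" for g
      proof -
        have "ip w g = ip (adv f) (inv_adv g)"
          unfolding w_def using S.q_uminus[OF adv_L2[OF K] H1_L2[OF g]] adv_inv_adv[OF f g] by simp
        then show ?thesis
          using eq[OF g] S.q_lincomb[OF L20_L2[OF hL] L20_L2[OF wL] H1_L2[OF g], of 1 "-\<alpha>\<^sup>2"]
          by (simp add: effective_form_def)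
      qed
      then show ?thesis
        unfolding neg_S_form form_operator_iff using f L20_lincomb[OF hL wL, of 1 "-\<alpha>\<^sup>2"] by blast
    qed
    ultimately have "(f, \<lambda>x. (1 * h x + (- \<alpha>\<^sup>2) * w x) + \<alpha>\<^sup>2 * w x) \<in> effective_op \<pi> \<gamma> \<alpha>"
      unfolding effective_op_def by (intro op_plusI op_scaleI)
    then show "(f, h) \<in> effective_op \<pi> \<gamma> \<alpha>" by simp
  qed
  then show ?thesis by auto
qed

lemma H2_H1: "H2 \<pi> \<subseteq> H1 \<pi>"
  by (auto simp: H2_def S_op_def)

lemma Domain_L_op: "Domain (L_op \<pi> \<gamma> \<alpha>) = H2 \<pi>"
  using H2_H1 by (auto simp: L_op_def Domain_op_plus Domain_op_scale Domain_A_op H2_def)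

text \<open>The second summand is defined on all of H1 because \<open>K\<close> maps H1 into itself;
  the domain is therefore that of S.\<close>

lemma Domain_effective_op: "Domain (effective_op \<pi> \<gamma> \<alpha>) = H2 \<pi>"
proof -
  have "H1 \<pi> \<subseteq> Domain (A_op \<pi> \<gamma> O (neg_S \<pi>)\<inverse> O op_adjoint \<pi> (A_op \<pi> \<gamma>))"
  proof
    fix f assume f: "f \<in> H1 \<pi>"
    note K = inv_adv(1)[OF f]
    have "(f, adv f) \<in> A_op \<pi> \<gamma>" by (rule A_op_adv[OF f])
    moreover have "(adv f, inv_adv f) \<in> (neg_S \<pi>)\<inverse>"
      using f adv_L20[OF f] by (simp add: neg_S_form form_operator_iff inv_adv)
    moreover have "(inv_adv f, \<lambda>x. - adv (inv_adv f) x) \<in> op_adjoint \<pi> (A_op \<pi> \<gamma>)"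
      unfolding adjoint_A_op_iff[OF K] using L20_scale[OF adv_L20[OF K], of "-1"] by simp
    ultimately show "f \<in> Domain (A_op \<pi> \<gamma> O (neg_S \<pi>)\<inverse> O op_adjoint \<pi> (A_op \<pi> \<gamma>))" by blast
  qed
  then show ?thesis
    using H2_H1 unfolding effective_op_def Domain_op_plus Domain_op_scale H2_def by blast
qed

section \<open>Adjoint and symmetric part of the inverse\<close>

lemma form_operator_ex: "invertible_operator \<pi> (form_operator b) \<Longrightarrow> h \<in> L20 \<pi> \<Longrightarrow> \<exists>f. (f, h) \<in> form_operator b"
  unfolding invertible_operator_def bounded_operator_def by blast

lemma drift_form_dual:
  "f \<in> H1 \<pi> \<Longrightarrow> g \<in> H1 \<pi> \<Longrightarrow> drift_form \<alpha> f g = drift_form (- \<alpha>) g f"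
  using adv_antisymmetric[of f g] D.q_sym[of f g] S.q_sym[of f "adv g"]
  by (simp add: drift_form_def adv_L2 H1_L2)

text \<open>Test the equation for \<open>\<alpha>\<close> with a solution for
  \<open>-\<alpha>\<close> and vice versa: the forms are transposes of each other. Since the
  equation for \<open>\<alpha>\<close> is solvable for every right-hand side, the adjoint value is
  determined up to a null set.\<close>

lemma adjoint_inverse_L:
  "op_adjoint \<pi> ((form_operator (drift_form \<alpha>))\<inverse>) = (form_operator (drift_form (- \<alpha>)))\<inverse>"
proof -
  let ?T = "form_operator (drift_form \<alpha>)" and ?T' = "form_operator (drift_form (- \<alpha>))"
  have dual: "ip u g = ip f h" if "(u, f) \<in> ?T" "(h, g) \<in> ?T'" for u f g h
  proof -
    have u: "u \<in> H1 \<pi>" and h: "h \<in> H1 \<pi>" and L: "f \<in> L20 \<pi>" "g \<in> L20 \<pi>"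
      using that by (auto simp: form_operator_iff)
    have "ip f h = drift_form \<alpha> u h" "ip g u = drift_form (- \<alpha>) h u"
      using that u h by (auto simp: form_operator_iff)
    then show ?thesis
      using drift_form_dual[OF u h] S.q_sym[of u g] u L by (simp add: H1_L2 L20_L2)
  qed
  have "(g, h) \<in> op_adjoint \<pi> (?T\<inverse>) \<longleftrightarrow> (g, h) \<in> ?T'\<inverse>" for g h
  proof
    assume adj: "(g, h) \<in> op_adjoint \<pi> (?T\<inverse>)"
    then have L: "g \<in> L20 \<pi>" "h \<in> L20 \<pi>" by (auto simp: op_adjoint_def)
    obtain h' where h': "(h', g) \<in> ?T'" using form_operator_ex[OF invertible_drift L(1)] by blast
    have h'L: "h' \<in> L20 \<pi>" using h' by (auto simp: form_operator_iff intro: H1_L20)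
    have "AE x in M. h' x = h x"
    proof (rule L20_AE_eq[OF h'L L(2)])
      fix f assume f: "f \<in> L20 \<pi>"
      obtain u where u: "(u, f) \<in> ?T" using form_operator_ex[OF invertible_drift f] by blast
      have "ip u g = ip f h" using adj u by (auto simp: op_adjoint_def)
      then show "ip h' f = ip h f"
        using dual[OF u h'] S.q_sym[of h' f] S.q_sym[of h f] f L h'L by (simp add: L20_L2)
    qed
    then show "(g, h) \<in> ?T'\<inverse>" using form_operator_closed[OF invertible_drift h' _ L(2)] by simp
  next
    assume "(g, h) \<in> ?T'\<inverse>"
    then show "(g, h) \<in> op_adjoint \<pi> (?T\<inverse>)"
      using dual by (auto simp: op_adjoint_def form_operator_iff intro: H1_L20)
  qed
  then show ?thesis by auto
qed

text \<open>If \<open>u\<close> and \<open>v\<close> solve the problems for \<open>\<alpha>\<close> and \<open>-\<alpha>\<close>, then \<open>w = (u + v) / 2\<close> and \<open>z = (u - v) / 2\<close>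
  satisfy \<open>-S w - \<alpha> A z = f\<close> and \<open>-S z = \<alpha> A w\<close>; eliminating \<open>z\<close> gives the effective equation.\<close>

lemma average_solves_effective:
  assumes "(u, f) \<in> form_operator (drift_form \<alpha>)" "(v, f) \<in> form_operator (drift_form (- \<alpha>))"
  shows "(\<lambda>x. 1 / 2 * (u x + v x), f) \<in> form_operator (effective_form \<alpha>)"
proof -
  have u: "u \<in> H1 \<pi>" and v: "v \<in> H1 \<pi>" and f: "f \<in> L20 \<pi>" using assms by (auto simp: form_operator_iff)
  define w where "w = (\<lambda>x. 1 / 2 * u x + 1 / 2 * v x)"
  define z where "z = (\<lambda>x. 1 / 2 * u x + (- 1 / 2) * v x)"
  have w: "w \<in> H1 \<pi>" and z: "z \<in> H1 \<pi>" unfolding w_def z_def by (intro H1_lincomb u v)+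
  have eqs: "dirichlet \<pi> w g - \<alpha> * ip (adv z) g = ip f g"
    "dirichlet \<pi> z g = \<alpha> * ip (adv w) g" if g: "g \<in> H1 \<pi>" for g
  proof -
    have u_eq: "dirichlet \<pi> u g = ip f g + \<alpha> * ip (adv u) g"
      and v_eq: "dirichlet \<pi> v g = ip f g - \<alpha> * ip (adv v) g"
      using assms g by (auto simp: form_operator_iff drift_form_def)
    have d: "dirichlet \<pi> w g = 1 / 2 * dirichlet \<pi> u g + 1 / 2 * dirichlet \<pi> v g"
      "dirichlet \<pi> z g = 1 / 2 * dirichlet \<pi> u g + (- 1 / 2) * dirichlet \<pi> v g"
      unfolding w_def z_def using D.q_lincomb[OF u v g, of "1 / 2" "1 / 2"] D.q_lincomb[OF u v g, of "1 / 2" "- 1 / 2"]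
      by simp_all
    have a: "ip (adv w) g = 1 / 2 * ip (adv u) g + 1 / 2 * ip (adv v) g"
      "ip (adv z) g = 1 / 2 * ip (adv u) g + (- 1 / 2) * ip (adv v) g"
      unfolding w_def z_def by (intro adv_lincomb u v H1_L2 g)+
    show "dirichlet \<pi> w g - \<alpha> * ip (adv z) g = ip f g"
      "dirichlet \<pi> z g = \<alpha> * ip (adv w) g"
      unfolding d a u_eq v_eq by (simp_all add: algebra_simps)
  qed
  have "effective_form \<alpha> w g = ip f g" if g: "g \<in> H1 \<pi>" for g
  proof -
    note K = inv_adv(1)[OF g]
    have "ip (adv z) g = - dirichlet \<pi> z (inv_adv g)"
      using adv_antisymmetric[OF z g] inv_adv(2)[OF g z] D.q_sym[OF K z] S.q_sym[of z "adv g"] z g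
      by (simp add: H1_L2 adv_L2)
    also have "\<dots> = - (\<alpha> * ip (adv w) (inv_adv g))" using eqs(2)[OF K] by simp
    finally show ?thesis using eqs(1)[OF g] by (simp add: effective_form_def power2_eq_square)
  qed
  then have "(w, f) \<in> form_operator (effective_form \<alpha>)" using w f by (simp add: form_operator_iff)
  moreover have "w = (\<lambda>x. 1 / 2 * (u x + v x))" by (auto simp: w_def)
  ultimately show ?thesis by simp
qed

text \<open>One inclusion is the averaging of solutions; the other needs, in addition, uniqueness
  for the effective equation and an adjustment on a null set.\<close>

lemma sym_part_inverse_L: "sym_part \<pi> ((neg_L \<pi> \<gamma> \<alpha>)\<inverse>) = (effective_op \<pi> \<gamma> \<alpha>)\<inverse>"
proof -
  let ?T = "form_operator (drift_form \<alpha>)" and ?T' = "form_operator (drift_form (- \<alpha>))"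
    and ?E = "form_operator (effective_form \<alpha>)"
  have symI: "(f, \<lambda>x. 1 / 2 * (u x + v x)) \<in> sym_part \<pi> (?T\<inverse>)" if "(u, f) \<in> ?T" "(v, f) \<in> ?T'" for f u v
    unfolding sym_part_def adjoint_inverse_L using that by (intro op_scaleI op_plusI) simp_all
  have "?E\<inverse> \<subseteq> sym_part \<pi> (?T\<inverse>)"
  proof (rule subrelI)
    fix f w assume "(f, w) \<in> ?E\<inverse>"
    then have w: "(w, f) \<in> ?E" by simp
    then have f: "f \<in> L20 \<pi>" and wL: "w \<in> L20 \<pi>" by (auto simp: form_operator_iff intro: H1_L20)
    obtain u v where u: "(u, f) \<in> ?T" and v: "(v, f) \<in> ?T'"
      using form_operator_ex[OF invertible_drift f] by blast
    have uL: "u \<in> L20 \<pi>" and vL: "v \<in> L20 \<pi>" using u v by (auto simp: form_operator_iff intro: H1_L20)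
    have ae: "AE x in M. w x = 1 / 2 * (u x + v x)"
      by (rule form_operator_unique[OF invertible_effective w average_solves_effective[OF u v]])
    \<comment> \<open>\<open>w\<close> agrees with the average only almost everywhere, whereas sums
      of graphs are formed pointwise. Adding the null function \<open>d\<close> to both solutions
      makes the average equal to \<open>w\<close> everywhere.\<close>
    define d where "d x = 1 * w x + (- 1 / 2) * (1 * u x + 1 * v x)" for x
    have dL: "d \<in> L20 \<pi>" unfolding d_def by (intro L20_lincomb wL uL vL)
    have d0: "AE x in M. d x = 0" using ae by eventually_elim (simp add: d_def)
    have shifted: "(\<lambda>x. u x + d x, f) \<in> ?T" "(\<lambda>x. v x + d x, f) \<in> ?T'"
      by (rule form_operator_closed[OF invertible_drift u], use d0 in \<open>eventually_elim, simp\<close>,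
          use L20_lincomb[OF uL dL, of 1 1] in simp)
        (rule form_operator_closed[OF invertible_drift v], use d0 in \<open>eventually_elim, simp\<close>,
          use L20_lincomb[OF vL dL, of 1 1] in simp)
    have w_eq: "w = (\<lambda>x. 1 / 2 * ((u x + d x) + (v x + d x)))" by (auto simp: d_def fun_eq_iff field_simps)
    show "(f, w) \<in> sym_part \<pi> (?T\<inverse>)" by (subst w_eq) (rule symI[OF shifted])
  qed
  moreover have "sym_part \<pi> (?T\<inverse>) \<subseteq> ?E\<inverse>"
  proof (rule subrelI)
    fix f w assume "(f, w) \<in> sym_part \<pi> (?T\<inverse>)"
    then obtain y where w: "w = (\<lambda>x. 1 / 2 * y x)" and y: "(f, y) \<in> op_plus (?T\<inverse>) (?T'\<inverse>)"
      unfolding sym_part_def adjoint_inverse_L op_scale_def by blast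
    obtain u v where "y = (\<lambda>x. u x + v x)" "(u, f) \<in> ?T" "(v, f) \<in> ?T'"
      using y unfolding op_plus_def by blast
    then show "(f, w) \<in> ?E\<inverse>" unfolding w using average_solves_effective by simp
  qed
  ultimately show ?thesis unfolding neg_L_form effective_op_form by blast
qed

section \<open>Asymptotic variance\<close>

lemma drift_form_0: "drift_form 0 = dirichlet \<pi>"
  by (simp add: drift_form_def fun_eq_iff)

text \<open>Makes every statement about -S the instance of vanishing drift strength of the statement
  about -L.\<close>

lemma neg_S_eq_neg_L_0: "neg_S \<pi> = neg_L \<pi> \<gamma> 0"
  by (simp add: neg_S_form neg_L_form drift_form_0)

lemma invertible_neg_L: "invertible_operator \<pi> (neg_L \<pi> \<gamma> \<alpha>)"
  by (simp add: neg_L_form invertible_drift)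

lemma invertible_effective_op: "invertible_operator \<pi> (effective_op \<pi> \<gamma> \<alpha>)"
  by (simp add: effective_op_form invertible_effective)

lemma neg_L_unique: "(\<phi>, f) \<in> neg_L \<pi> \<gamma> \<alpha> \<Longrightarrow> (\<psi>, f) \<in> neg_L \<pi> \<gamma> \<alpha> \<Longrightarrow> AE x in M. \<phi> x = \<psi> x"
  unfolding neg_L_form by (rule form_operator_unique[OF invertible_drift])

text \<open>Testing with the solution itself removes the drift, which is antisymmetric.\<close>

lemma energy_identity:
  assumes "(\<phi>, f) \<in> neg_L \<pi> \<gamma> \<alpha>"
  shows "\<phi> \<in> H1 \<pi>" "f \<in> L20 \<pi>" "dirichlet \<pi> \<phi> \<phi> = ip f \<phi>"
  using assms by (auto simp: neg_L_form form_operator_iff drift_form_def adv_self)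

lemma op_apply_inverse_L:
  assumes "f \<in> L20 \<pi>"
  shows "(op_apply ((neg_L \<pi> \<gamma> \<alpha>)\<inverse>) f, f) \<in> neg_L \<pi> \<gamma> \<alpha>"
proof -
  have "\<exists>u. (f, u) \<in> (neg_L \<pi> \<gamma> \<alpha>)\<inverse>"
    using form_operator_ex[OF invertible_drift assms] by (simp add: neg_L_form)
  from someI_ex[OF this] show ?thesis unfolding op_apply_def converse_iff .
qed

text \<open>The solution chosen in \<open>asymp_var\<close> and the one chosen by
  \<open>op_apply\<close> may be different functions; uniqueness makes them equal almost everywhere,
  and the pairing with \<open>f\<close> does not see the difference.\<close>

lemma asymp_var_eq:
  assumes f: "f \<in> L20 \<pi>"
  shows "asymp_var \<pi> \<gamma> \<alpha> f = 2 * ip f (op_apply ((neg_L \<pi> \<gamma> \<alpha>)\<inverse>) f)"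
proof -
  let ?u = "op_apply ((neg_L \<pi> \<gamma> \<alpha>)\<inverse>) f"
  let ?P = "\<lambda>\<phi>. \<phi> \<in> H1 \<pi> \<and> (\<phi>, f) \<in> neg_L \<pi> \<gamma> \<alpha>"
  note u = op_apply_inverse_L[OF f, of \<alpha>]
  define \<phi> where "\<phi> = (SOME \<phi>. ?P \<phi>)"
  have "?P \<phi>" unfolding \<phi>_def by (rule someI[of ?P ?u]) (use u energy_identity(1)[OF u] in blast)
  then have \<phi>: "(\<phi>, f) \<in> neg_L \<pi> \<gamma> \<alpha>" by blast
  have "AE x in M. \<phi> x = ?u x"
    by (rule neg_L_unique[OF \<phi> u])
  then have "ip f \<phi> = ip f ?u"
    using energy_identity(1)[OF u] energy_identity(1)[OF \<phi>] f
    by (intro L2_inner_cong_AE) (auto intro: H1_L2 L20_L2)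
  then show ?thesis
    using energy_identity(3)[OF \<phi>] unfolding asymp_var_def \<phi>_def[symmetric] by (simp add: Let_def)
qed

text \<open>For \<open>\<phi> = (-L)\<^sup>-\<^sup>1 f\<close> and \<open>\<eta> = (-S)\<^sup>-\<^sup>1 f\<close> the energy identity gives
  \<open>\<parallel>\<phi>\<parallel>\<^sub>1\<^sup>2 = \<langle>f, \<phi>\<rangle> = \<langle>\<eta>, \<phi>\<rangle>\<^sub>1 \<le> \<parallel>\<eta>\<parallel>\<^sub>1 \<parallel>\<phi>\<parallel>\<^sub>1\<close>.\<close>

lemma inverse_L_le_inverse_S:
  assumes f: "f \<in> L20 \<pi>"
  shows "ip f (op_apply ((neg_L \<pi> \<gamma> \<alpha>)\<inverse>) f) \<le> ip f (op_apply ((neg_L \<pi> \<gamma> 0)\<inverse>) f)"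
proof -
  let ?\<phi> = "op_apply ((neg_L \<pi> \<gamma> \<alpha>)\<inverse>) f" and ?\<eta> = "op_apply ((neg_L \<pi> \<gamma> 0)\<inverse>) f"
  note \<phi> = op_apply_inverse_L[OF f, of \<alpha>] and \<eta> = op_apply_inverse_L[OF f, of 0]
  note H = energy_identity(1)[OF \<phi>] energy_identity(1)[OF \<eta>]
  have "ip f ?\<phi> = dirichlet \<pi> ?\<eta> ?\<phi>"
    using \<eta> H(1) by (simp add: neg_L_form form_operator_iff drift_form_0)
  then have "(D.nrm ?\<phi>)\<^sup>2 \<le> D.nrm ?\<eta> * D.nrm ?\<phi>"
    using D.cauchy_schwarz[OF H(2,1)] energy_identity(3)[OF \<phi>] D.nrm_sq[OF H(1)] by simp
  then have "D.nrm ?\<phi> \<le> D.nrm ?\<eta>"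
    using D.nrm_nonneg[OF H(1)] D.nrm_nonneg[OF H(2)] by (cases "D.nrm ?\<phi> = 0") (auto simp: power2_eq_square)
  then have "(D.nrm ?\<phi>)\<^sup>2 \<le> (D.nrm ?\<eta>)\<^sup>2" using D.nrm_nonneg[OF H(1)] by (rule power_mono)
  then show ?thesis
    using energy_identity(3)[OF \<phi>] energy_identity(3)[OF \<eta>] D.nrm_sq[OF H(1)] D.nrm_sq[OF H(2)] by simp
qed

end

theorem lemma3:
  fixes \<pi> :: "real ^ 'd \<Rightarrow> real" and \<gamma> :: "real ^ 'd \<Rightarrow> real ^ 'd" and \<alpha> :: real
  assumes "smooth \<pi>" and "\<forall>x. \<pi> x > 0" and "prob_space (dens_measure \<pi>)"
    and "smooth \<gamma>" and "\<forall>x. divergence (\<lambda>y. \<pi> y *\<^sub>R \<gamma> y) x = 0"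
    and "bounded (range \<pi>)"
    and "\<exists>\<beta>::real. 0 < \<beta> \<and> \<beta> < 1 \<and>
           Liminf at_infinity (\<lambda>x. ereal ((1 - \<beta>) * (norm (grad (\<lambda>y. ln (\<pi> y)) x))\<^sup>2
             + laplacian (\<lambda>y. ln (\<pi> y)) x)) > 0"
    and "filterlim (\<lambda>x. norm (grad (\<lambda>y. ln (\<pi> y)) x)) at_top at_infinity"
    and "bounded (range \<gamma>)"
  shows "invertible_operator \<pi> (neg_S \<pi>)
    \<and> Domain (A_op \<pi> \<gamma>) = H1 \<pi>
    \<and> invertible_operator \<pi> (neg_L \<pi> \<gamma> \<alpha>) \<and> Domain (L_op \<pi> \<gamma> \<alpha>) = H2 \<pi>
    \<and> invertible_operator \<pi> (effective_op \<pi> \<gamma> \<alpha>) \<and> Domain (effective_op \<pi> \<gamma> \<alpha>) = H2 \<pi>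
    \<and> op_restrict (op_adjoint \<pi> (A_op \<pi> \<gamma>)) (H1 \<pi>) = op_scale (-1) (A_op \<pi> \<gamma>)
    \<and> sym_part \<pi> ((neg_L \<pi> \<gamma> \<alpha>)\<inverse>) = (effective_op \<pi> \<gamma> \<alpha>)\<inverse>
    \<and> (\<forall>f\<in>L20 \<pi>.
         asymp_var \<pi> \<gamma> \<alpha> f = 2 * L2_inner \<pi> f (op_apply ((neg_L \<pi> \<gamma> \<alpha>)\<inverse>) f)
       \<and> 2 * L2_inner \<pi> f (op_apply ((neg_L \<pi> \<gamma> \<alpha>)\<inverse>) f)
           \<le> 2 * L2_inner \<pi> f (op_apply ((neg_S \<pi>)\<inverse>) f)
       \<and> 2 * L2_inner \<pi> f (op_apply ((neg_S \<pi>)\<inverse>) f) = asymp_var \<pi> \<gamma> 0 f)"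
proof -
  interpret smooth_density \<pi>
    by (rule smooth_density.intro) (use assms(1-3) in blast)+
  obtain \<beta> where \<beta>: "0 < \<beta>" "Liminf at_infinity (\<lambda>x. ereal ((1 - \<beta>) * (norm (grad (\<lambda>y. ln (\<pi> y)) x))\<^sup>2
             + laplacian (\<lambda>y. ln (\<pi> y)) x)) > 0"
    using assms(7) by blast
  obtain C where C: "C > 0"
    "\<And>f G. has_L2_gradient \<pi> f G \<Longrightarrow> (LINT x|M. f x) = 0 \<Longrightarrow> L2_norm \<pi> f \<le> C * L2_norm \<pi> G"
    by (rule poincare_inequality[OF \<beta> that])
  obtain B where B: "\<And>x. norm (\<gamma> x) \<le> B" using assms(9) by (auto simp: bounded_iff)
  interpret divergence_free_drift \<pi> \<gamma> B C
  proof unfold_locales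
    show "C_k (Suc 0) \<gamma>" by (rule smoothD[OF assms(4)])
  qed (use C B assms(5) in blast)+
  show ?thesis
    unfolding neg_S_eq_neg_L_0
    by (intro conjI ballI invertible_neg_L Domain_A_op Domain_L_op invertible_effective_op Domain_effective_op
        adjoint_A_op sym_part_inverse_L asymp_var_eq asymp_var_eq[symmetric] mult_left_mono inverse_L_le_inverse_S) simp_all
qed

end
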